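(* Let $p\ge2$ be an integer, $\lambda_p=\frac{p-1}{\sqrt{2p}}$, $\beta=\frac{p-1}{2p}\alpha$. There is a logarithmic intertwining operator of $\overline{M(1)_p}$-modules $$\mathcal Y\in I\binom{M(1)_p\otimes\Omega_1}{M(1)_p\otimes\Omega\quad M(1,\beta)}$$ such that $$\mathcal Y(w_1,x)=E^-(\lambda_p,x)E^+(\lambda_p,x)\,T(w_1)\,(1+\lambda_p\log(x)h_n(0))\,x^{\lambda_ph_s(0)},$$ $$\begin{aligned}\mathcal Y(w_2,x)=&\ \Big(\int^-h(x)\Big)E^-(\lambda_p,x)E^+(\lambda_p,x)\,T(w_1)\,(1+\lambda_p\log(x)h_n(0))\,x^{\lambda_ph_s(0)}\\&+E^-(\lambda_p,x)E^+(\lambda_p,x)\,T(w_1)\,(1+\lambda_p\log(x)h_n(0))\,x^{\lambda_ph_s(0)}\Big(\int^+h(x)\Big)\\&+E^-(\lambda_p,x)E^+(\lambda_p,x)\,T(w_2)\,(1+\lambda_p\log(x)h_n(0))\,x^{\lambda_ph_s(0)},\end{aligned}$$ where $\int^+h(x)=h(0)\log(x)+\sum_{m>0}\frac{h(m)x^{-m}}{-m}$ and $\int^-h(x)=\sum_{m<0}\frac{h(m)x^{-m}}{-m}$.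
   Context: Fix an integer $p\ge2$. Let $L=\mathbb Z\alpha$, $\langle\alpha,\alpha\rangle=2p$, $\mathfrak h=\mathbb C\otimes_{\mathbb Z}L$, $h=\alpha/\sqrt{2p}$, and $\widehat{\mathfrak h}$ the Heisenberg Lie algebra, $[a(m),b(n)]=m\langle a,b\rangle\delta_{m+n,0}c$. $M(1)$ is the level-one Heisenberg vertex algebra; $M(1)_p$ is $M(1)$ with conformal vector $\omega=\frac1{4p}\alpha(-1)^2\mathbf 1+\frac{p-1}{2p}\alpha(-2)\mathbf 1$. For a finite-dimensional $\Omega'$ with an operator $h(0)$, $M(1)_p\otimes\Omega'$ is the level-one $\widehat{\mathfrak h}$-module with $h(n)$, $n\ne0$, acting on $M(1)$ and $h(0)$ acting on $\Omega'$; it is an $M(1)_p$-module (with $L(0)$ possibly non-diagonalizable). $M(1,\beta)=M(1)\otimes\mathbb C_\beta$, where $\mathbb C_\beta$ is one-dimensional with $h(0)=\langle h,\beta\rangle=\lambda_p$. $\Omega$ has basis $w_1,w_2$ with $h(0)w_1=\lambda_pw_1$, $h(0)w_2=\lambda_pw_2+w_1$. $\Omega_1$ is two-dimensional with $(h(0)-2\lambda_p)^2=0$, $h(0)\ne2\lambda_p$; $M(1)_p\otimes\Omega_1$ is logarithmic, i.e. $L(0)$ is not diagonalizable. $w_i$ is identified with $\mathbf 1\otimes w_i$. $\overline{M(1)_p}=\mathrm{Ker}_{M(1)}\,e^{-\alpha/p}_0$, where in the generalized lattice vertex algebra of $\mathbb Z\frac{\alpha}{2p}$ (trivial cocycle)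 $Y(e^\gamma,x)=\exp(\sum_{k>0}\frac{\gamma(-k)}{k}x^{k})\exp(-\sum_{k>0}\frac{\gamma(k)}{k}x^{-k})e^{\gamma}x^{\gamma(0)}=\sum_n e^\gamma_nx^{-n-1}$; it is a vertex operator subalgebra of $M(1)_p$ and $M(1)_p$-modules are $\overline{M(1)_p}$-modules by restriction. A logarithmic intertwining operator of type $\binom{W_3}{W_1\ W_2}$ is a linear map $\mathcal Y(\cdot,x):W_1\to\mathrm{Hom}(W_2,W_3)\{x\}[\log x]$ satisfying lower truncation, the Jacobi identity, and $\mathcal Y(L(-1)w,x)=\frac{d}{dx}\mathcal Y(w,x)$. Notation: $h(0)=h_s(0)+h_n(0)$ is the decomposition into semisimple and nilpotent parts on the module acted on; $E^{\pm}(\lambda_p,x)=\exp\big(\lambda_p\sum_{\pm m>0}\frac{h(m)x^{-m}}{-m}\big)$; $T=T_{\Omega,\beta}^{\Omega_1}\in\mathrm{Hom}(\Omega,\mathrm{Hom}(\mathbb C_\beta,\Omega_1))$ corresponds to the $\mathfrak h$-module isomorphism $\Omega\otimes\mathbb C_\beta\cong\Omega_1$ ($h(0)$ acting on the tensor product as $h(0)\otimes1+1\otimes h(0)$), and $T(w)$ is extended to $M(1)\otimes\mathbb C_\beta\to M(1)\otimes\Omega_1$ as the identity on $M(1)$. *)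

theory Defs
  imports Complex_Main "HOL-Library.Multiset" "HOL-Library.Poly_Mapping"
begin

text \<open>
  The one-dimensional space \<open>\<hh>\<close> is identified with the complex numbers by letting \<open>h\<close>
  correspond to \<open>1\<close>, so that \<open>\<langle>a, b\<rangle> = a * b\<close>.  The central element \<open>c\<close> acts as \<open>1\<close> throughout.
\<close>

definition hform :: "complex \<Rightarrow> complex \<Rightarrow> complex"
  where "hform a b = a * b"

definition alpha :: "nat \<Rightarrow> complex"
  where "alpha p = complex_of_real (sqrt (2 * real p))"

definition beta :: "nat \<Rightarrow> complex"
  where "beta p = (of_nat p - 1) / (2 * of_nat p) * alpha p"

definition lambda :: "nat \<Rightarrow> complex"
  where "lambda p = (of_nat p - 1) / complex_of_real (sqrt (2 * real p))"

lemma alpha_form: "hform (alpha p) (alpha p) = 2 * of_nat p"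
proof -
  have "sqrt (2 * real p) * sqrt (2 * real p) = 2 * real p" by simp
  then show ?thesis
    unfolding hform_def alpha_def of_real_mult[symmetric] by simp
qed

lemma h_beta_form:
  assumes "p \<ge> 1"
  shows "hform 1 (beta p) = lambda p"
proof -
  have sq: "alpha p * alpha p = 2 * of_nat p" using alpha_form by (simp only: hform_def)
  have "alpha p \<noteq> 0" using assms by (simp add: alpha_def)
  then have "(of_nat p - 1) / (alpha p * alpha p) * alpha p = (of_nat p - 1) / alpha p"
    by simp
  then have "beta p = lambda p"
    unfolding beta_def lambda_def sq by (simp only: alpha_def)
  then show ?thesis by (simp only: hform_def mult_1)
qed


section \<open>The level-one Heisenberg modules\<close>

text \<open>
  \<open>M(1) \<otimes> \<Omega>'\<close> is the space of finitely supported functions from the monomials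
  \<open>h(-n\<^sub>1) \<cdots> h(-n\<^sub>r) \<one>\<close> (\<open>n\<^sub>j \<ge> 1\<close>) to \<open>\<Omega>'\<close>.  The monomial is encoded as the multiset
  \<open>{#n\<^sub>1 - 1, \<dots>, n\<^sub>r - 1#}\<close>, i.e. an element \<open>i\<close> stands for a factor \<open>h(-(i+1))\<close>;
  \<open>Poly_Mapping.single {#} w\<close> is \<open>\<one> \<otimes> w\<close>.  The space \<open>M(1)\<close> itself is \<open>complex fock\<close>.
\<close>

type_synonym 'w fock = "nat multiset \<Rightarrow>\<^sub>0 'w"

definition fock_scale :: "(complex \<Rightarrow> 'w \<Rightarrow> 'w::zero) \<Rightarrow> complex \<Rightarrow> 'w fock \<Rightarrow> 'w fock"
  where "fock_scale sc c = Poly_Mapping.map (sc c)"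

lift_definition fock_create :: "nat \<Rightarrow> 'w::zero fock \<Rightarrow> 'w fock"
  is "\<lambda>i f \<mu>. if i \<in># \<mu> then f (\<mu> - {#i#}) else 0"
proof -
  fix i :: nat and f :: "nat multiset \<Rightarrow> 'w"
  assume "finite {\<mu>. f \<mu> \<noteq> 0}"
  moreover have "{\<mu>. (if i \<in># \<mu> then f (\<mu> - {#i#}) else 0) \<noteq> 0} \<subseteq> add_mset i ` {\<mu>. f \<mu> \<noteq> 0}"
    by (auto split: if_splits intro!: image_eqI)
  ultimately show "finite {\<mu>. (if i \<in># \<mu> then f (\<mu> - {#i#}) else 0) \<noteq> 0}"
    by (meson finite_imageI finite_subset)
qed

text \<open>\<open>h(i+1)\<close> acts on \<open>M(1)\<close> as \<open>(i+1)\<close> times the derivative by \<open>h(-(i+1))\<close>.\<close>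

lift_definition fock_annihilate :: "(complex \<Rightarrow> 'w \<Rightarrow> 'w) \<Rightarrow> nat \<Rightarrow> 'w::zero fock \<Rightarrow> 'w fock"
  is "\<lambda>sc i f \<mu>. sc (of_nat ((i + 1) * (count \<mu> i + 1))) (f (add_mset i \<mu>))
        when f (add_mset i \<mu>) \<noteq> 0"
proof -
  fix sc :: "complex \<Rightarrow> 'w \<Rightarrow> 'w" and i :: nat and f :: "nat multiset \<Rightarrow> 'w"
  let ?g = "\<lambda>\<mu>. sc (of_nat ((i + 1) * (count \<mu> i + 1))) (f (add_mset i \<mu>))
              when f (add_mset i \<mu>) \<noteq> 0"
  assume "finite {\<mu>. f \<mu> \<noteq> 0}"
  moreover have "{\<mu>. ?g \<mu> \<noteq> 0} \<subseteq> (\<lambda>\<mu>. \<mu> - {#i#}) ` {\<mu>. f \<mu> \<noteq> 0}"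
  proof
    fix \<mu> assume "\<mu> \<in> {\<mu>. ?g \<mu> \<noteq> 0}"
    then show "\<mu> \<in> (\<lambda>\<mu>. \<mu> - {#i#}) ` {\<mu>. f \<mu> \<noteq> 0}"
      by (intro image_eqI[where x = "add_mset i \<mu>"]) auto
  qed
  ultimately show "finite {\<mu>. ?g \<mu> \<noteq> 0}"
    by (meson finite_imageI finite_subset)
qed

text \<open>
  \<open>heis sc h0 n\<close> is \<open>h(n)\<close> on \<open>M(1) \<otimes> \<Omega>'\<close>, where \<open>sc\<close> is the scalar multiplication of \<open>\<Omega>'\<close> and
  \<open>h0\<close> the operator \<open>h(0)\<close> on \<open>\<Omega>'\<close>; for \<open>a \<in> \<hh>\<close>, \<open>hmode sc h0 a n\<close> is \<open>a(n)\<close>.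
\<close>

definition heis ::
    "(complex \<Rightarrow> 'w \<Rightarrow> 'w) \<Rightarrow> ('w \<Rightarrow> 'w) \<Rightarrow> int \<Rightarrow> 'w::zero fock \<Rightarrow> 'w fock"
  where "heis sc h0 n =
    (if n < 0 then fock_create (nat (- n) - 1)
     else if n = 0 then Poly_Mapping.map h0
     else fock_annihilate sc (nat n - 1))"

definition hmode ::
    "(complex \<Rightarrow> 'w \<Rightarrow> 'w) \<Rightarrow> ('w \<Rightarrow> 'w) \<Rightarrow> complex \<Rightarrow> int \<Rightarrow> 'w::zero fock \<Rightarrow> 'w fock"
  where "hmode sc h0 a n u = fock_scale sc a (heis sc h0 n u)"

lemma lookup_fock_scale:
  assumes "vector_space sc"
  shows "Poly_Mapping.lookup (fock_scale sc c f) \<mu> = sc c (Poly_Mapping.lookup f \<mu>)"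
proof -
  interpret vector_space sc by fact
  show ?thesis
    by (simp add: fock_scale_def Poly_Mapping.map.rep_eq when_def)
qed

lemma vector_space_fock:
  assumes "vector_space sc"
  shows "vector_space (fock_scale sc)"
proof -
  interpret vector_space sc by fact
  show ?thesis
    by unfold_locales
      (simp_all add: poly_mapping_eq_iff fun_eq_iff lookup_fock_scale[OF assms] lookup_add
        scale_right_distrib scale_left_distrib)
qed

lemma heis_commutator:
  assumes "vector_space sc" and "Vector_Spaces.linear sc sc h0"
  shows "heis sc h0 m (heis sc h0 n u) - heis sc h0 n (heis sc h0 m u) =
    fock_scale sc (of_int m when m + n = 0) u"
proof (rule poly_mapping_eqI)
  interpret vector_space sc by fact
  interpret L: Vector_Spaces.linear sc sc h0 by fact
  fix \<mu>
  have ann: "Poly_Mapping.lookup (fock_annihilate sc i f) \<nu> =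
      sc (of_nat ((i + 1) * (count \<nu> i + 1))) (Poly_Mapping.lookup f (add_mset i \<nu>))" for i f \<nu>
    by (simp add: fock_annihilate.rep_eq when_def)
  have zer: "Poly_Mapping.lookup (Poly_Mapping.map h0 f) \<nu> = h0 (Poly_Mapping.lookup f \<nu>)" for f \<nu>
    by (simp add: Poly_Mapping.map.rep_eq when_def L.zero)
  have comm: "Poly_Mapping.lookup (fock_annihilate sc i (fock_create j f)) \<mu> -
      Poly_Mapping.lookup (fock_create j (fock_annihilate sc i f)) \<mu> =
      sc (of_nat (i + 1) when i = j) (Poly_Mapping.lookup f \<mu>)" for i j f
  proof (cases "i = j")
    case True
    show ?thesis
    proof (cases "j \<in># \<mu>")
      case jm: True
      then have "count \<mu> j > 0" by simp
      then have "complex_of_nat ((j + 1) * (count \<mu> j + 1)) -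
          of_nat ((j + 1) * (count (\<mu> - {#j#}) j + 1)) = of_nat (j + 1)"
        by (cases "count \<mu> j") (simp_all add: algebra_simps)
      then have "sc (of_nat ((j + 1) * (count \<mu> j + 1))) (Poly_Mapping.lookup f \<mu>) -
          sc (of_nat ((j + 1) * (count (\<mu> - {#j#}) j + 1))) (Poly_Mapping.lookup f \<mu>) =
          sc (of_nat (j + 1)) (Poly_Mapping.lookup f \<mu>)"
        by (simp only: scale_left_diff_distrib[symmetric])
      then show ?thesis using True jm
        by (simp add: ann fock_create.rep_eq del: of_nat_mult of_nat_add of_nat_Suc)
    next
      case False
      then show ?thesis using True
        by (simp add: ann fock_create.rep_eq count_eq_zero_iff[THEN iffD2])
    qed
  next
    case False
    then show ?thesis
      by (auto simp add: ann fock_create.rep_eq)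
  qed
  have cc: "fock_create i (fock_create j f) = fock_create j (fock_create i f)"
    for i j and f :: "'a fock"
    by (rule poly_mapping_eqI)
      (auto simp: fock_create.rep_eq add_mset_commute in_diff_count split: if_splits)
  have aa: "fock_annihilate sc i (fock_annihilate sc j f) = fock_annihilate sc j (fock_annihilate sc i f)"
    for i j f
    by (rule poly_mapping_eqI) (simp add: ann add_mset_commute mult.commute)
  show "Poly_Mapping.lookup
      (heis sc h0 m (heis sc h0 n u) - heis sc h0 n (heis sc h0 m u)) \<mu> =
    Poly_Mapping.lookup (fock_scale sc (of_int m when m + n = 0) u) \<mu>"
  proof -
    consider "m > 0" "n > 0" | "m > 0" "n < 0" | "m < 0" "n > 0" | "m < 0" "n < 0" | "m = 0" | "n = 0"
      by linarith
    then show ?thesis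
    proof cases
      case 1
      then show ?thesis by (simp add: heis_def lookup_minus aa[of "nat m - Suc 0" "nat n - Suc 0"] lookup_fock_scale assms(1))
    next
      case 2
      have "of_nat (nat m - 1 + 1) = (of_int m :: complex)" using 2 by (simp add: of_nat_nat)
      moreover have "nat m - 1 = nat (- n) - 1 \<longleftrightarrow> m + n = 0" using 2 by linarith
      ultimately show ?thesis using 2 comm[of "nat m - 1" "nat (- n) - 1" u]
        by (simp add: heis_def lookup_minus lookup_fock_scale assms(1))
    next
      case 3
      have "of_nat (nat n - 1 + 1) = (- of_int m :: complex)" if "m + n = 0"
      proof -
        have "nat n - 1 + 1 = nat (- m)" using 3 that by linarith
        then show ?thesis using 3 by (simp add: of_nat_nat)
      qed
      moreover have "nat n - 1 = nat (- m) - 1 \<longleftrightarrow> m + n = 0" using 3 by linarith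
      moreover have "Poly_Mapping.lookup
          (fock_create (nat (- m) - 1) (fock_annihilate sc (nat n - 1) u)) \<mu> -
        Poly_Mapping.lookup (fock_annihilate sc (nat n - 1) (fock_create (nat (- m) - 1) u)) \<mu> =
        - sc (of_nat (nat n - 1 + 1) when nat n - 1 = nat (- m) - 1) (Poly_Mapping.lookup u \<mu>)"
        unfolding comm[symmetric] by (simp only: minus_diff_eq)
      ultimately show ?thesis using 3
        by (cases "m + n = 0") (simp_all add: heis_def lookup_minus lookup_fock_scale assms(1))
    next
      case 4
      then show ?thesis by (simp add: heis_def lookup_minus cc[of "nat (- m) - Suc 0" "nat (- n) - Suc 0"] lookup_fock_scale assms(1))
    next
      case 5
      then show ?thesis
        by (simp add: heis_def lookup_minus lookup_fock_scale assms(1) zer ann fock_create.rep_eq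
            L.scale L.zero when_def)
    next
      case 6
      then show ?thesis
        by (simp add: heis_def lookup_minus lookup_fock_scale assms(1) zer ann fock_create.rep_eq
            L.scale L.zero when_def)
    qed
  qed
qed


section \<open>Vertex operators on Heisenberg modules\<close>

text \<open>
  A field \<open>A(x) = \<Sum>\<^sub>n A\<^sub>n x\<^bsup>-n-1\<^esup>\<close> is given by its modes \<open>A\<^sub>n\<close>.  Infinite sums of operators below
  are all finite when applied to a vector, and \<open>Sum_any\<close> is the sum over the finite support.
\<close>

definition field_deriv :: "(complex \<Rightarrow> 'u \<Rightarrow> 'u) \<Rightarrow> (int \<Rightarrow> 'u \<Rightarrow> 'u) \<Rightarrow> int \<Rightarrow> 'u \<Rightarrow> 'u"
  where "field_deriv S A n u = S (- of_int n) (A (n - 1) u)"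

text \<open>The normally ordered product \<open>A(x)\<^sup>- B(x) + B(x) A(x)\<^sup>+\<close> with \<open>A(x)\<^sup>- = \<Sum>\<^bsub>j<0\<^esub> A\<^sub>j x\<^bsup>-j-1\<^esup>\<close>.\<close>

definition normal_product ::
    "(int \<Rightarrow> 'u \<Rightarrow> 'u) \<Rightarrow> (int \<Rightarrow> 'u \<Rightarrow> 'u) \<Rightarrow> int \<Rightarrow> 'u \<Rightarrow> 'u::comm_monoid_add"
  where "normal_product A B n u =
    Sum_any (\<lambda>j. A j (B (n - j - 1) u) when j < 0) +
    Sum_any (\<lambda>j. B (n - j - 1) (A j u) when j \<ge> 0)"

text \<open>\<open>Y(h(-n\<^sub>1) \<cdots> h(-n\<^sub>r) \<one>, x)\<close> is the normally ordered product of the \<open>\<partial>\<^bsup>n\<^sub>j-1\<^esup> h(x) / (n\<^sub>j-1)!\<close>.\<close>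

definition monomial_vertex ::
    "(complex \<Rightarrow> 'w \<Rightarrow> 'w) \<Rightarrow> ('w \<Rightarrow> 'w) \<Rightarrow> nat multiset \<Rightarrow> int \<Rightarrow> 'w::comm_monoid_add fock \<Rightarrow> 'w fock"
  where "monomial_vertex sc h0 \<mu> =
    foldr (\<lambda>i B. normal_product
        (\<lambda>n u. fock_scale sc (1 / fact i)
            ((field_deriv (fock_scale sc) ^^ i) (heis sc h0) n u)) B)
      (sorted_list_of_multiset \<mu>) (\<lambda>n u. u when n = -1)"

text \<open>\<open>fock_vertex sc h0 v n\<close> is the mode \<open>v\<^sub>n\<close> of \<open>v \<in> M(1)\<close> on \<open>M(1) \<otimes> \<Omega>'\<close>.\<close>

definition fock_vertex ::
    "(complex \<Rightarrow> 'w \<Rightarrow> 'w) \<Rightarrow> ('w \<Rightarrow> 'w) \<Rightarrow> complex fock \<Rightarrow> int \<Rightarrow> 'w::comm_monoid_add fock \<Rightarrow> 'w fock"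
  where "fock_vertex sc h0 v n u =
    (\<Sum>\<mu>\<in>Poly_Mapping.keys v. fock_scale sc (Poly_Mapping.lookup v \<mu>) (monomial_vertex sc h0 \<mu> n u))"

text \<open>On \<open>M(1)\<close> itself \<open>h(0)\<close> acts as zero.\<close>

definition omega :: "nat \<Rightarrow> complex fock"
  where "omega p =
    (let a = hmode (*) (\<lambda>_. 0) (alpha p); vac = Poly_Mapping.single {#} 1 in
      fock_scale (*) (1 / (4 * of_nat p)) (a (-1) (a (-1) vac)) +
      fock_scale (*) ((of_nat p - 1) / (2 * of_nat p)) (a (-2) vac))"

record ('v, 'u) vmodule =
  vscale :: "complex \<Rightarrow> 'u \<Rightarrow> 'u"
  vmode :: "'v \<Rightarrow> int \<Rightarrow> 'u \<Rightarrow> 'u"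

definition fock_module ::
    "(complex \<Rightarrow> 'w \<Rightarrow> 'w) \<Rightarrow> ('w \<Rightarrow> 'w) \<Rightarrow> (complex fock, 'w::comm_monoid_add fock) vmodule"
  where "fock_module sc h0 = \<lparr>vscale = fock_scale sc, vmode = fock_vertex sc h0\<rparr>"


section \<open>Formal series in \<open>x\<close> and \<open>log x\<close>\<close>

text \<open>
  \<open>A s k\<close> is the coefficient of \<open>x\<^bsup>s\<^esup> (log x)\<^bsup>k\<^esup>\<close>, for \<open>s\<close> an arbitrary complex number.
\<close>

type_synonym ('a, 'b) log_series = "complex \<Rightarrow> nat \<Rightarrow> 'a \<Rightarrow> 'b"

definition ls_const :: "('a \<Rightarrow> 'b::zero) \<Rightarrow> ('a, 'b) log_series"
  where "ls_const f s k u = (f u when s = 0 \<and> k = 0)"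

definition ls_log :: "('a \<Rightarrow> 'b::zero) \<Rightarrow> ('a, 'b) log_series"
  where "ls_log f s k u = (f u when s = 0 \<and> k = 1)"

definition ls_int :: "(int \<Rightarrow> 'a \<Rightarrow> 'b::zero) \<Rightarrow> ('a, 'b) log_series"
  where "ls_int c s k u = (c \<lfloor>Re s\<rfloor> u when s \<in> \<int> \<and> k = 0)"

definition ls_add :: "('a, 'b) log_series \<Rightarrow> ('a, 'b) log_series \<Rightarrow> ('a, 'b::plus) log_series"
    (infixl "\<oplus>" 65)
  where "(A \<oplus> B) s k u = A s k u + B s k u"

definition ls_mult ::
    "('b, 'c) log_series \<Rightarrow> ('a, 'b) log_series \<Rightarrow> ('a, 'c::comm_monoid_add) log_series"
    (infixr "\<odot>" 70)
  where "(A \<odot> B) s k u =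
    Sum_any (\<lambda>(t, j). A (s - t) (k - j) (B t j u) when j \<le> k)"

fun ls_power :: "('a, 'a) log_series \<Rightarrow> nat \<Rightarrow> ('a, 'a::comm_monoid_add) log_series"
  where
    "ls_power A 0 = ls_const (\<lambda>u. u)"
  | "ls_power A (Suc n) = A \<odot> ls_power A n"

definition ls_exp ::
    "(complex \<Rightarrow> 'a \<Rightarrow> 'a) \<Rightarrow> ('a, 'a) log_series \<Rightarrow> ('a, 'a::comm_monoid_add) log_series"
  where "ls_exp S A s k u = Sum_any (\<lambda>n. S (1 / fact n) (ls_power A n s k u))"

definition ls_deriv ::
    "(complex \<Rightarrow> 'b \<Rightarrow> 'b) \<Rightarrow> ('a, 'b) log_series \<Rightarrow> ('a, 'b::plus) log_series"
  where "ls_deriv S A s k u = S (s + 1) (A (s + 1) k u) + S (of_nat k + 1) (A (s + 1) (k + 1) u)"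

text \<open>
  For a diagonalizable operator \<open>D\<close>, \<open>x\<^bsup>D\<^esup>\<close> is multiplication by \<open>x\<^bsup>s\<^esup>\<close> on the \<open>s\<close>-eigenspace;
  its coefficient at \<open>x\<^bsup>s\<^esup>\<close> is the projection onto that eigenspace along the others.
\<close>

definition eigen_component ::
    "(complex \<Rightarrow> 'a \<Rightarrow> 'a) \<Rightarrow> ('a \<Rightarrow> 'a) \<Rightarrow> complex \<Rightarrow> 'a \<Rightarrow> 'a::ab_group_add"
  where "eigen_component S D s u =
    (THE d. D d = S s d \<and> u - d \<in> module.span S {v. \<exists>t. t \<noteq> s \<and> D v = S t v})"

definition x_power ::
    "(complex \<Rightarrow> 'a \<Rightarrow> 'a) \<Rightarrow> ('a \<Rightarrow> 'a) \<Rightarrow> ('a, 'a::ab_group_add) log_series"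
  where "x_power S D s k u = (eigen_component S D s u when k = 0)"

text \<open>\<open>f = f\<^sub>s + f\<^sub>n\<close> with \<open>f\<^sub>s\<close> diagonalizable, \<open>f\<^sub>n\<close> nilpotent and the two commuting.\<close>

definition semisimple_nilpotent_parts ::
    "(complex \<Rightarrow> 'a \<Rightarrow> 'a) \<Rightarrow> ('a::ab_group_add \<Rightarrow> 'a) \<Rightarrow> ('a \<Rightarrow> 'a) \<Rightarrow> ('a \<Rightarrow> 'a) \<Rightarrow> bool"
  where "semisimple_nilpotent_parts S f fs fn \<longleftrightarrow>
    Vector_Spaces.linear S S fs \<and> Vector_Spaces.linear S S fn \<and>
    module.span S {v. \<exists>t. fs v = S t v} = UNIV \<and>
    (\<exists>n. \<forall>u. (fn ^^ n) u = 0) \<and>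
    (\<forall>u. fs (fn u) = fn (fs u)) \<and>
    (\<forall>u. f u = fs u + fn u)"

text \<open>
  \<open>\<integral>\<^sup>-h(x)\<close>, \<open>\<integral>\<^sup>+h(x)\<close> and \<open>E\<^sup>\<plusminus>(a, x)\<close>, with the summation index \<open>m\<close> replaced by the exponent
  \<open>e = -m\<close> of \<open>x\<close>.
\<close>

definition int_h_term ::
    "(complex \<Rightarrow> 'w \<Rightarrow> 'w) \<Rightarrow> ('w \<Rightarrow> 'w) \<Rightarrow> int \<Rightarrow> 'w::zero fock \<Rightarrow> 'w fock"
  where "int_h_term sc h0 e u = fock_scale sc (1 / of_int e) (heis sc h0 (- e) u)"

definition int_h_minus ::
    "(complex \<Rightarrow> 'w \<Rightarrow> 'w) \<Rightarrow> ('w \<Rightarrow> 'w) \<Rightarrow> ('w::comm_monoid_add fock, 'w fock) log_series"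
  where "int_h_minus sc h0 = ls_int (\<lambda>e u. int_h_term sc h0 e u when e > 0)"

definition int_h_plus ::
    "(complex \<Rightarrow> 'w \<Rightarrow> 'w) \<Rightarrow> ('w \<Rightarrow> 'w) \<Rightarrow> ('w::comm_monoid_add fock, 'w fock) log_series"
  where "int_h_plus sc h0 =
    ls_log (heis sc h0 0) \<oplus> ls_int (\<lambda>e u. int_h_term sc h0 e u when e < 0)"

definition E_minus ::
    "(complex \<Rightarrow> 'w \<Rightarrow> 'w) \<Rightarrow> ('w \<Rightarrow> 'w) \<Rightarrow> complex \<Rightarrow> ('w::comm_monoid_add fock, 'w fock) log_series"
  where "E_minus sc h0 a =
    ls_exp (fock_scale sc) (ls_int (\<lambda>e u. fock_scale sc a (int_h_term sc h0 e u) when e > 0))"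

definition E_plus ::
    "(complex \<Rightarrow> 'w \<Rightarrow> 'w) \<Rightarrow> ('w \<Rightarrow> 'w) \<Rightarrow> complex \<Rightarrow> ('w::comm_monoid_add fock, 'w fock) log_series"
  where "E_plus sc h0 a =
    ls_exp (fock_scale sc) (ls_int (\<lambda>e u. fock_scale sc a (int_h_term sc h0 e u) when e < 0))"


section \<open>The kernel of the screening operator\<close>

text \<open>
  The group algebra of \<open>\<int> \<alpha>/(2p)\<close> is \<open>int \<Rightarrow>\<^sub>0 complex\<close>, with \<open>e\<^bsup>j\<alpha>/(2p)\<^esup>\<close> corresponding to
  \<open>Poly_Mapping.single j 1\<close>.  The generalized lattice vertex algebra is its tensor product with
  \<open>M(1)\<close>, on which \<open>h(0)\<close> acts by \<open>\<langle>h, j\<alpha>/(2p)\<rangle>\<close> on the summand of \<open>e\<^bsup>j\<alpha>/(2p)\<^esup>\<close>.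
\<close>

definition lattice_vec :: "nat \<Rightarrow> int \<Rightarrow> complex"
  where "lattice_vec p j = of_int j * alpha p / (2 * of_nat p)"

definition lattice_scale :: "complex \<Rightarrow> (int \<Rightarrow>\<^sub>0 complex) \<Rightarrow> (int \<Rightarrow>\<^sub>0 complex)"
  where "lattice_scale c = Poly_Mapping.map ((*) c)"

definition lattice_h0 :: "nat \<Rightarrow> (int \<Rightarrow>\<^sub>0 complex) \<Rightarrow> (int \<Rightarrow>\<^sub>0 complex)"
  where "lattice_h0 p = Poly_Mapping.mapp (\<lambda>j c. hform 1 (lattice_vec p j) * c)"

definition lattice_shift :: "int \<Rightarrow> (int \<Rightarrow>\<^sub>0 complex) fock \<Rightarrow> (int \<Rightarrow>\<^sub>0 complex) fock"
  where "lattice_shift g = Poly_Mapping.map (Poly_Mapping.map_key (\<lambda>j. j - g))"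

text \<open>\<open>Y(e\<^sup>\<gamma>, x)\<close> for \<open>\<gamma> = g\<alpha>/(2p)\<close>.\<close>

definition lattice_vertex ::
    "nat \<Rightarrow> int \<Rightarrow> ((int \<Rightarrow>\<^sub>0 complex) fock, (int \<Rightarrow>\<^sub>0 complex) fock) log_series"
  where "lattice_vertex p g =
    (let \<gamma> = lattice_vec p g in
      E_minus lattice_scale (lattice_h0 p) \<gamma> \<odot> E_plus lattice_scale (lattice_h0 p) \<gamma> \<odot>
      ls_const (lattice_shift g) \<odot>
      x_power (fock_scale lattice_scale) (hmode lattice_scale (lattice_h0 p) \<gamma> 0))"

definition lattice_mode ::
    "nat \<Rightarrow> int \<Rightarrow> complex \<Rightarrow> (int \<Rightarrow>\<^sub>0 complex) fock \<Rightarrow> (int \<Rightarrow>\<^sub>0 complex) fock"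
  where "lattice_mode p g n = lattice_vertex p g (- n - 1) 0"

text \<open>Here \<open>-\<alpha>/p = (-2)\<alpha>/(2p)\<close>, and \<open>M(1)\<close> is embedded as \<open>M(1) \<otimes> e\<^sup>0\<close>.\<close>

definition M1_bar :: "nat \<Rightarrow> complex fock set"
  where "M1_bar p =
    {v. lattice_mode p (-2) 0 (Poly_Mapping.map (Poly_Mapping.single 0) v) = 0}"


section \<open>Logarithmic intertwining operators\<close>

text \<open>
  Logarithmic intertwining operators of type \<open>W\<^sub>3\<close> over \<open>W\<^sub>1 W\<^sub>2\<close> for the vertex operator algebra
  with underlying space \<open>V\<close> and conformal vector \<open>\<omega>\<close>; recall that \<open>L(-1) = \<omega>\<^sub>0\<close>.
  With \<open>v\<^sub>n\<close> and \<open>w\<^sub>n\<close> the coefficients at \<open>x\<^bsup>-n-1\<^esup>\<close>, the last but one clause is the coefficient of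
  \<open>x\<^sub>0\<^bsup>-l-1\<^esup> x\<^sub>1\<^bsup>-m-1\<^esup> x\<^sub>2\<^bsup>-n-1\<^esup> (log x\<^sub>2)\<^bsup>k\<^esup>\<close> in the Jacobi identity
  \<open>x\<^sub>0\<^bsup>-1\<^esup> \<delta>((x\<^sub>1 - x\<^sub>2)/x\<^sub>0) Y\<^sub>3(v,x\<^sub>1) \<Y>(w,x\<^sub>2) u - x\<^sub>0\<^bsup>-1\<^esup> \<delta>((x\<^sub>2 - x\<^sub>1)/(-x\<^sub>0)) \<Y>(w,x\<^sub>2) Y\<^sub>2(v,x\<^sub>1) u
    = x\<^sub>2\<^bsup>-1\<^esup> \<delta>((x\<^sub>1 - x\<^sub>0)/x\<^sub>2) \<Y>(Y\<^sub>1(v,x\<^sub>0) w,x\<^sub>2) u\<close>,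
  where the expansion of the last delta function gives \<open>(-1)\<^sup>i (i-m-1 choose i) = (m choose i)\<close>.
\<close>

definition log_intertwining_operator ::
    "'v set \<Rightarrow> 'v \<Rightarrow> ('v, 'c::ab_group_add) vmodule \<Rightarrow> ('v, 'a::ab_group_add) vmodule \<Rightarrow>
     ('v, 'b::ab_group_add) vmodule \<Rightarrow> ('a \<Rightarrow> ('b, 'c) log_series) \<Rightarrow> bool"
  where "log_intertwining_operator V \<omega> W3 W1 W2 \<Y> \<longleftrightarrow>
    (\<forall>s k u. Vector_Spaces.linear (vscale W1) (vscale W3) (\<lambda>w. \<Y> w s k u)) \<and>
    (\<forall>w s k. Vector_Spaces.linear (vscale W2) (vscale W3) (\<Y> w s k)) \<and>
    (\<forall>w. \<exists>K. \<forall>k>K. \<forall>s u. \<Y> w s k u = 0) \<and>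
    (\<forall>w u. \<exists>N. \<forall>s k. Re s < N \<longrightarrow> \<Y> w s k u = 0) \<and>
    (\<forall>v\<in>V. \<forall>w u. \<forall>l m :: int. \<forall>n :: complex. \<forall>k.
      Sum_any (\<lambda>i. vscale W3 ((-1) ^ i * (of_int l gchoose i))
        (vmode W3 v (m + l - int i) (\<Y> w (- (n + of_nat i) - 1) k u))) -
      Sum_any (\<lambda>i. vscale W3 ((-1) powi l * (-1) ^ i * (of_int l gchoose i))
        (\<Y> w (- (n + of_int l - of_nat i) - 1) k (vmode W2 v (m + int i) u))) =
      Sum_any (\<lambda>i. vscale W3 (of_int m gchoose i)
        (\<Y> (vmode W1 v (l + int i) w) (- (of_int m + n - of_nat i) - 1) k u))) \<and>
    (\<forall>w. \<Y> (vmode W1 \<omega> 0 w) = ls_deriv (vscale W3) (\<Y> w))"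

end

(*
  The Jacobi identity holds for every v in M(1). For w in Omega put N = h(0) - lambda_p, Phi(w) = E^- E^+ T(w) x^(lambda_p^2) and
  Y(w) = (int^- h) Phi(N w) + Phi(N w) (int^+ h) + Phi(w), and extend Y to M(1) (x) Omega by letting
  Y(h(-K-1) w) be the normally ordered product of (d/dx)^K h(x) / K! and Y(w). The commutators
  [h(m), Y(w)] and the derivative of Y(w) are computed on Omega and are compatible with this
  extension. Together with the defining formula for Y(h(-K-1) w), the commutators yield the Jacobi
  identity for v = h(-1)1. The set of v for which the identity holds is closed under linear
  combinations, derivatives and normally ordered products, and hence is all of M(1).
*)
theory Submission
  imports Defs "HOL-Computational_Algebra.Formal_Power_Series"
begin

section \<open>Sums over finite supports\<close>

text \<open>The prescribed formula is one normally ordered exponential expanded in a nilpotent: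
  replace \<open>lam\<close> by \<open>lam + N\<close> in \<open>E^- E^+ T(w) x^(lam h(0))\<close>.
  Since \<open>N^2 = 0\<close>, the factor \<open>exp(N int h)\<close> stops after its linear term,
  with \<open>int h\<close> the sum of \<open>int^- h\<close> and \<open>int^+ h\<close>. This also
  shows why \<open>Phi\<close> alone is not enough: nonzero modes commute with \<open>Phi(w)\<close>
  as if \<open>h(0) w\<close> were \<open>lam w\<close>, whereas the zero mode acts through
  \<open>T\<close> and sees \<open>h(0) w\<close> itself. The discrepancy \<open>Phi(N w)\<close> is
  exactly what the commutator of a nonzero mode with \<open>int h\<close> contributes. Logarithms
  enter only through \<open>h(0) log x\<close> in \<open>int^+ h\<close>; the derivative of this
  term restores the summand \<open>h(0)/x\<close> that the derivative of the rest of
  \<open>int h\<close> lacks.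

  The obstacle that shapes the text is finiteness. All operator sums are \<open>Sum_any\<close>,
  which is 0 on an infinite support, so each interchange, regrouping or passage of a linear map
  through a sum needs a proof that the support is finite. For double sums this comes from lower
  truncation, often with a bound on one index that depends on the other.\<close>

lemma finite_pairs_by_fst:
  fixes f :: "nat \<Rightarrow> nat \<Rightarrow> 'a::zero"
  assumes "\<exists>N. \<forall>i\<ge>N. \<forall>j. f i j = 0" and "\<And>i. \<exists>N. \<forall>j\<ge>N. f i j = 0"
  shows "finite {(i, j). f i j \<noteq> 0}"
proof -
  obtain N where N: "\<forall>i\<ge>N. \<forall>j. f i j = 0" using assms(1) by blast
  obtain M where M: "\<forall>i. \<forall>j\<ge>M i. f i j = 0" using assms(2) by metis
  have "{(i, j). f i j \<noteq> 0} \<subseteq> (SIGMA i:{..<N}. {..<M i})"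
    using N M by (auto simp: not_le[symmetric])
  then show ?thesis by (rule finite_subset) auto
qed

lemma finite_pairs_by_snd:
  fixes f :: "nat \<Rightarrow> nat \<Rightarrow> 'a::zero"
  assumes "\<exists>N. \<forall>j\<ge>N. \<forall>i. f i j = 0" and "\<And>j. \<exists>N. \<forall>i\<ge>N. f i j = 0"
  shows "finite {(i, j). f i j \<noteq> 0}"
proof -
  have "finite {(j, i). f i j \<noteq> 0}" by (rule finite_pairs_by_fst) (use assms in auto)
  then have "finite (prod.swap ` {(j, i). f i j \<noteq> 0})" by simp
  also have "prod.swap ` {(j, i). f i j \<noteq> 0} = {(i, j). f i j \<noteq> 0}" by force
  finally show ?thesis .
qed

lemma finite_nonzero_iff_eventually:
  fixes f :: "nat \<Rightarrow> 'a::zero"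
  shows "finite {i. f i \<noteq> 0} \<longleftrightarrow> (\<exists>N. \<forall>i\<ge>N. f i = 0)"
proof
  assume "finite {i. f i \<noteq> 0}"
  then obtain N where "\<forall>i\<in>{i. f i \<noteq> 0}. i < N" using finite_nat_set_iff_bounded by blast
  then show "\<exists>N. \<forall>i\<ge>N. f i = 0" by (metis mem_Collect_eq not_le)
next
  assume "\<exists>N. \<forall>i\<ge>N. f i = 0"
  then obtain N where "\<forall>i\<ge>N. f i = 0" ..
  then have "{i. f i \<noteq> 0} \<subseteq> {..<N}" by (auto simp: not_le[symmetric])
  then show "finite {i. f i \<noteq> 0}" by (rule finite_subset) simp
qed

lemma eventually_zero_mono:
  assumes "\<exists>N. \<forall>j\<ge>(N::nat). g j = 0" and "\<And>j. g j = 0 \<Longrightarrow> f j = 0"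
  shows "\<exists>N. \<forall>j\<ge>(N::nat). f j = 0"
  using assms by blast

lemma finite_nonzero_mono:
  assumes "finite {j. g j \<noteq> 0}" and "\<And>j. g j = 0 \<Longrightarrow> f j = 0"
  shows "finite {j. f j \<noteq> 0}"
  by (rule finite_subset[OF _ assms(1)]) (use assms(2) in auto)

lemma finite_slices:
  assumes "finite {(i, j). f i j \<noteq> 0}"
  shows "finite {i. \<exists>j. f i j \<noteq> 0}" "finite {j. f i j \<noteq> 0}" "finite {j. \<exists>i. f i j \<noteq> 0}"
    "finite {i. f i j \<noteq> 0}"
proof -
  have "{i. \<exists>j. f i j \<noteq> 0} \<subseteq> fst ` {(i, j). f i j \<noteq> 0}"
    "{j. f i j \<noteq> 0} \<subseteq> snd ` {(i, j). f i j \<noteq> 0}"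
    "{j. \<exists>i. f i j \<noteq> 0} \<subseteq> snd ` {(i, j). f i j \<noteq> 0}"
    "{i. f i j \<noteq> 0} \<subseteq> fst ` {(i, j). f i j \<noteq> 0}" for i j
    by force+
  then show "finite {i. \<exists>j. f i j \<noteq> 0}" "finite {j. f i j \<noteq> 0}" "finite {j. \<exists>i. f i j \<noteq> 0}"
    "finite {i. f i j \<noteq> 0}"
    using assms by (meson finite_imageI finite_subset)+
qed

lemma Sum_any_nested:
  assumes "finite {(i, j). f i j \<noteq> 0}"
  shows "Sum_any (\<lambda>i. Sum_any (f i)) = Sum_any (\<lambda>(i, j). f i j)"
  by (rule Sum_any.cartesian_product[OF finite_cartesian_product[OF finite_slices(1)[OF assms]
        finite_slices(3)[OF assms]] order_refl])

lemma Sum_any_swap: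
  assumes "finite {(i, j). f i j \<noteq> 0}"
  shows "Sum_any (\<lambda>i. Sum_any (\<lambda>j. f i j)) = Sum_any (\<lambda>j. Sum_any (\<lambda>i. f i j))"
  by (rule Sum_any.swap[OF finite_cartesian_product[OF finite_slices(1)[OF assms]
        finite_slices(3)[OF assms]] order_refl])

lemma finite_nested:
  assumes "finite {(i, j). f i j \<noteq> 0}"
  shows "finite {i. Sum_any (f i) \<noteq> 0}"
  by (rule finite_subset[OF _ finite_slices(1)[OF assms]])
    (auto elim: Sum_any.not_neutral_obtains_not_neutral)

lemma Sum_any_additive:
  assumes "finite {i. g i \<noteq> 0}" and "f 0 = 0" and "\<And>x y. f (x + y) = f x + f y"
  shows "f (Sum_any g) = Sum_any (\<lambda>i. f (g i))"
proof -
  have "f (sum g A) = (\<Sum>i\<in>A. f (g i))" if "finite A" for A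
    using that by (induction A rule: finite_induct) (simp_all add: assms(2,3))
  moreover have "Sum_any (\<lambda>i. f (g i)) = (\<Sum>i\<in>{i. g i \<noteq> 0}. f (g i))"
    by (rule Sum_any.expand_superset) (use assms in auto)
  ultimately show ?thesis using assms(1) by (simp add: Sum_any.expand_set)
qed

lemma Sum_any_linear:
  assumes "finite {i. g i \<noteq> 0}" and "Vector_Spaces.linear S S' f"
  shows "f (Sum_any g) = Sum_any (\<lambda>i. f (g i))"
proof -
  interpret Vector_Spaces.linear S S' f by fact
  show ?thesis by (rule Sum_any_additive) (use assms in \<open>simp_all add: add zero\<close>)
qed

lemma Sum_any_scale:
  assumes "vector_space S" and "finite {i. g i \<noteq> 0}"
  shows "S c (Sum_any g) = Sum_any (\<lambda>i. S c (g i))"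
proof -
  interpret vector_space S by fact
  show ?thesis by (rule Sum_any_additive) (use assms in \<open>simp_all add: scale_right_distrib\<close>)
qed

lemma Sum_any_subtractf:
  fixes f g :: "'i \<Rightarrow> 'a::ab_group_add"
  assumes "finite {i. f i \<noteq> 0}" and "finite {i. g i \<noteq> 0}"
  shows "Sum_any (\<lambda>i. f i - g i) = Sum_any f - Sum_any g"
proof -
  have "Sum_any (\<lambda>i. - g i) = - Sum_any g"
    using Sum_any_additive[OF assms(2), of uminus] by simp
  moreover have "Sum_any (\<lambda>i. f i + - g i) = Sum_any f + Sum_any (\<lambda>i. - g i)"
    by (rule Sum_any.distrib) (use assms in simp_all)
  ultimately show ?thesis by simp
qed

lemma Sum_any_Suc:
  fixes f :: "nat \<Rightarrow> 'a::comm_monoid_add"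
  assumes "finite {i. f i \<noteq> 0}"
  shows "Sum_any f = f 0 + Sum_any (\<lambda>i. f (Suc i))"
proof -
  obtain N where N: "\<forall>i\<ge>N. f i = 0" using assms finite_nonzero_iff_eventually[of f] by blast
  have "Sum_any f = sum f {..<Suc N}"
    by (rule Sum_any.expand_superset) (use N in \<open>auto simp: not_less[symmetric] less_Suc_eq_le intro: ccontr\<close>)
  also have "\<dots> = f 0 + (\<Sum>i<N. f (Suc i))" by (rule sum.lessThan_Suc_shift)
  also have "(\<Sum>i<N. f (Suc i)) = Sum_any (\<lambda>i. f (Suc i))"
    by (rule Sum_any.expand_superset[symmetric]) (use N in \<open>auto simp: not_less[symmetric] intro: ccontr\<close>)
  finally show ?thesis .
qed

lemma Sum_any_reindex_inj:
  assumes "inj h" and "\<And>x. x \<notin> range h \<Longrightarrow> f x = 0"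
  shows "Sum_any f = Sum_any (\<lambda>i. f (h i))"
proof -
  have "sum f {x. f x \<noteq> 0} = (\<Sum>i\<in>{i. f (h i) \<noteq> 0}. f (h i))"
    by (rule sum.reindex_cong[of h])
      (use assms in \<open>auto simp: inj_on_def inj_def image_iff\<close>, metis rangeE)
  then show ?thesis by (simp add: Sum_any.expand_set)
qed

text \<open>Terms with the same vector \<open>G x\<close> are merged, which leaves a scalar sum to
  be evaluated separately. The fibres of the index map may be infinite; \<open>F x\<close> only has
  to contain the part of the fibre where \<open>c\<close> is nonzero.\<close>

lemma Sum_any_fibres:
  assumes "vector_space S" and "finite {x. G x \<noteq> 0}" and "\<And>x. finite (F x)"
    and "\<And>t. c t \<noteq> 0 \<Longrightarrow> t \<in> F (\<pi> t)" and "\<And>x t. t \<in> F x \<Longrightarrow> \<pi> t = x"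
  shows "Sum_any (\<lambda>t. S (c t) (G (\<pi> t))) = Sum_any (\<lambda>x. S (\<Sum>t\<in>F x. c t) (G x))"
    and "finite {t. S (c t) (G (\<pi> t)) \<noteq> 0}"
proof -
  interpret vector_space S by fact
  let ?X = "{x. G x \<noteq> 0}"
  have sub: "{t. S (c t) (G (\<pi> t)) \<noteq> 0} \<subseteq> (\<Union>x\<in>?X. F x)"
    using assms(4) by (force simp: scale_eq_0_iff)
  have fin: "finite (\<Union>x\<in>?X. F x)" using assms(2,3) by blast
  show "finite {t. S (c t) (G (\<pi> t)) \<noteq> 0}" using sub fin by (rule finite_subset)
  have "Sum_any (\<lambda>t. S (c t) (G (\<pi> t))) = (\<Sum>t\<in>(\<Union>x\<in>?X. F x). S (c t) (G (\<pi> t)))"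
    by (rule Sum_any.expand_superset[OF fin sub])
  also have "\<dots> = (\<Sum>x\<in>?X. \<Sum>t\<in>F x. S (c t) (G (\<pi> t)))"
    by (rule sum.UNION_disjoint) (use assms(2,3,5) in \<open>simp_all, blast\<close>)
  also have "\<dots> = (\<Sum>x\<in>?X. S (\<Sum>t\<in>F x. c t) (G x))"
    using assms(5) by (intro sum.cong refl) (simp add: scale_sum_left)
  also have "\<dots> = Sum_any (\<lambda>x. S (\<Sum>t\<in>F x. c t) (G x))"
    by (rule Sum_any.expand_superset[symmetric]) (use assms(2) in auto)
  finally show "Sum_any (\<lambda>t. S (c t) (G (\<pi> t))) = Sum_any (\<lambda>x. S (\<Sum>t\<in>F x. c t) (G x))" .
qed

text \<open>The hypothesis on \<open>p'\<close> says that its generating function is that of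
  \<open>p\<close> times \<open>1 + \<sigma> y\<close>. This covers the passage from exponent
  \<open>l\<close> to \<open>l + 1\<close> in \<open>(1 - y)^l\<close> and in
  \<open>(1 + y)^l\<close>.\<close>

lemma Sum_any_pascal:
  assumes "vector_space S" and "finite {i. F i \<noteq> 0}"
    and "p' 0 = p 0" and "\<And>i. p' (Suc i) = p (Suc i) + \<sigma> * p i"
  shows "Sum_any (\<lambda>i. S (p' i) (F i)) =
    Sum_any (\<lambda>i. S (p i) (F i)) + S \<sigma> (Sum_any (\<lambda>i. S (p i) (F (Suc i))))"
proof -
  interpret vector_space S by fact
  have fin: "finite {i. S (q i) (F i) \<noteq> 0}" for q
    by (rule finite_nonzero_mono[OF assms(2)]) simp
  have finS: "finite {i. F (Suc i) \<noteq> 0}"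
    using assms(2) unfolding finite_nonzero_iff_eventually by (meson le_Suc_eq)
  have fin': "finite {i. S (q i) (F (Suc i)) \<noteq> 0}" for q
    by (rule finite_nonzero_mono[OF finS]) simp
  have fin'': "finite {i. S s (S (q i) (F (Suc i))) \<noteq> 0}" for s q
    by (rule finite_nonzero_mono[OF finS]) simp
  have "Sum_any (\<lambda>i. S (p' i) (F i)) =
      S (p 0) (F 0) + Sum_any (\<lambda>i. S (p (Suc i)) (F (Suc i)) + S \<sigma> (S (p i) (F (Suc i))))"
    by (subst Sum_any_Suc[OF fin]) (simp add: assms(3,4) scale_left_distrib)
  also have "\<dots> = S (p 0) (F 0) + Sum_any (\<lambda>i. S (p (Suc i)) (F (Suc i))) +
      S \<sigma> (Sum_any (\<lambda>i. S (p i) (F (Suc i))))"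
    by (simp only: Sum_any.distrib[OF fin' fin''] Sum_any_scale[OF assms(1) fin'] add.assoc)
  also have "\<dots> = Sum_any (\<lambda>i. S (p i) (F i)) + S \<sigma> (Sum_any (\<lambda>i. S (p i) (F (Suc i))))"
    using Sum_any_Suc[OF fin, of p] by simp
  finally show ?thesis .
qed

section \<open>The Jacobi identity for modes\<close>

lemma linear_0: "Vector_Spaces.linear s s' f \<Longrightarrow> f 0 = 0"
  by (meson Vector_Spaces.linear.axioms(3) module_hom.zero)

lemma linear_add: "Vector_Spaces.linear s s' f \<Longrightarrow> f (x + y) = f x + f y"
  by (meson Vector_Spaces.linear.axioms(3) module_hom.add)

lemma linear_diff: "Vector_Spaces.linear s s' f \<Longrightarrow> f (x - y) = f x - f y"
  by (meson Vector_Spaces.linear.axioms(3) module_hom.diff)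

lemma linear_scale: "Vector_Spaces.linear s s' f \<Longrightarrow> f (s c x) = s' c (f x)"
  by (meson Vector_Spaces.linear.axioms(3) module_hom.scale)

lemma linearI:
  assumes "vector_space s" "vector_space s'" "\<And>x y. f (x + y) = f x + f y" "\<And>c x. f (s c x) = s' c (f x)"
  shows "Vector_Spaces.linear s s' f"
  using assms by (simp add: Vector_Spaces.linear_def module_hom_def module_hom_axioms_def vector_space_def module_def)

lemma linear_vs: "Vector_Spaces.linear s s' f \<Longrightarrow> vector_space s" "Vector_Spaces.linear s s' f \<Longrightarrow> vector_space s'"
  by (auto simp: Vector_Spaces.linear_def)

text \<open>The mode of index \<open>n\<close> belongs to \<open>x^(-n-1)\<close>, so vanishing for
  all large \<open>n\<close> is lower truncation in \<open>x\<close>.\<close>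

definition int_field ::
    "(complex \<Rightarrow> 'a \<Rightarrow> 'a) \<Rightarrow> (complex \<Rightarrow> 'b \<Rightarrow> 'b) \<Rightarrow> (int \<Rightarrow> 'a::ab_group_add \<Rightarrow> 'b::ab_group_add) \<Rightarrow> bool"
  where "int_field S S' A \<longleftrightarrow>
    (\<forall>n. Vector_Spaces.linear S S' (A n)) \<and> (\<forall>u. \<exists>N. \<forall>n\<ge>N. A n u = 0)"

lemma int_field_linear: "int_field S S' A \<Longrightarrow> Vector_Spaces.linear S S' (A n)"
  by (simp add: int_field_def)

lemma int_field_0: "int_field S S' A \<Longrightarrow> A n 0 = 0"
  by (rule linear_0[OF int_field_linear])

lemma int_field_trunc:
  assumes "int_field S S' A"
  shows "\<exists>N::nat. \<forall>j\<ge>N. A (q + int j) u = 0"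
proof -
  obtain N where N: "\<forall>n\<ge>N. A n u = 0" using assms unfolding int_field_def by blast
  have "A (q + int j) u = 0" if "j \<ge> nat (N - q)" for j
    using that N by auto
  then show ?thesis by blast
qed

lemma int_field_trunc_mono:
  assumes "int_field S S' A" and "\<And>j::nat. A (q + int j) u = 0 \<Longrightarrow> P j"
  shows "\<exists>N. \<forall>j\<ge>N. P j"
  using int_field_trunc[OF assms(1), of q u] assms(2) by blast

text \<open>Made for products of two fields: the inner field bounds \<open>i\<close>, and for each
  such \<open>i\<close> the outer field bounds \<open>j\<close>, with no uniformity in
  \<open>i\<close> required.\<close>

lemma finite_pairs_fst:
  fixes f :: "nat \<Rightarrow> nat \<Rightarrow> 'z::zero"
  assumes "int_field S S' A" and "\<And>i j. A (q + int i) u = 0 \<Longrightarrow> f i j = 0"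
    and "\<And>i. int_field R R' (B i)" and "\<And>i j. B i (p i + int j) (v i) = 0 \<Longrightarrow> f i j = 0"
  shows "finite {(i, j). f i j \<noteq> 0}"
  by (rule finite_pairs_by_fst; rule int_field_trunc_mono[OF assms(1)] int_field_trunc_mono[OF assms(3)])
    (use assms(2,4) in blast)+

lemma finite_pairs_snd:
  fixes f :: "nat \<Rightarrow> nat \<Rightarrow> 'z::zero"
  assumes "int_field S S' A" and "\<And>j i. A (q + int j) u = 0 \<Longrightarrow> f i j = 0"
    and "\<And>j. int_field R R' (B j)" and "\<And>j i. B j (p j + int i) (v j) = 0 \<Longrightarrow> f i j = 0"
  shows "finite {(i, j). f i j \<noteq> 0}"
  by (rule finite_pairs_by_snd; rule int_field_trunc_mono[OF assms(1)] int_field_trunc_mono[OF assms(3)])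
    (use assms(2,4) in blast)+

lemma finite_pairs_add:
  fixes f :: "nat \<Rightarrow> nat \<Rightarrow> 'z::zero"
  assumes "int_field S S' A" and "\<And>i j. A (q + int i + int j) u = 0 \<Longrightarrow> f i j = 0"
  shows "finite {(i, j). f i j \<noteq> 0}"
proof (rule finite_pairs_by_fst)
  obtain N where N: "\<forall>n\<ge>N. A n u = 0" using assms(1) unfolding int_field_def by blast
  then show "\<exists>N. \<forall>i\<ge>N. \<forall>j. f i j = 0"
    by (intro exI[of _ "nat (N - q)"]) (auto intro!: assms(2))
  show "\<exists>N. \<forall>j\<ge>N. f i j = 0" for i
    by (rule int_field_trunc_mono[OF assms(1), of "q + int i" u]) (rule assms(2))
qed

lemma int_field_finite:
  assumes "int_field S S' A"
  shows "finite {j::nat. A (q + int j) u \<noteq> 0}"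
  unfolding finite_nonzero_iff_eventually by (rule int_field_trunc[OF assms])

lemma int_field_zero: "vector_space S \<Longrightarrow> vector_space S' \<Longrightarrow> int_field S S' (\<lambda>_ _. 0)"
  unfolding int_field_def
proof (intro conjI allI)
  assume vs: "vector_space S" "vector_space S'"
  interpret vector_space S' by fact
  show "Vector_Spaces.linear S S' (\<lambda>_. 0)" by (rule linearI[OF vs]) simp_all
qed auto

lemma int_field_id:
  assumes "vector_space S"
  shows "int_field S S (\<lambda>n u. u when n = -1)"
proof -
  interpret vector_space S by fact
  have "\<exists>N. \<forall>n\<ge>(N::int). (u when n = -1) = 0" for u :: 'a
    by (rule exI[of _ 0]) auto
  then show ?thesis unfolding int_field_def
    by (auto intro!: linearI[OF assms assms] simp: when_def)
qed

lemma int_field_add: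
  assumes "int_field S S' A" "int_field S S' B"
  shows "int_field S S' (\<lambda>n u. A n u + B n u)"
proof -
  interpret V: vector_space S' by (rule linear_vs[OF int_field_linear[OF assms(1)]])
  have "Vector_Spaces.linear S S' (\<lambda>u. A n u + B n u)" for n
    by (rule linearI) (use int_field_linear[OF assms(1), of n] int_field_linear[OF assms(2), of n] in
        \<open>auto simp: linear_vs linear_add linear_scale V.scale_right_distrib algebra_simps\<close>)
  moreover have "\<exists>N. \<forall>n\<ge>N. A n u + B n u = 0" for u
  proof -
    obtain N M where "\<forall>n\<ge>N. A n u = 0" "\<forall>n\<ge>M. B n u = 0"
      using assms unfolding int_field_def by meson
    then show ?thesis by (intro exI[of _ "max N M"]) auto
  qed
  ultimately show ?thesis by (simp add: int_field_def)
qed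

lemma int_field_scale:
  assumes "int_field S S' A"
  shows "int_field S S' (\<lambda>n u. S' (c n) (A (n + d) u))"
proof -
  interpret V: vector_space S' by (rule linear_vs[OF int_field_linear[OF assms(1)]])
  have "Vector_Spaces.linear S S' (\<lambda>u. S' (c n) (A (n + d) u))" for n
    by (rule linearI) (use int_field_linear[OF assms(1), of "n + d"] in
        \<open>auto simp: linear_vs linear_add linear_scale V.scale_right_distrib V.scale_left_commute\<close>)
  moreover have "\<exists>N. \<forall>n\<ge>N. S' (c n) (A (n + d) u) = 0" for u
  proof -
    obtain N where "\<forall>n\<ge>N. A n u = 0" using assms unfolding int_field_def by meson
    then show ?thesis by (intro exI[of _ "N - d"]) auto
  qed
  ultimately show ?thesis by (simp add: int_field_def)
qed

lemma int_field_deriv: "int_field S S A \<Longrightarrow> int_field S S (field_deriv S A)"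
  using int_field_scale[of S S A "\<lambda>n. - of_int n" "-1"] by (simp add: field_deriv_def[abs_def])

lemma linear_scaled:
  assumes "Vector_Spaces.linear S S' f"
  shows "Vector_Spaces.linear S S' (\<lambda>x. S' c (f x))"
proof -
  interpret V: vector_space S' by (rule linear_vs[OF assms])
  show ?thesis
    by (rule linearI) (use assms in
        \<open>auto simp: linear_vs linear_add linear_scale V.scale_right_distrib V.scale_left_commute\<close>)
qed

lemma Sum_any_linear_nested:
  fixes S :: "complex \<Rightarrow> 'a::ab_group_add \<Rightarrow> 'a" and S' :: "complex \<Rightarrow> 'b::ab_group_add \<Rightarrow> 'b"
    and f g :: "'c \<Rightarrow> 'd \<Rightarrow> 'a"
  assumes "\<And>i. Vector_Spaces.linear S S' (L i)"
    and f: "finite {(i, j). f i j \<noteq> 0}" and g: "finite {(i, j). g i j \<noteq> 0}"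
  shows "Sum_any (\<lambda>i. L i (Sum_any (f i) + Sum_any (g i))) =
    Sum_any (\<lambda>(i, j). L i (f i j)) + Sum_any (\<lambda>(i, j). L i (g i j))"
proof -
  have L0: "L i 0 = 0" for i by (rule linear_0[OF assms(1)])
  have fin: "finite {(i, j). L i (h i j) \<noteq> 0}" if "finite {(i, j). h i j \<noteq> 0}" for h :: "'c \<Rightarrow> 'd \<Rightarrow> 'a"
    by (rule finite_subset[OF _ that]) (auto simp: L0)
  have push: "L i (Sum_any (h i)) = Sum_any (\<lambda>j. L i (h i j))"
    if "finite {(i, j). h i j \<noteq> 0}" for h :: "'c \<Rightarrow> 'd \<Rightarrow> 'a" and i
    by (rule Sum_any_linear[OF finite_slices(2)[OF that] assms(1)])
  show ?thesis
    unfolding linear_add[OF assms(1)] push[OF f] push[OF g]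
      Sum_any_nested[OF fin[OF f], symmetric] Sum_any_nested[OF fin[OF g], symmetric]
    by (rule Sum_any.distrib[OF finite_nested[OF fin[OF f]] finite_nested[OF fin[OF g]]])
qed

lemma normal_product_nat:
  "normal_product A B n u =
    Sum_any (\<lambda>j. A (- int j - 1) (B (n + int j) u)) + Sum_any (\<lambda>j. B (n - int j - 1) (A (int j) u))"
proof -
  have "Sum_any (\<lambda>j. A j (B (n - j - 1) u) when j < 0) =
      Sum_any (\<lambda>j. A (- int j - 1) (B (n - (- int j - 1) - 1) u) when - int j - 1 < 0)"
  proof (rule Sum_any_reindex_inj)
    show "inj (\<lambda>j. - int j - 1)" by (auto simp: inj_def)
    fix x :: int assume "x \<notin> range (\<lambda>j. - int j - 1)"
    then have "x \<noteq> - int (nat (- x - 1)) - 1" by blast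
    then show "(A x (B (n - x - 1) u) when x < 0) = 0" by (cases "x < 0") auto
  qed
  moreover have "Sum_any (\<lambda>j. B (n - j - 1) (A j u) when j \<ge> 0) =
      Sum_any (\<lambda>j. B (n - int j - 1) (A (int j) u) when int j \<ge> 0)"
  proof (rule Sum_any_reindex_inj)
    show "inj int" by (auto simp: inj_def)
    fix x :: int assume "x \<notin> range int"
    then have "x \<noteq> int (nat x)" by blast
    then show "(B (n - x - 1) (A x u) when x \<ge> 0) = 0" by (cases "x \<ge> 0") auto
  qed
  ultimately show ?thesis by (simp add: normal_product_def)
qed

lemma int_field_normal_product:
  assumes A: "int_field S S A" and B: "int_field S S B"
  shows "int_field S S (normal_product A B)"
proof -
  note vs = linear_vs(1)[OF int_field_linear[OF A]]
  interpret vector_space S by (rule vs)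
  note A0 = int_field_0[OF A] and B0 = int_field_0[OF B]
  have fin1: "finite {j::nat. A (- int j - 1) (B (n + int j) u) \<noteq> 0}" for n u
    by (rule finite_nonzero_mono[OF int_field_finite[OF B, of n u]]) (simp add: A0)
  have fin2: "finite {j::nat. B (n - int j - 1) (A (int j) u) \<noteq> 0}" for n u
    by (rule finite_nonzero_mono[OF int_field_finite[OF A, of 0 u]]) (simp add: B0)
  have "normal_product A B n (u + v) = normal_product A B n u + normal_product A B n v" for n u v
    unfolding normal_product_nat linear_add[OF int_field_linear[OF A]] linear_add[OF int_field_linear[OF B]]
    unfolding Sum_any.distrib[OF fin1 fin1] Sum_any.distrib[OF fin2 fin2] by (simp only: ac_simps)
  moreover have "normal_product A B n (S c u) = S c (normal_product A B n u)" for n c u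
    unfolding normal_product_nat linear_scale[OF int_field_linear[OF A]]
      linear_scale[OF int_field_linear[OF B]]
    unfolding scale_right_distrib Sum_any_scale[OF vs fin1] Sum_any_scale[OF vs fin2] by (rule refl)
  moreover have "\<exists>N. \<forall>n\<ge>N. normal_product A B n u = 0" for u
  proof -
    obtain M where M: "\<forall>n\<ge>M. B n u = 0" using B unfolding int_field_def by blast
    obtain K :: nat where K: "\<forall>j\<ge>K. A (0 + int j) u = 0" using int_field_trunc[OF A] by blast
    have "\<forall>j::nat. \<exists>L. \<forall>n\<ge>L. B n (A (int j) u) = 0"
      using B by (simp add: int_field_def)
    from choice[OF this] obtain L where L: "\<forall>j::nat. \<forall>n\<ge>L j. B n (A (int j) u) = 0" ..
    \<comment> \<open>In the second sum only \<open>j < K\<close> contribute, each with its own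
      bound \<open>L j\<close>; the shift \<open>j + 1\<close> undoes the mode
      \<open>n - j - 1\<close>.\<close>
    define N where "N = Max (insert M ((\<lambda>j. L j + int j + 1) ` {..<K}))"
    have N: "N \<ge> M" "\<And>j. j < K \<Longrightarrow> N \<ge> L j + int j + 1" by (auto simp: N_def)
    have "normal_product A B n u = 0" if "n \<ge> N" for n
    proof -
      have "B (n + int j) u = 0" for j using M N(1) that by auto
      moreover have "B (n - int j - 1) (A (int j) u) = 0" for j
      proof (cases "j < K")
        case True
        then have "n - int j - 1 \<ge> L j" using N(2) that by force
        then show ?thesis using L by blast
      qed (use K in \<open>simp add: B0\<close>)
      ultimately show ?thesis by (simp add: normal_product_nat A0)
    qed
    then show ?thesis by blast
  qed
  ultimately show ?thesis unfolding int_field_def by (auto intro!: linearI vs)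
qed

text \<open>The coefficient of \<open>y^i\<close> in \<open>(1 - y)^l\<close>; these numbers expand
  \<open>(x1 - x2)^l\<close> for integral \<open>l\<close> of either sign.\<close>

definition schoose :: "int \<Rightarrow> nat \<Rightarrow> complex"
  where "schoose l i = (-1) ^ i * (of_int l gchoose i)"

lemma schoose_0 [simp]: "schoose l 0 = 1" by (simp add: schoose_def)

lemma gbinomial_int_Suc:
  "(of_int (l + 1) :: complex) gchoose Suc i = (of_int l gchoose Suc i) + (of_int l gchoose i)"
  using gbinomial_Suc_Suc[of "of_int l :: complex" i] by simp

lemma schoose_Suc: "schoose (l + 1) (Suc i) = schoose l (Suc i) + (-1) * schoose l i"
  unfolding schoose_def gbinomial_int_Suc by (simp add: algebra_simps)

text \<open>Negation of the upper index of the binomial coefficient; these are the coefficients of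
  \<open>1/(1 - y)^(j+1)\<close>.\<close>

lemma schoose_minus: "schoose (- int j - 1) r = of_nat ((j + r) choose j)"
proof -
  have "(- of_nat j - 1 :: complex) gchoose r = (-1) ^ r * (of_nat (j + r) gchoose r)"
    by (subst gbinomial_negated_upper) (simp add: algebra_simps)
  then have "schoose (- int j - 1) r = of_nat (j + r) gchoose r"
    by (simp add: schoose_def power_mult_distrib[symmetric] mult.assoc[symmetric])
  then show ?thesis
    using binomial_symmetric[of r "j + r"] by (simp add: binomial_gbinomial[symmetric] del: of_nat_add)
qed

lemma minus_one_powi_add: "(-1 :: complex) powi (m + n) = (-1) powi m * (-1) powi n"
  by (rule power_int_add) simp

lemma gbinomial_minus_nat:
  "(of_int (- int j - 1) :: complex) gchoose i = (-1) ^ i * of_nat ((j + i) choose j)"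
  using schoose_minus[of j i] by (simp add: schoose_def power_mult_distrib[symmetric] mult.assoc[symmetric]
      flip: power_add mult.assoc) (metis (no_types, lifting) left_minus_one_mult_self)

text \<open>
  The maps \<open>A3\<close>, \<open>A2\<close>, \<open>A1\<close> below are the modes of one \<open>v\<close> on the three modules. The power of \<open>log x\<close> is
  the same in all terms of the Jacobi identity, and the exponents of \<open>x\<close> differ by integers; so both the
  power and the coset are fixed, and \<open>y w n\<close> is the coefficient of \<open>w\<close> with integral index \<open>n\<close>.
\<close>

locale jacobi_setting =
  fixes S1 :: "complex \<Rightarrow> 'a::ab_group_add \<Rightarrow> 'a"
    and S2 :: "complex \<Rightarrow> 'b::ab_group_add \<Rightarrow> 'b"
    and S3 :: "complex \<Rightarrow> 'c::ab_group_add \<Rightarrow> 'c"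
    and y :: "'a \<Rightarrow> int \<Rightarrow> 'b \<Rightarrow> 'c"
  assumes y_field: "int_field S2 S3 (y w)"
    and y_linear: "Vector_Spaces.linear S1 S3 (\<lambda>w. y w n u)"
begin

sublocale V1: vector_space S1 using y_linear by (rule linear_vs)
sublocale V2: vector_space S2 using int_field_linear[OF y_field] by (rule linear_vs)
sublocale V3: vector_space S3 using y_linear by (rule linear_vs)

lemma y_0 [simp]: "y 0 n u = 0" "y w n 0 = 0"
  by (rule linear_0[OF y_linear]) (rule int_field_0[OF y_field])

text \<open>The three terms of the Jacobi coefficient in \<open>log_intertwining_operator\<close>,
  in the order in which they occur there.\<close>

definition "left_sum A l m n w u = Sum_any (\<lambda>i. S3 (schoose l i) (A (m + l - int i) (y w (n + int i) u)))"

definition "mid_sum A l m n w u =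
  Sum_any (\<lambda>i. S3 ((-1) powi l * schoose l i) (y w (n + l - int i) (A (m + int i) u)))"

definition "right_sum A l m n w u =
  Sum_any (\<lambda>i. S3 (of_int m gchoose i) (y (A (l + int i) w) (m + n - int i) u))"

definition "jacobi A3 A2 A1 \<longleftrightarrow>
  int_field S3 S3 A3 \<and> int_field S2 S2 A2 \<and> int_field S1 S1 A1 \<and>
  (\<forall>l m n w u. left_sum A3 l m n w u - mid_sum A2 l m n w u = right_sum A1 l m n w u)"

lemmas sum_scale = Sum_any_scale[OF V3.vector_space_axioms]

lemma jacobi_fields:
  assumes "jacobi A3 A2 A1"
  shows "int_field S3 S3 A3" "int_field S2 S2 A2" "int_field S1 S1 A1"
  using assms by (auto simp: jacobi_def)

lemma jacobiD:
  assumes "jacobi A3 A2 A1"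
  shows "left_sum A3 l m n w u = mid_sum A2 l m n w u + right_sum A1 l m n w u"
  using assms by (auto simp: jacobi_def algebra_simps)

lemma fin1:
  assumes "int_field S3 S3 A"
  shows "finite {i::nat. A (p - int i) (y w (n + int i) u) \<noteq> 0}"
  by (rule finite_nonzero_mono[OF int_field_finite[OF y_field, of w n u]]) (simp add: int_field_0[OF assms])

lemma fin2:
  assumes "int_field S2 S2 A"
  shows "finite {i::nat. y w (p - int i) (A (m + int i) u) \<noteq> 0}"
  by (rule finite_nonzero_mono[OF int_field_finite[OF assms, of m u]]) simp

lemma fin3:
  assumes "int_field S1 S1 A"
  shows "finite {i::nat. y (A (l + int i) w) (p - int i) u \<noteq> 0}"
  by (rule finite_nonzero_mono[OF int_field_finite[OF assms, of l w]]) simp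

text \<open>\<open>left_sum\<close> is the residue of
  \<open>(x1 - x2)^l x1^m x2^n A(x1) y(x2)\<close>, and the additional factor \<open>x1\<close> is
  split as \<open>(x1 - x2) + x2\<close>.\<close>

lemma left_sum_rec:
  assumes "int_field S3 S3 A"
  shows "left_sum A l (m + 1) n w u = left_sum A (l + 1) m n w u + left_sum A l m (n + 1) w u"
proof -
  let ?F = "\<lambda>i. A (m + 1 + l - int i) (y w (n + int i) u)"
  have "Sum_any (\<lambda>i. S3 (schoose (l + 1) i) (?F i)) =
      Sum_any (\<lambda>i. S3 (schoose l i) (?F i)) + S3 (-1) (Sum_any (\<lambda>i. S3 (schoose l i) (?F (Suc i))))"
    by (rule Sum_any_pascal[OF V3.vector_space_axioms fin1[OF assms]]) (simp_all add: schoose_Suc)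
  then show ?thesis
    unfolding left_sum_def by (simp add: algebra_simps)
qed

text \<open>The same splitting, with \<open>(x1 - x2)^l\<close> expanded as
  \<open>(-1)^l (x2 - x1)^l\<close> in nonnegative powers of \<open>x1\<close>. The prefactor
  alternates with \<open>l\<close>, so the Pascal rule is applied to the coefficients multiplied by
  \<open>- ?s\<close>.\<close>

lemma mid_sum_rec:
  assumes "int_field S2 S2 A"
  shows "mid_sum A l (m + 1) n w u = mid_sum A (l + 1) m n w u + mid_sum A l m (n + 1) w u"
proof -
  let ?F = "\<lambda>i. y w (n + 1 + l - int i) (A (m + int i) u)"
  let ?s = "(-1) powi l :: complex"
  have "Sum_any (\<lambda>i. S3 (- ?s * schoose (l + 1) i) (?F i)) =
      Sum_any (\<lambda>i. S3 (- ?s * schoose l i) (?F i)) + S3 (-1) (Sum_any (\<lambda>i. S3 (- ?s * schoose l i) (?F (Suc i))))"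
    by (rule Sum_any_pascal[OF V3.vector_space_axioms fin2[OF assms]]) (simp_all add: schoose_Suc distrib_left right_diff_distrib)
  moreover have "(-1) powi (l + 1) = - ?s" by (simp add: minus_one_powi_add)
  moreover have "Sum_any (\<lambda>i. S3 (- ?s * schoose l i) (G i)) = - Sum_any (\<lambda>i. S3 (?s * schoose l i) (G i))"
    if "finite {i. G i \<noteq> 0}" for G
  proof -
    have "Sum_any (\<lambda>i. - S3 (?s * schoose l i) (G i)) = - Sum_any (\<lambda>i. S3 (?s * schoose l i) (G i))"
      by (rule Sum_any_additive[symmetric]) (auto intro: finite_nonzero_mono[OF that])
    then show ?thesis by simp
  qed
  ultimately show ?thesis
    unfolding mid_sum_def using fin2[OF assms, of w "n + 1 + l" m u] fin2[OF assms, of w "n + l" "m + 1" u]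
    by (simp add: algebra_simps)
qed

text \<open>Here the kernel is \<open>x0^l (x2 + x0)^m x2^n\<close>, and one factor
  \<open>x2 + x0\<close> is multiplied out.\<close>

lemma right_sum_rec:
  assumes "int_field S1 S1 A"
  shows "right_sum A l (m + 1) n w u = right_sum A (l + 1) m n w u + right_sum A l m (n + 1) w u"
proof -
  let ?F = "\<lambda>i. y (A (l + int i) w) (m + 1 + n - int i) u"
  have "Sum_any (\<lambda>i. S3 (of_int (m + 1) gchoose i) (?F i)) =
      Sum_any (\<lambda>i. S3 (of_int m gchoose i) (?F i)) +
      S3 1 (Sum_any (\<lambda>i. S3 (of_int m gchoose i) (?F (Suc i))))"
    by (rule Sum_any_pascal[OF V3.vector_space_axioms fin3[OF assms]])
      (simp_all add: gbinomial_int_Suc del: of_int_add)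
  then show ?thesis
    unfolding right_sum_def by (simp add: algebra_simps)
qed

text \<open>
  The defect of the identity satisfies \<open>D(l, m + 1, n) = D(l + 1, m, n) + D(l, m, n + 1)\<close>, because
  \<open>x\<^sub>1 = x\<^sub>0 + x\<^sub>2\<close>. Hence the commutator formula (\<open>l = 0\<close>) and the associativity formula (\<open>m = 0\<close>) for negative
  \<open>l\<close> suffice.
\<close>

lemma jacobiI:
  assumes fields: "int_field S3 S3 A3" "int_field S2 S2 A2" "int_field S1 S1 A1"
    and comm: "\<And>m n w u. left_sum A3 0 m n w u - mid_sum A2 0 m n w u = right_sum A1 0 m n w u"
    and assoc: "\<And>l n w u. l < 0 \<Longrightarrow> left_sum A3 l 0 n w u - mid_sum A2 l 0 n w u = right_sum A1 l 0 n w u"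
  shows "jacobi A3 A2 A1"
proof -
  define D where "D l m n w u = left_sum A3 l m n w u - mid_sum A2 l m n w u - right_sum A1 l m n w u" for l m n w u
  have rec: "D l (m + 1) n w u = D (l + 1) m n w u + D l m (n + 1) w u" for l m n w u
    unfolding D_def left_sum_rec[OF fields(1)] mid_sum_rec[OF fields(2)] right_sum_rec[OF fields(3)] by simp
  have 0: "D 0 m n w u = 0" for m n w u
    by (simp add: D_def comm)
  have nonneg: "D (int k) m n w u = 0" for k m n w u
  proof (induction k arbitrary: m n)
    case (Suc k)
    show ?case using rec[of "int k" m n w u] Suc by (simp add: add.commute)
  qed (simp add: 0)
  have neg: "D (- int k) m n w u = 0" for k m n w u
  proof (induction k arbitrary: m n)
    case (Suc k)
    \<comment> \<open>The term with \<open>l + 1\<close> vanishes by the induction hypothesis, so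
      the defect depends on \<open>m + n\<close> only and can be moved to \<open>m = 0\<close>,
      where associativity applies.\<close>
    have step: "D (- int (Suc k)) (m + 1) n w u = D (- int (Suc k)) m (n + 1) w u" for m n
      using rec[of "- int (Suc k)" m n w u] Suc by simp
    have zero: "D (- int (Suc k)) 0 n w u = 0" for n
      using assoc[of "- int (Suc k)" n w u] by (simp add: D_def)
    show ?case
    proof (induction m arbitrary: n rule: int_induct[where k = 0])
      case (step1 m) then show ?case by (simp only: step)
    next
      case (step2 m) then show ?case using step[of "m - 1" "n - 1"] by simp
    qed (rule zero)
  qed (simp add: 0)
  have "D l m n w u = 0" for l m n w u
    using nonneg[of "nat l" m n w u] neg[of "nat (- l)" m n w u] by (cases "l \<ge> 0") auto
  then show ?thesis using fields by (simp add: jacobi_def D_def)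
qed

text \<open>The case \<open>l = 0\<close>: \<open>(x1 - x2)^0\<close> leaves only
  \<open>i = 0\<close> in the first two sums.\<close>

lemma jacobi_comm:
  assumes "jacobi A3 A2 A1"
  shows "A3 q (y w r v) =
    y w r (A2 q v) + Sum_any (\<lambda>i. S3 (of_int q gchoose i) (y (A1 (int i) w) (q + r - int i) v))"
proof -
  have sb0: "schoose 0 i = (if i = 0 then 1 else 0)" for i
    by (simp add: schoose_def gbinomial_0_left)
  have "left_sum A3 0 q r w v = A3 q (y w r v)"
    unfolding left_sum_def by (subst Sum_any.expand_superset[of "{0}"]) (auto simp: sb0)
  moreover have "mid_sum A2 0 q r w v = y w r (A2 q v)"
    unfolding mid_sum_def by (subst Sum_any.expand_superset[of "{0}"]) (auto simp: sb0)
  ultimately show ?thesis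
    using jacobiD[OF assms, of 0 q r w v] by (simp add: right_sum_def)
qed

text \<open>The case \<open>m = 0\<close>, where \<open>(x2 + x0)^0\<close> leaves a single term on
  the right: the operator of \<open>A1 p x\<close> is the \<open>p\<close>-th product of two
  fields.\<close>

lemma jacobi_assoc:
  assumes "jacobi A3 A2 A1"
  shows "y (A1 p x) q v = Sum_any (\<lambda>r. S3 (schoose p r) (A3 (p - int r) (y x (q + int r) v))) -
    Sum_any (\<lambda>r. S3 ((-1) powi p * schoose p r) (y x (q + p - int r) (A2 (int r) v)))"
proof -
  have "right_sum A1 p 0 q x v = y (A1 p x) q v"
    unfolding right_sum_def by (subst Sum_any.expand_superset[of "{0}"]) (auto simp: gbinomial_0_left)
  then show ?thesis
    using jacobiD[OF assms, of p 0 q x v] by (simp add: left_sum_def mid_sum_def)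
qed

section \<open>Closure properties of the Jacobi identity, except for normally ordered
  products\<close>

lemma jacobi_zero: "jacobi (\<lambda>_ _. 0) (\<lambda>_ _. 0) (\<lambda>_ _. 0)"
  by (simp add: jacobi_def left_sum_def mid_sum_def right_sum_def int_field_zero V1.vector_space_axioms
      V2.vector_space_axioms V3.vector_space_axioms)

lemma fin_scaled:
  assumes "finite {i. F i \<noteq> 0}"
  shows "finite {i. S3 (c i) (F i) \<noteq> 0}"
  by (rule finite_nonzero_mono[OF assms]) simp

lemma jacobi_add:
  assumes "jacobi A3 A2 A1" and "jacobi B3 B2 B1"
  shows "jacobi (\<lambda>n u. A3 n u + B3 n u) (\<lambda>n u. A2 n u + B2 n u) (\<lambda>n u. A1 n u + B1 n u)"
proof -
  note A = jacobi_fields[OF assms(1)] and B = jacobi_fields[OF assms(2)]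
  have "left_sum (\<lambda>n u. A3 n u + B3 n u) l m n w u = left_sum A3 l m n w u + left_sum B3 l m n w u" for l m n w u
    unfolding left_sum_def V3.scale_right_distrib by (rule Sum_any.distrib; intro fin_scaled fin1 A B)
  moreover have "mid_sum (\<lambda>n u. A2 n u + B2 n u) l m n w u = mid_sum A2 l m n w u + mid_sum B2 l m n w u" for l m n w u
    unfolding mid_sum_def linear_add[OF int_field_linear[OF y_field]] V3.scale_right_distrib
    by (rule Sum_any.distrib; intro fin_scaled fin2 A B)
  moreover have "right_sum (\<lambda>n u. A1 n u + B1 n u) l m n w u = right_sum A1 l m n w u + right_sum B1 l m n w u" for l m n w u
    unfolding right_sum_def linear_add[OF y_linear] V3.scale_right_distrib
    by (rule Sum_any.distrib; intro fin_scaled fin3 A B)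
  ultimately show ?thesis
    using A B jacobiD[OF assms(1)] jacobiD[OF assms(2)] by (simp add: jacobi_def int_field_add)
qed

lemma jacobi_scale:
  assumes "jacobi A3 A2 A1"
  shows "jacobi (\<lambda>n u. S3 c (A3 n u)) (\<lambda>n u. S2 c (A2 n u)) (\<lambda>n u. S1 c (A1 n u))"
proof -
  note A = jacobi_fields[OF assms]
  have "left_sum (\<lambda>n u. S3 c (A3 n u)) l m n w u = S3 c (left_sum A3 l m n w u)" for l m n w u
    unfolding left_sum_def by (subst sum_scale)
      (auto intro!: fin_scaled fin1 A simp: mult.commute)
  moreover have "mid_sum (\<lambda>n u. S2 c (A2 n u)) l m n w u = S3 c (mid_sum A2 l m n w u)" for l m n w u
    unfolding mid_sum_def by (subst sum_scale)
      (auto intro!: fin_scaled fin2 A simp: mult.commute linear_scale[OF int_field_linear[OF y_field]])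
  moreover have "right_sum (\<lambda>n u. S1 c (A1 n u)) l m n w u = S3 c (right_sum A1 l m n w u)" for l m n w u
    unfolding right_sum_def by (subst sum_scale)
      (auto intro!: fin_scaled fin3 A simp: mult.commute linear_scale[OF y_linear])
  ultimately show ?thesis
    using A jacobiD[OF assms] int_field_scale[of S3 S3 A3 "\<lambda>_. c" 0]
      int_field_scale[of S2 S2 A2 "\<lambda>_. c" 0] int_field_scale[of S1 S1 A1 "\<lambda>_. c" 0]
    by (simp add: jacobi_def V3.scale_right_distrib)
qed

lemma jacobi_sum:
  assumes "finite K" and "\<And>k. k \<in> K \<Longrightarrow> jacobi (A3 k) (A2 k) (A1 k)"
  shows "jacobi (\<lambda>n u. \<Sum>k\<in>K. A3 k n u) (\<lambda>n u. \<Sum>k\<in>K. A2 k n u) (\<lambda>n u. \<Sum>k\<in>K. A1 k n u)"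
  using assms
proof (induction K rule: finite_induct)
  case (insert x F)
  then have "jacobi (A3 x) (A2 x) (A1 x)" "jacobi (\<lambda>n u. \<Sum>k\<in>F. A3 k n u) (\<lambda>n u. \<Sum>k\<in>F. A2 k n u)
    (\<lambda>n u. \<Sum>k\<in>F. A1 k n u)" by auto
  then show ?case using insert(1,2) jacobi_add by simp
qed (simp add: jacobi_zero)

text \<open>The Jacobi identity for the vacuum vector, from which normally ordered products are
  built up.\<close>

lemma jacobi_id:
  "jacobi (\<lambda>n u. u when n = -1) (\<lambda>n u. u when n = -1) (\<lambda>n u. u when n = -1)"
proof (rule jacobiI)
  show "int_field S3 S3 (\<lambda>n u. u when n = -1)" "int_field S2 S2 (\<lambda>n u. u when n = -1)"
    "int_field S1 S1 (\<lambda>n u. u when n = -1)"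
    by (simp_all add: int_field_id V1.vector_space_axioms V2.vector_space_axioms V3.vector_space_axioms)
next
  fix m n w u
  have sb0: "schoose 0 i = (if i = 0 then 1 else 0)" for i
    by (simp add: schoose_def gbinomial_0_left)
  have "left_sum (\<lambda>n u. u when n = -1) 0 m n w u = (y w n u when m = -1)"
    unfolding left_sum_def by (subst Sum_any.expand_superset[of "{0}"]) (auto simp: sb0)
  moreover have "mid_sum (\<lambda>n u. u when n = -1) 0 m n w u = (y w n u when m = -1)"
    unfolding mid_sum_def by (subst Sum_any.expand_superset[of "{0}"]) (auto simp: sb0 when_def)
  moreover have "right_sum (\<lambda>n u. u when n = -1) 0 m n w u = 0"
    unfolding right_sum_def by simp
  ultimately show "left_sum (\<lambda>n u. u when n = -1) 0 m n w u - mid_sum (\<lambda>n u. u when n = -1) 0 m n w u =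
      right_sum (\<lambda>n u. u when n = -1) 0 m n w u" by simp
next
  fix l n :: int and w u assume l: "l < 0"
  have "left_sum (\<lambda>n u. u when n = -1) l 0 n w u = (y w n u when l = -1)"
    unfolding left_sum_def by (subst Sum_any.expand_superset[of "{0}"]) (use l in \<open>auto simp: when_def split: if_splits\<close>)
  moreover have "mid_sum (\<lambda>n u. u when n = -1) l 0 n w u = 0"
    unfolding mid_sum_def by simp
  moreover have "right_sum (\<lambda>n u. u when n = -1) l 0 n w u = (y w n u when l = -1)"
    unfolding right_sum_def by (subst Sum_any.expand_superset[of "{0}"]) (auto simp: gbinomial_0_left when_def)
  ultimately show "left_sum (\<lambda>n u. u when n = -1) l 0 n w u - mid_sum (\<lambda>n u. u when n = -1) l 0 n w u =
      right_sum (\<lambda>n u. u when n = -1) l 0 n w u" by simp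
qed

lemma Sum_any_lincomb:
  assumes "finite {i. F i \<noteq> 0}" and "\<And>i. p i = a * q i + b * r i"
  shows "Sum_any (\<lambda>i. S3 (p i) (F i)) =
    S3 a (Sum_any (\<lambda>i. S3 (q i) (F i))) + S3 b (Sum_any (\<lambda>i. S3 (r i) (F i)))"
proof -
  have "Sum_any (\<lambda>i. S3 (p i) (F i)) = Sum_any (\<lambda>i. S3 a (S3 (q i) (F i)) + S3 b (S3 (r i) (F i)))"
    by (simp add: assms(2) V3.scale_left_distrib)
  also have "\<dots> = Sum_any (\<lambda>i. S3 a (S3 (q i) (F i))) + Sum_any (\<lambda>i. S3 b (S3 (r i) (F i)))"
    by (rule Sum_any.distrib; rule finite_nonzero_mono[OF assms(1)]; simp)
  finally show ?thesis
    by (simp only: sum_scale[OF fin_scaled[OF assms(1)]])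
qed

text \<open>The factor \<open>i\<close> removes the term \<open>i = 0\<close>, so the index can be
  lowered; absorption identities for binomials provide \<open>r\<close>.\<close>

lemma Sum_any_absorb:
  assumes "finite {i. F i \<noteq> 0}" and "\<And>i. of_nat (Suc i) * q (Suc i) = r i"
  shows "Sum_any (\<lambda>i. S3 (of_nat i * q i) (F i)) = Sum_any (\<lambda>i. S3 (r i) (F (Suc i)))"
  by (subst Sum_any_Suc[OF fin_scaled[OF assms(1)]]) (simp add: assms(2) del: of_nat_Suc)

lemma schoose_absorb_comp: "(of_int l - of_nat i) * schoose l i = of_int l * schoose (l - 1) i"
  using arg_cong[OF gbinomial_absorb_comp[of "of_int l :: complex" i], of "\<lambda>x. (-1) ^ i * x"]
  by (simp add: schoose_def mult.left_commute)

lemma schoose_absorb: "of_nat (Suc i) * schoose l (Suc i) = - of_int l * schoose (l - 1) i"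
  using arg_cong[OF gbinomial_absorption[of i "of_int l :: complex"], of "\<lambda>x. - ((-1) ^ i * x)"]
  by (simp add: schoose_def mult.left_commute del: of_nat_Suc)

text \<open>Integration by parts in \<open>x1\<close>. Differentiating the kernel
  \<open>(x1 - x2)^l x1^m\<close> yields \<open>m\<close> times the kernel at \<open>m - 1\<close>
  plus \<open>l\<close> times the kernel at \<open>l - 1\<close>, and this happens in all three
  expansions alike; so the identity for the derivative is a combination of two instances of the
  given one.\<close>

lemma jacobi_deriv:
  assumes "jacobi A3 A2 A1"
  shows "jacobi (field_deriv S3 A3) (field_deriv S2 A2) (field_deriv S1 A1)"
proof -
  note A = jacobi_fields[OF assms]
  have "left_sum (field_deriv S3 A3) l m n w u =
      S3 (- of_int m) (left_sum A3 l (m - 1) n w u) + S3 (- of_int l) (left_sum A3 (l - 1) m n w u)" for l m n w u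
  proof -
    let ?F = "\<lambda>i. A3 (m - 1 + l - int i) (y w (n + int i) u)"
    have "Sum_any (\<lambda>i. S3 (schoose l i * - of_int (m + l - int i)) (?F i)) =
        S3 (- of_int m) (Sum_any (\<lambda>i. S3 (schoose l i) (?F i))) +
        S3 (- of_int l) (Sum_any (\<lambda>i. S3 (schoose (l - 1) i) (?F i)))"
      by (rule Sum_any_lincomb[OF fin1[OF A(1)]]) (use schoose_absorb_comp[of l] in \<open>simp add: algebra_simps\<close>)
    moreover have "m + l - int i - 1 = m - 1 + l - int i" "m + (l - 1) - int i = m - 1 + l - int i" for i
      by simp_all
    ultimately show ?thesis unfolding left_sum_def field_deriv_def V3.scale_scale by (simp only:)
  qed
  moreover have "mid_sum (field_deriv S2 A2) l m n w u =
      S3 (- of_int m) (mid_sum A2 l (m - 1) n w u) + S3 (- of_int l) (mid_sum A2 (l - 1) m n w u)" for l m n w u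
  proof -
    let ?F = "\<lambda>i. y w (n + l - int i) (A2 (m - 1 + int i) u)" and ?s = "(-1) powi l :: complex"
    have "(-1) powi (l - 1) = - ?s" using minus_one_powi_add[of "l - 1" 1] by simp
    then have "of_nat (Suc i) * (?s * schoose l (Suc i)) = of_int l * ((-1) powi (l - 1) * schoose (l - 1) i)" for i
      using arg_cong[OF schoose_absorb[of i l], of "\<lambda>x. ?s * x"]
      by (simp add: mult.left_commute del: of_nat_Suc)
    then have "Sum_any (\<lambda>i. S3 (of_nat i * (?s * schoose l i)) (?F i)) =
        Sum_any (\<lambda>i. S3 (of_int l * ((-1) powi (l - 1) * schoose (l - 1) i)) (?F (Suc i)))"
      by (intro Sum_any_absorb fin2[OF A(2)])
    moreover have "?F (Suc i) = y w (n + (l - 1) - int i) (A2 (m + int i) u)" for i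
      by (simp add: algebra_simps)
    ultimately have "Sum_any (\<lambda>i. S3 (of_nat i * (?s * schoose l i)) (?F i)) =
        S3 (of_int l) (mid_sum A2 (l - 1) m n w u)"
      unfolding mid_sum_def sum_scale[OF fin_scaled[OF fin2[OF A(2)]]]
      by (simp only: V3.scale_scale)
    moreover have "Sum_any (\<lambda>i. S3 (?s * schoose l i * - of_int (m + int i)) (?F i)) =
        S3 (- of_int m) (Sum_any (\<lambda>i. S3 (?s * schoose l i) (?F i))) +
        S3 (-1) (Sum_any (\<lambda>i. S3 (of_nat i * (?s * schoose l i)) (?F i)))"
      by (rule Sum_any_lincomb[OF fin2[OF A(2)]]) (simp add: algebra_simps)
    moreover have "m + int i - 1 = m - 1 + int i" for i by simp
    ultimately show ?thesis
      unfolding mid_sum_def field_deriv_def linear_scale[OF int_field_linear[OF y_field]] V3.scale_scale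
      by (simp only: V3.scale_minus_left V3.scale_one)
  qed
  moreover have "right_sum (field_deriv S1 A1) l m n w u =
      S3 (- of_int m) (right_sum A1 l (m - 1) n w u) + S3 (- of_int l) (right_sum A1 (l - 1) m n w u)" for l m n w u
  proof -
    let ?F = "\<lambda>i. y (A1 (l - 1 + int i) w) (m + n - int i) u"
    let ?c = "\<lambda>i. of_int m gchoose i :: complex"
    have "of_nat (Suc i) * ?c (Suc i) = of_int m * (of_int (m - 1) gchoose i)" for i
      using gbinomial_absorption[of i "of_int m :: complex"] by simp
    then have "Sum_any (\<lambda>i. S3 (of_nat i * ?c i) (?F i)) =
        Sum_any (\<lambda>i. S3 (of_int m * (of_int (m - 1) gchoose i)) (?F (Suc i)))"
      by (intro Sum_any_absorb fin3[OF A(3)])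
    moreover have "?F (Suc i) = y (A1 (l + int i) w) (m - 1 + n - int i) u" for i
      by (simp add: algebra_simps)
    ultimately have "Sum_any (\<lambda>i. S3 (of_nat i * ?c i) (?F i)) = S3 (of_int m) (right_sum A1 l (m - 1) n w u)"
      unfolding right_sum_def sum_scale[OF fin_scaled[OF fin3[OF A(3)]]]
      by (simp only: V3.scale_scale)
    moreover have "Sum_any (\<lambda>i. S3 (?c i * - of_int (l + int i)) (?F i)) =
        S3 (- of_int l) (Sum_any (\<lambda>i. S3 (?c i) (?F i))) +
        S3 (-1) (Sum_any (\<lambda>i. S3 (of_nat i * ?c i) (?F i)))"
      by (rule Sum_any_lincomb[OF fin3[OF A(3)]]) (simp add: algebra_simps)
    moreover have "l + int i - 1 = l - 1 + int i" for i by simp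
    ultimately show ?thesis
      unfolding right_sum_def field_deriv_def linear_scale[OF y_linear] V3.scale_scale
      by (simp only: V3.scale_minus_left V3.scale_one add.commute)
  qed
  ultimately have "left_sum (field_deriv S3 A3) l m n w u - mid_sum (field_deriv S2 A2) l m n w u =
      right_sum (field_deriv S1 A1) l m n w u" for l m n w u
    by (simp only: jacobiD[OF assms] V3.scale_right_distrib) simp
  then show ?thesis
    using A by (simp add: jacobi_def int_field_deriv)
qed

end

section \<open>Normally ordered products\<close>

lemma Vandermonde_int:
  "(\<Sum>j\<le>n. ((of_int a :: complex) gchoose j) * (of_int b gchoose (n - j))) = of_int (a + b) gchoose n"
  using gbinomial_Vandermonde[of "of_int a :: complex" "of_int b" n] by (simp add: atMost_atLeast0)

lemma schoose_Vandermonde: "(\<Sum>j\<le>n. schoose a j * schoose b (n - j)) = schoose (a + b) n"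
proof -
  have "schoose a j * schoose b (n - j) = (-1) ^ n * ((of_int a gchoose j) * (of_int b gchoose (n - j)))"
    if "j \<le> n" for j
    using power_add[of "-1 :: complex" j "n - j"] that by (simp add: schoose_def)
  then have "(\<Sum>j\<le>n. schoose a j * schoose b (n - j)) =
      (-1) ^ n * (\<Sum>j\<le>n. (of_int a gchoose j) * (of_int b gchoose (n - j)))"
    by (simp add: sum_distrib_left)
  then show ?thesis by (simp only: Vandermonde_int schoose_def)
qed

text \<open>\<open>schoose (- j - 1) (J - j)\<close> is \<open>J choose j\<close>, so this is the
  convolution with upper indices \<open>J\<close> and \<open>m\<close>.\<close>

lemma sum_fibre_GG:
  "(\<Sum>((i, j), r)\<in>(\<lambda>j. ((I - j, j), J - j)) ` {..min I J}.
     ((of_int m gchoose i) * schoose (- int j - 1) r)) =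
   of_int (m + int J) gchoose I"
  (is "?L = _")
proof -
  let ?f = "\<lambda>j. (of_int (int J) gchoose j) * ((of_int m :: complex) gchoose (I - j))"
  have "?L =
      (\<Sum>j\<le>min I J. (of_int m gchoose (I - j)) * schoose (- int j - 1) (J - j))"
    by (subst sum.reindex) (auto simp: inj_on_def)
  also have "\<dots> = (\<Sum>j\<le>min I J. ?f j)"
  proof (rule sum.cong[OF refl])
    fix j assume "j \<in> {..min I J}"
    then have "schoose (- int j - 1) (J - j) = of_int (int J) gchoose j"
      by (simp add: schoose_minus binomial_gbinomial)
    then show "(of_int m gchoose (I - j)) * schoose (- int j - 1) (J - j) = ?f j" by simp
  qed
  \<comment> \<open>For \<open>j > J\<close> the coefficient \<open>J choose j\<close> vanishes, so
    the cut-off at \<open>min I J\<close> may be raised to \<open>I\<close>.\<close>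
  also have "\<dots> = (\<Sum>j\<le>I. ?f j)"
    by (rule sum.mono_neutral_left) (auto simp: binomial_gbinomial[symmetric])
  also have "\<dots> = of_int (m + int J) gchoose I"
    by (simp only: Vandermonde_int) (simp add: add.commute)
  finally show ?thesis .
qed

text \<open>Symmetry of \<open>(j + r) choose j\<close> turns the factor with index
  \<open>- j - 1\<close> into a binomial with upper index \<open>- r - 1\<close>, up to sign; then
  the convolution has upper indices \<open>- r - 1\<close> and \<open>m\<close>.\<close>

lemma sum_fibre_GH:
  "(\<Sum>((i, j), r)\<in>(\<lambda>j. ((I - j, j), r)) ` {..I}.
     ((of_int m gchoose i) * ((-1) powi (- int j - 1) * schoose (- int j - 1) r))) =
   - (of_int (m - int r - 1) gchoose I)"
  (is "?L = _")
proof -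
  have "?L =
     (\<Sum>j\<le>I. (of_int m gchoose (I - j)) * ((-1) powi (- int j - 1) * schoose (- int j - 1) r))"
    by (subst sum.reindex) (auto simp: inj_on_def)
  also have "\<dots> = (\<Sum>j\<le>I. - ((of_int (- int r - 1) gchoose j) * (of_int m gchoose (I - j))))"
  proof (rule sum.cong[OF refl])
    fix j
    have "(-1 :: complex) powi (- int j - 1) = - ((-1) ^ j)"
      by (simp add: power_int_def nat_add_distrib)
    moreover have "of_int (- int r - 1) gchoose j = (-1) ^ j * schoose (- int j - 1) r"
      using binomial_symmetric[of j "j + r"]
      by (simp add: gbinomial_minus_nat schoose_minus add.commute del: of_int_diff of_int_minus)
    ultimately show "(of_int m gchoose (I - j)) * ((-1) powi (- int j - 1) * schoose (- int j - 1) r) =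
        - ((of_int (- int r - 1) gchoose j) * (of_int m gchoose (I - j)))"
      by simp
  qed
  also have "\<dots> = - (of_int (- int r - 1 + m) gchoose I)"
    by (simp only: sum_negf Vandermonde_int)
  also have "- int r - 1 + m = m - int r - 1" by simp
  finally show ?thesis .
qed

text \<open>\<open>(J + d) choose J\<close> is the coefficient of \<open>y^d\<close> in
  \<open>(1 - y)^(-J-1)\<close>, so the sum is a coefficient of
  \<open>(1 - y)^(l-J-1)\<close>.\<close>

lemma sum_fibre_G4:
  "(\<Sum>((i, j), k)\<in>(\<lambda>d. ((R - d, J + d), J)) ` {..R}.
     (schoose l i * (of_int (int j) gchoose k))) = schoose (l - int J - 1) R"
  (is "?L = _")
proof -
  have "?L =
     (\<Sum>d\<le>R. schoose l (R - d) * (of_int (int (J + d)) gchoose J))"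
    by (subst sum.reindex) (auto simp: inj_on_def)
  also have "\<dots> = (\<Sum>d\<le>R. schoose (- int J - 1) d * schoose l (R - d))"
    by (rule sum.cong[OF refl]) (simp add: schoose_minus binomial_gbinomial)
  also have "\<dots> = schoose (- int J - 1 + l) R" by (rule schoose_Vandermonde)
  also have "- int J - 1 + l = l - int J - 1" by simp
  finally show ?thesis .
qed

text \<open>As for \<open>sum_fibre_G4\<close>; the sign \<open>(-1)^J\<close> from the negative
  upper index combines with \<open>(-1)^l\<close> to minus the sign belonging to
  \<open>l - J - 1\<close>.\<close>

lemma sum_fibre_G3:
  "(\<Sum>((j, i), k)\<in>(\<lambda>j. ((j, R - j), J)) ` {..R}.
     ((-1) powi l * schoose l i * (of_int (- int j - 1) gchoose k))) =
   - ((-1) powi (l - int J - 1) * schoose (l - int J - 1) R)"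
  (is "?L = _")
proof -
  have "?L =
     (\<Sum>j\<le>R. (-1) powi l * schoose l (R - j) * (of_int (- int j - 1) gchoose J))"
    by (subst sum.reindex) (auto simp: inj_on_def)
  also have "\<dots> = (-1) powi l * (-1) ^ J * (\<Sum>j\<le>R. schoose (- int J - 1) j * schoose l (R - j))"
    unfolding sum_distrib_left
  proof (rule sum.cong[OF refl])
    fix j
    have "of_int (- int j - 1) gchoose J = (-1) ^ J * schoose (- int J - 1) j"
      using binomial_symmetric[of j "j + J"]
      by (simp add: gbinomial_minus_nat schoose_minus add.commute del: of_int_diff of_int_minus)
    then show "(-1) powi l * schoose l (R - j) * (of_int (- int j - 1) gchoose J) =
        (-1) powi l * (-1) ^ J * (schoose (- int J - 1) j * schoose l (R - j))"
      by simp
  qed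
  also have "\<dots> = (-1) powi l * (-1) ^ J * schoose (- int J - 1 + l) R" by (simp only: schoose_Vandermonde)
  also have "(-1 :: complex) ^ J = - ((-1) powi (- int J - 1))"
    by (simp add: power_int_def nat_add_distrib)
  also have "(-1) powi l * - ((-1) powi (- int J - 1)) * schoose (- int J - 1 + l) R =
      - ((-1) powi (l + (- int J - 1)) * schoose (- int J - 1 + l) R)"
    by (simp only: minus_one_powi_add) simp
  also have "l + (- int J - 1) = l - int J - 1" by simp
  also have "- int J - 1 + l = l - int J - 1" by simp
  finally show ?thesis .
qed

text \<open>The shape that arises when one mode inside a double sum is expanded by the commutator or
  the associativity formula: an outer pair and an inner index.\<close>

lemma Sum_any_fibres_pair:
  assumes "vector_space S" and "finite {x. G x \<noteq> 0}" and "\<And>x. finite (F x)"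
    and "\<forall>t. c t \<noteq> 0 \<longrightarrow> t \<in> F (\<pi> t)" and "\<And>x t. t \<in> F x \<Longrightarrow> \<pi> t = x"
  shows "Sum_any (\<lambda>p. Sum_any (\<lambda>k. S (c (p, k)) (G (\<pi> (p, k))))) = Sum_any (\<lambda>x. S (\<Sum>t\<in>F x. c t) (G x))"
    and "finite {p. Sum_any (\<lambda>k. S (c (p, k)) (G (\<pi> (p, k)))) \<noteq> 0}"
proof -
  note fib = Sum_any_fibres[OF assms(1-3) assms(4)[rule_format] assms(5), simplified]
  have fin: "finite {(p, k). S (c (p, k)) (G (\<pi> (p, k))) \<noteq> 0}"
    using fib(2) by (simp add: case_prod_unfold)
  show "finite {p. Sum_any (\<lambda>k. S (c (p, k)) (G (\<pi> (p, k)))) \<noteq> 0}"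
    by (rule finite_nested[OF fin])
  show "Sum_any (\<lambda>p. Sum_any (\<lambda>k. S (c (p, k)) (G (\<pi> (p, k))))) = Sum_any (\<lambda>x. S (\<Sum>t\<in>F x. c t) (G x))"
    using fib(1) unfolding Sum_any_nested[OF fin] by (simp add: case_prod_unfold)
qed

lemma Sum_any_pair_swap: "Sum_any (\<lambda>(i, j). f i j) = Sum_any (\<lambda>(j, i). f i j)"
  by (rule Sum_any.reindex_cong[of prod.swap]) (auto simp: fun_eq_iff)

context jacobi_setting
begin

text \<open>
  With \<open>(AB)(y) = Res\<^sub>x (A(x) B(y) \<iota> (x - y)\<^sup>-\<^sup>1 - B(y) A(x) \<iota>' (x - y)\<^sup>-\<^sup>1)\<close>, move first \<open>B\<close> and then \<open>A\<close> past
  \<open>\<Y>(w)\<close> in \<open>A B \<Y>(w)\<close>, and in the opposite order in \<open>B A \<Y>(w)\<close>. The sums \<open>T1\<close>, \<open>\<dots>\<close>, \<open>T4\<close> are the four residues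
  that this leaves, and \<open>U1\<close>, \<open>\<dots>\<close>, \<open>U4\<close> the same residues before collecting equal terms, which is a
  Vandermonde convolution each time.
\<close>

context
  fixes A3 B3 :: "int \<Rightarrow> 'c \<Rightarrow> 'c" and A2 B2 :: "int \<Rightarrow> 'b \<Rightarrow> 'b"
    and A1 B1 :: "int \<Rightarrow> 'a \<Rightarrow> 'a" and l m n :: int and w :: 'a and u :: 'b
  assumes A: "jacobi A3 A2 A1" and B: "jacobi B3 B2 B1"
begin

lemmas fA = jacobi_fields[OF A] and fB = jacobi_fields[OF B]
lemmas zeros = int_field_0[OF fA(1)] int_field_0[OF fA(2)] int_field_0[OF fA(3)]
  int_field_0[OF fB(1)] int_field_0[OF fB(2)] int_field_0[OF fB(3)]

text \<open>\<open>Q1\<close> and \<open>Q2\<close> are the terms with both operators to the right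
  of the intertwiner. They make up all of \<open>mid_sum\<close> and reappear in
  \<open>left_sum\<close>, so they cancel in the difference.\<close>

private definition "Q1 = Sum_any (\<lambda>(j, i).
  S3 ((-1) powi l * schoose l i) (y w (n + l - int i) (A2 (- int j - 1) (B2 (m + int j + int i) u))))"
private definition "Q2 = Sum_any (\<lambda>(j, i).
  S3 ((-1) powi l * schoose l i) (y w (n + l - int i) (B2 (m - int j - 1 + int i) (A2 (int j) u))))"
text \<open>The vectors of the four residues, by where the operators end up. In \<open>GG\<close>
  and \<open>GH\<close>, \<open>B\<close> acts on the argument \<open>w\<close>, with
  \<open>A\<close> on the left and on the right respectively; in \<open>G3\<close> and
  \<open>G4\<close>, \<open>A\<close> acts on \<open>w\<close>, with \<open>B\<close> on the right
  and on the left respectively.\<close>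

private definition "GG = (\<lambda>(J, I). A3 (- int J - 1) (y (B1 (l + int I) w) (m + int J + n - int I) u))"
private definition "GH = (\<lambda>(r, I). y (B1 (l + int I) w) (m - int r - 1 + n - int I) (A2 (int r) u))"
private definition "G3 = (\<lambda>(J, R). y (A1 (int J) w) (n + l - 1 - int J - int R) (B2 (m + int R) u))"
private definition "G4 = (\<lambda>(J, R). B3 (m + l - 1 - int J - int R) (y (A1 (int J) w) (n + int R) u))"
private definition "T1 = Sum_any (\<lambda>x. S3 (case x of (J, I) \<Rightarrow> of_int (m + int J) gchoose I) (GG x))"
private definition "T2 = Sum_any (\<lambda>x. S3 (case x of (r, I) \<Rightarrow> of_int (m - int r - 1) gchoose I) (GH x))"
private definition "T3 = Sum_any (\<lambda>x.
  S3 (case x of (J, R) \<Rightarrow> - ((-1) powi (l - int J - 1) * schoose (l - int J - 1) R)) (G3 x))"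
private definition "T4 = Sum_any (\<lambda>x. S3 (case x of (J, R) \<Rightarrow> schoose (l - int J - 1) R) (G4 x))"

private lemma fin_GG: "finite {x. GG x \<noteq> 0}"
proof -
  have "finite {(i, j). GG (i, j) \<noteq> 0}"
    by (rule finite_pairs_snd[where q = l and u = w and p = "\<lambda>j. m + n - int j"
        and v = "\<lambda>j. u" and B = "\<lambda>j. y (B1 (l + int j) w)",
        OF fB(3) _ y_field])
      (simp_all add: GG_def zeros algebra_simps)
  then show ?thesis by (simp add: case_prod_unfold)
qed

private lemma fin_GH: "finite {x. GH x \<noteq> 0}"
proof -
  have "finite {(i, j). GH (i, j) \<noteq> 0}"
    by (rule finite_pairs_fst[where q = 0 and u = u and p = "\<lambda>i. l" and v = "\<lambda>i. w",
        OF fA(2) _ fB(3)])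
      (simp_all add: GH_def zeros)
  then show ?thesis by (simp add: case_prod_unfold)
qed

private lemma fin_G3: "finite {x. G3 x \<noteq> 0}"
proof -
  have "finite {(i, j). G3 (i, j) \<noteq> 0}"
    by (rule finite_pairs_fst[where q = 0 and u = w and p = "\<lambda>i. m" and v = "\<lambda>i. u",
        OF fA(3) _ fB(2)])
      (simp_all add: G3_def zeros)
  then show ?thesis by (simp add: case_prod_unfold)
qed

private lemma fin_G4: "finite {x. G4 x \<noteq> 0}"
proof -
  have "finite {(i, j). G4 (i, j) \<noteq> 0}"
    by (rule finite_pairs_fst[where q = 0 and u = w and p = "\<lambda>i. n"
        and v = "\<lambda>i. u" and B = "\<lambda>i. y (A1 (int i) w)",
        OF fA(3) _ y_field])
      (simp_all add: G4_def zeros)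
  then show ?thesis by (simp add: case_prod_unfold)
qed

private definition "U1 = (\<lambda>(i, j). Sum_any (\<lambda>r. S3 ((of_int m gchoose i) * schoose (- int j - 1) r)
     (A3 (- int j - 1 - int r) (y (B1 (l + int i + int j) w) (m + n - int i + int r) u))))"
private definition "U2 = (\<lambda>(i, j). Sum_any (\<lambda>r. S3 ((of_int m gchoose i) * ((-1) powi (- int j - 1) * schoose (- int j - 1) r))
     (y (B1 (l + int i + int j) w) (m + n - int i + (- int j - 1) - int r) (A2 (int r) u))))"
private definition "U3 = (\<lambda>(j, i). Sum_any (\<lambda>k. S3 ((-1) powi l * schoose l i * (of_int (- int j - 1) gchoose k))
     (y (A1 (int k) w) (- int j - 1 + (n + l - int i) - int k) (B2 (m + int j + int i) u))))"
private definition "U4 = (\<lambda>(i, j). Sum_any (\<lambda>k. S3 (schoose l i * (of_int (int j) gchoose k))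
     (B3 (m + l - int i - int j - 1) (y (A1 (int k) w) (int j + (n + int i) - int k) u))))"

private lemmas lin =
  int_field_linear[OF y_field] y_linear int_field_linear[OF fA(1)] int_field_linear[OF fA(2)]
  int_field_linear[OF fA(3)] int_field_linear[OF fB(1)] int_field_linear[OF fB(2)] int_field_linear[OF fB(3)]

private lemmas push = linear_add[OF lin(1)] linear_add[OF lin(3)] linear_add[OF lin(6)]
  linear_scale[OF lin(1)] linear_scale[OF lin(3)] linear_scale[OF lin(6)]

private lemma sum_T3:
  "Sum_any U3 = T3" "finite {x. U3 x \<noteq> 0}"
proof -
  define c where "c = (\<lambda>((j, i), k). (-1) powi l * schoose l i * (of_int (- int j - 1) gchoose k))"
  define \<pi> where "\<pi> = (\<lambda>((j, i), k::nat). (k, j + i :: nat))"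
  define F :: "nat \<times> nat \<Rightarrow> ((nat \<times> nat) \<times> nat) set"
    where "F = (\<lambda>(J, R). (\<lambda>j. ((j, R - j), J)) ` {..R})"
  have f: "U3 = (\<lambda>p. Sum_any (\<lambda>k. S3 (c (p, k)) (G3 (\<pi> (p, k)))))"
    by (auto simp: U3_def fun_eq_iff c_def \<pi>_def G3_def algebra_simps intro!: Sum_any.cong)
  have 1: "finite (F x)" for x by (auto simp: F_def split: prod.split)
  have 2: "\<forall>t. c t \<noteq> 0 \<longrightarrow> t \<in> F (\<pi> t)" by (force simp: F_def \<pi>_def)
  have 3: "t \<in> F x \<Longrightarrow> \<pi> t = x" for t x by (auto simp: F_def \<pi>_def)
  note fib = Sum_any_fibres_pair[where c = c and \<pi> = \<pi> and F = F, OF V3.vector_space_axioms fin_G3 1 2 3]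
  have "sum c (F (J, R)) = - ((-1) powi (l - int J - 1) * schoose (l - int J - 1) R)" for J R
    unfolding F_def c_def prod.case by (rule sum_fibre_G3)
  then have cx: "sum c (F x) = (case x of (J, R) \<Rightarrow> - ((-1) powi (l - int J - 1) * schoose (l - int J - 1) R))" for x by (cases x) simp
  show "Sum_any U3 = T3"
    using fib(1) unfolding f T3_def by (simp only: cx)
  show "finite {x. U3 x \<noteq> 0}" unfolding f by (rule fib(2))
qed

private lemma sum_T4:
  "Sum_any U4 = T4" "finite {x. U4 x \<noteq> 0}"
proof -
  define c where "c = (\<lambda>((i, j), k). schoose l i * (of_int (int j) gchoose k))"
  define \<pi> where "\<pi> = (\<lambda>((i, j), k::nat). (k, j - k + i :: nat))"
  define F :: "nat \<times> nat \<Rightarrow> ((nat \<times> nat) \<times> nat) set"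
    where "F = (\<lambda>(J, R). (\<lambda>d. ((R - d, J + d), J)) ` {..R})"
  \<comment> \<open>The difference \<open>j - k\<close> in the index map is cut off at 0; this is
    harmless because \<open>j choose k\<close> vanishes for \<open>k > j\<close>.\<close>
  have c0: "c t \<noteq> 0 \<Longrightarrow> snd t \<le> snd (fst t)" for t
    by (cases t) (auto simp: c_def binomial_gbinomial[symmetric] not_less[symmetric])
  have "S3 (schoose l i * (of_int (int j) gchoose k))
     (B3 (m + l - int i - int j - 1) (y (A1 (int k) w) (int j + (n + int i) - int k) u)) =
     S3 (c ((i, j), k)) (G4 (\<pi> ((i, j), k)))" for i j k
  proof (cases "k \<le> j")
    case True
    then show ?thesis by (simp add: c_def \<pi>_def G4_def of_nat_diff algebra_simps)
  next
    case False
    then show ?thesis using c0[of "((i, j), k)"] by (auto simp: c_def)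
  qed
  then have f: "U4 = (\<lambda>p. Sum_any (\<lambda>k. S3 (c (p, k)) (G4 (\<pi> (p, k)))))"
    by (auto simp: U4_def fun_eq_iff)
  have 1: "finite (F x)" for x by (auto simp: F_def split: prod.split)
  have "c t \<noteq> 0 \<longrightarrow> t \<in> F (\<pi> t)" for t
    using c0[of t] by (cases t) (auto simp: F_def \<pi>_def intro!: image_eqI[of _ _ "snd (fst t) - snd t"])
  then have 2: "\<forall>t. c t \<noteq> 0 \<longrightarrow> t \<in> F (\<pi> t)" ..
  have 3: "t \<in> F x \<Longrightarrow> \<pi> t = x" for t x by (auto simp: F_def \<pi>_def)
  note fib = Sum_any_fibres_pair[where c = c and \<pi> = \<pi> and F = F, OF V3.vector_space_axioms fin_G4 1 2 3]
  have "sum c (F (J, R)) = schoose (l - int J - 1) R" for J R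
    unfolding F_def c_def prod.case by (rule sum_fibre_G4)
  then have cx: "sum c (F x) = (case x of (J, R) \<Rightarrow> schoose (l - int J - 1) R)" for x by (cases x) simp
  show "Sum_any U4 = T4"
    using fib(1) unfolding f T4_def by (simp only: cx)
  show "finite {x. U4 x \<noteq> 0}" unfolding f by (rule fib(2))
qed

private lemma sum_T1:
  "Sum_any U1 = T1" "finite {x. U1 x \<noteq> 0}"
proof -
  define c :: "(nat \<times> nat) \<times> nat \<Rightarrow> complex" where "c = (\<lambda>((i, j), r). (of_int m gchoose i) * schoose (- int j - 1) r)"
  define \<pi> where "\<pi> = (\<lambda>((i, j), r). (j + r :: nat, i + j :: nat))"
  define F :: "nat \<times> nat \<Rightarrow> ((nat \<times> nat) \<times> nat) set"
    where "F = (\<lambda>(J, I). (\<lambda>j. ((I - j, j), J - j)) ` {..min I J})"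
  have f: "U1 = (\<lambda>p. Sum_any (\<lambda>k. S3 (c (p, k)) (GG (\<pi> (p, k)))))"
    by (auto simp: U1_def fun_eq_iff c_def \<pi>_def GG_def algebra_simps intro!: Sum_any.cong)
  have 1: "finite (F x)" for x by (auto simp: F_def split: prod.split)
  have 2: "\<forall>t. c t \<noteq> 0 \<longrightarrow> t \<in> F (\<pi> t)" by (force simp: F_def \<pi>_def)
  have 3: "t \<in> F x \<Longrightarrow> \<pi> t = x" for t x by (auto simp: F_def \<pi>_def)
  note fib = Sum_any_fibres_pair[where c = c and \<pi> = \<pi> and F = F, OF V3.vector_space_axioms fin_GG 1 2 3]
  have "sum c (F (J, I)) = of_int (m + int J) gchoose I" for J I
    unfolding F_def c_def prod.case by (rule sum_fibre_GG)
  then have cx: "sum c (F x) = (case x of (J, I) \<Rightarrow> of_int (m + int J) gchoose I)" for x by (cases x) simp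
  show "Sum_any U1 = T1"
    using fib(1) unfolding f T1_def by (simp only: cx)
  show "finite {x. U1 x \<noteq> 0}" unfolding f by (rule fib(2))
qed

private lemma sum_T2:
  "Sum_any U2 = - T2" "finite {x. U2 x \<noteq> 0}"
proof -
  define c where "c = (\<lambda>((i, j), r). (of_int m gchoose i) * ((-1) powi (- int j - 1) * schoose (- int j - 1) r))"
  define \<pi> where "\<pi> = (\<lambda>((i, j), r::nat). (r, i + j :: nat))"
  define F :: "nat \<times> nat \<Rightarrow> ((nat \<times> nat) \<times> nat) set"
    where "F = (\<lambda>(r, I). (\<lambda>j. ((I - j, j), r)) ` {..I})"
  have f: "U2 = (\<lambda>p. Sum_any (\<lambda>k. S3 (c (p, k)) (GH (\<pi> (p, k)))))"
    by (auto simp: U2_def fun_eq_iff c_def \<pi>_def GH_def algebra_simps intro!: Sum_any.cong)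
  have 1: "finite (F x)" for x by (auto simp: F_def split: prod.split)
  have 2: "\<forall>t. c t \<noteq> 0 \<longrightarrow> t \<in> F (\<pi> t)" by (force simp: F_def \<pi>_def)
  have 3: "t \<in> F x \<Longrightarrow> \<pi> t = x" for t x by (auto simp: F_def \<pi>_def)
  note fib = Sum_any_fibres_pair[where c = c and \<pi> = \<pi> and F = F, OF V3.vector_space_axioms fin_GH 1 2 3]
  have "sum c (F (r, I)) = - (of_int (m - int r - 1) gchoose I)" for r I
    unfolding F_def c_def prod.case by (rule sum_fibre_GH)
  then have cx: "S3 (sum c (F x)) z = - S3 (case x of (r, I) \<Rightarrow> of_int (m - int r - 1) gchoose I) z" for x z
    by (cases x) simp
  have "Sum_any U2 = Sum_any (\<lambda>x. - S3 (case x of (r, I) \<Rightarrow> of_int (m - int r - 1) gchoose I) (GH x))"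
    using fib(1) unfolding f by (simp only: cx)
  also have "\<dots> = - T2"
    unfolding T2_def by (rule Sum_any_additive[symmetric]) (auto intro!: fin_scaled fin_GH simp del: of_int_diff)
  finally show "Sum_any U2 = - T2" .
  show "finite {x. U2 x \<noteq> 0}" unfolding f by (rule fib(2))
qed

lemma normal_product_lhs1:
  "left_sum (normal_product A3 B3) l m n w u =
    (T1 + T2) + (T3 + T4) + (Q1 + Q2)"
proof -
  define P1 where "P1 = (\<lambda>i j. A3 (- int j - 1) (B3 (m + l - int i + int j) (y w (n + int i) u)))"
  define P2 where "P2 = (\<lambda>i j. B3 (m + l - int i - int j - 1) (A3 (int j) (y w (n + int i) u)))"
  have finP1: "finite {(i, j). P1 i j \<noteq> 0}"
    by (rule finite_pairs_fst[where q = n and u = u and p = "\<lambda>i. m + l - int i"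
        and v = "\<lambda>i. y w (n + int i) u",
        OF y_field[of w] _ fB(1)])
      (simp_all add: P1_def zeros)
  have finP2: "finite {(i, j). P2 i j \<noteq> 0}"
    by (rule finite_pairs_fst[where q = n and u = u and p = "\<lambda>i. 0"
        and v = "\<lambda>i. y w (n + int i) u",
        OF y_field[of w] _ fA(1)])
      (simp_all add: P2_def zeros)
  have "left_sum (normal_product A3 B3) l m n w u =
      Sum_any (\<lambda>i. S3 (schoose l i) (Sum_any (P1 i) + Sum_any (P2 i)))"
    unfolding left_sum_def normal_product_nat P1_def P2_def ..
  also have "\<dots> = Sum_any (\<lambda>(i, j). S3 (schoose l i) (P1 i j)) + Sum_any (\<lambda>(i, j). S3 (schoose l i) (P2 i j))"
    by (rule Sum_any_linear_nested[OF V3.linear_scale_self finP1 finP2])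
  also have "Sum_any (\<lambda>(i, j). S3 (schoose l i) (P1 i j)) = T1 + T3 + Q1"
  proof -
    define f where "f = (\<lambda>j i. S3 ((-1) powi l * schoose l i) (y w (n + l - int i) (B2 (m + int j + int i) u)))"
    define g where "g = (\<lambda>j i. S3 (of_int (m + int j) gchoose i) (y (B1 (l + int i) w) (m + int j + n - int i) u))"
    have finf: "finite {(j, i). f j i \<noteq> 0}"
      by (rule finite_pairs_add[OF fB(2), of m u])
        (simp add: f_def zeros)
    have fing: "finite {(j, i). g j i \<noteq> 0}"
      by (rule finite_pairs_snd[where q = l and u = w and p = "\<lambda>i. m + n - int i"
          and v = "\<lambda>i. u" and B = "\<lambda>i. y (B1 (l + int i) w)",
          OF fB(3) _ y_field])
        (simp_all add: g_def zeros algebra_simps)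
    have finP: "finite {(j, i). S3 (schoose l i) (P1 i j) \<noteq> 0}"
    proof -
      have "{(j, i). S3 (schoose l i) (P1 i j) \<noteq> 0} \<subseteq> prod.swap ` {(i, j). P1 i j \<noteq> 0}" by force
      then show ?thesis using finP1 by (meson finite_imageI finite_subset)
    qed
    have "Sum_any (\<lambda>(i, j). S3 (schoose l i) (P1 i j)) = Sum_any (\<lambda>(j, i). S3 (schoose l i) (P1 i j))"
      by (rule Sum_any_pair_swap)
    also have "\<dots> = Sum_any (\<lambda>j. Sum_any (\<lambda>i. S3 (schoose l i) (P1 i j)))"
      by (rule Sum_any_nested[OF finP, symmetric])
    \<comment> \<open>For fixed \<open>j\<close> the sum over \<open>i\<close> is a left term for
      \<open>B\<close> with \<open>m\<close> replaced by \<open>m + j\<close>, so the Jacobi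
      identity for \<open>B\<close> can be used at the full value of \<open>l\<close>.\<close>
    also have "\<dots> = Sum_any (\<lambda>j. A3 (- int j - 1) (left_sum B3 l (m + int j) n w u))"
    proof (rule Sum_any.cong)
      fix j
      have "m + int j + l - int i = m + l - int i + int j" for i by simp
      then show "Sum_any (\<lambda>i. S3 (schoose l i) (P1 i j)) = A3 (- int j - 1) (left_sum B3 l (m + int j) n w u)"
        unfolding left_sum_def P1_def Sum_any_linear[OF fin_scaled[OF fin1[OF fB(1)]] lin(3)]
        by (simp only: push)
    qed
    also have "\<dots> = Sum_any (\<lambda>j. A3 (- int j - 1) (Sum_any (f j) + Sum_any (g j)))"
      by (simp only: jacobiD[OF B] mid_sum_def right_sum_def f_def g_def)
    also have "\<dots> = Sum_any (\<lambda>(j, i). A3 (- int j - 1) (f j i)) + Sum_any (\<lambda>(j, i). A3 (- int j - 1) (g j i))"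
      by (rule Sum_any_linear_nested[OF lin(3) finf fing])
    also have "Sum_any (\<lambda>(j, i). A3 (- int j - 1) (g j i)) = T1"
      unfolding T1_def by (intro Sum_any.cong) (simp add: g_def GG_def push split: prod.split)
    also have "Sum_any (\<lambda>(j, i). A3 (- int j - 1) (f j i)) = Q1 + T3"
    proof -
      let ?q = "\<lambda>(j, i). S3 ((-1) powi l * schoose l i)
        (y w (n + l - int i) (A2 (- int j - 1) (B2 (m + int j + int i) u)))"
      have "A3 (- int j - 1) (f j i) = ?q (j, i) + U3 (j, i)" for j i
      proof -
        have "finite {k. S3 (of_int (- int j - 1) gchoose k)
            (y (A1 (int k) w) (- int j - 1 + (n + l - int i) - int k) (B2 (m + int j + int i) u)) \<noteq> 0}"
          using fin_scaled[OF fin3[OF fA(3), of 0]] by simp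
        from sum_scale[OF this] show ?thesis
          unfolding f_def push jacobi_comm[OF A] V3.scale_right_distrib by (simp add: U3_def del: of_int_diff of_int_minus)
      qed
      then have "Sum_any (\<lambda>(j, i). A3 (- int j - 1) (f j i)) = Sum_any (\<lambda>x. ?q x + U3 x)"
        by (intro Sum_any.cong) auto
      also have "\<dots> = Sum_any ?q + Sum_any U3"
      proof (rule Sum_any.distrib)
        show "finite {x. U3 x \<noteq> 0}" by (rule sum_T3(2))
        have "finite {(j, i). y w (n + l - int i) (A2 (- int j - 1) (B2 (m + int j + int i) u)) \<noteq> 0}"
            by (rule finite_pairs_add[OF fB(2), of m u])
              (simp add: zeros)
        then show "finite {x. ?q x \<noteq> 0}"
          by (rule rev_finite_subset) auto
      qed
      finally show ?thesis unfolding sum_T3(1) by (simp add: Q1_def)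
    qed
    finally show ?thesis by simp
  qed
  also have "Sum_any (\<lambda>(i, j). S3 (schoose l i) (P2 i j)) = T2 + T4 + Q2"
  proof -
    define f where "f = (\<lambda>j i. S3 ((-1) powi l * schoose l i) (y w (n + l - int i) (B2 (m - int j - 1 + int i) (A2 (int j) u))))"
    define g where "g = (\<lambda>j i. S3 (of_int (m - int j - 1) gchoose i)
      (y (B1 (l + int i) w) (m - int j - 1 + n - int i) (A2 (int j) u)))"
    define q where "q = (\<lambda>j i. S3 (schoose l i) (B3 (m + l - int i - int j - 1) (y w (n + int i) (A2 (int j) u))))"
    have finf: "finite {(j, i). f j i \<noteq> 0}"
      by (rule finite_pairs_fst[where q = 0 and u = u and p = "\<lambda>j. m - int j - 1"
          and v = "\<lambda>j. A2 (int j) u",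
          OF fA(2) _ fB(2)])
        (simp_all add: f_def zeros)
    have fing: "finite {(j, i). g j i \<noteq> 0}"
      by (rule finite_pairs_fst[where q = 0 and u = u and p = "\<lambda>j. l" and v = "\<lambda>j. w",
          OF fA(2) _ fB(3)])
        (simp_all add: g_def zeros)
    have finq: "finite {(j, i). q j i \<noteq> 0}"
      by (rule finite_pairs_fst[where q = 0 and u = u and p = "\<lambda>j. n"
          and v = "\<lambda>j. A2 (int j) u" and B = "\<lambda>j. y (w)",
          OF fA(2) _ y_field])
        (simp_all add: q_def zeros)
    have "S3 (schoose l i) (P2 i j) = q j i + U4 (i, j)" for i j
    proof -
      have fin: "finite {k. S3 (of_int (int j) gchoose k)
          (y (A1 (int k) w) (int j + (n + int i) - int k) u) \<noteq> 0}"
        using fin_scaled[OF fin3[OF fA(3), of 0]] by simp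
      have "finite {k. S3 (of_int (int j) gchoose k)
          (B3 (m + l - int i - int j - 1) (y (A1 (int k) w) (int j + (n + int i) - int k) u)) \<noteq> 0}"
        by (rule finite_nonzero_mono[OF fin]) (auto simp: zeros)
      from sum_scale[OF this] show ?thesis
        unfolding P2_def q_def jacobi_comm[OF A] push Sum_any_linear[OF fin lin(6)] V3.scale_right_distrib
        by (simp add: U4_def del: of_int_of_nat_eq)
    qed
    then have "Sum_any (\<lambda>(i, j). S3 (schoose l i) (P2 i j)) = Sum_any (\<lambda>x. (\<lambda>(i, j). q j i) x + U4 x)"
      by (intro Sum_any.cong) auto
    also have "\<dots> = Sum_any (\<lambda>(i, j). q j i) + Sum_any U4"
    proof (rule Sum_any.distrib)
      show "finite {x. U4 x \<noteq> 0}" by (rule sum_T4(2))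
      have "{x. (case x of (i, j) \<Rightarrow> q j i) \<noteq> 0} \<subseteq> prod.swap ` {(j, i). q j i \<noteq> 0}" by force
      then show "finite {x. (case x of (i, j) \<Rightarrow> q j i) \<noteq> 0}" using finq by (meson finite_imageI finite_subset)
    qed
    also have "Sum_any U4 = T4" by (rule sum_T4(1))
    also have "Sum_any (\<lambda>(i, j). q j i) = Sum_any (\<lambda>(j, i). q j i)"
      by (rule Sum_any_pair_swap)
    also have "\<dots> = Sum_any (\<lambda>j. Sum_any (\<lambda>i. q j i))"
      by (rule Sum_any_nested[OF finq, symmetric])
    also have "\<dots> = Sum_any (\<lambda>j. left_sum B3 l (m - int j - 1) n w (A2 (int j) u))"
    proof (rule Sum_any.cong)
      fix j
      have "m - int j - 1 + l - int i = m + l - int i - int j - 1" for i by simp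
      then show "Sum_any (q j) = left_sum B3 l (m - int j - 1) n w (A2 (int j) u)"
        unfolding left_sum_def q_def by (simp only:)
    qed
    also have "\<dots> = Sum_any (\<lambda>j. S3 1 (Sum_any (f j) + Sum_any (g j)))"
      by (simp only: jacobiD[OF B] mid_sum_def right_sum_def f_def g_def V3.scale_one)
    also have "\<dots> = Sum_any (\<lambda>(j, i). S3 1 (f j i)) + Sum_any (\<lambda>(j, i). S3 1 (g j i))"
      by (rule Sum_any_linear_nested[OF V3.linear_scale_self finf fing])
    also have "\<dots> = Q2 + T2"
      by (simp add: Q2_def T2_def f_def g_def GH_def case_prod_unfold del: of_int_diff)
    finally show ?thesis by simp
  qed
  finally show ?thesis by simp
qed

lemma normal_product_lhs2: "mid_sum (normal_product A2 B2) l m n w u = Q1 + Q2"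
proof -
  define f where "f = (\<lambda>i j. A2 (- int j - 1) (B2 (m + int i + int j) u))"
  define g where "g = (\<lambda>i j. B2 (m + int i - int j - 1) (A2 (int j) u))"
  have finf: "finite {(i, j). f i j \<noteq> 0}"
    by (rule finite_pairs_add[OF fB(2), of m u])
      (simp add: f_def zeros)
  have fing: "finite {(i, j). g i j \<noteq> 0}"
    by (rule finite_pairs_snd[where q = 0 and u = u and p = "\<lambda>j. m - int j - 1"
        and v = "\<lambda>j. A2 (int j) u",
        OF fA(2) _ fB(2)])
      (simp_all add: g_def zeros algebra_simps)
  have "mid_sum (normal_product A2 B2) l m n w u = Sum_any (\<lambda>i.
      S3 ((-1) powi l * schoose l i) (y w (n + l - int i) (Sum_any (f i) + Sum_any (g i))))"
    unfolding mid_sum_def normal_product_nat f_def g_def ..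
  also have "\<dots> = Sum_any (\<lambda>(i, j). S3 ((-1) powi l * schoose l i) (y w (n + l - int i) (f i j))) +
      Sum_any (\<lambda>(i, j). S3 ((-1) powi l * schoose l i) (y w (n + l - int i) (g i j)))"
    by (rule Sum_any_linear_nested[OF linear_scaled[OF lin(1)] finf fing])
  also have "Sum_any (\<lambda>(i, j). S3 ((-1) powi l * schoose l i) (y w (n + l - int i) (f i j))) = Q1"
    by (subst Sum_any_pair_swap) (simp add: Q1_def f_def algebra_simps)
  also have "Sum_any (\<lambda>(i, j). S3 ((-1) powi l * schoose l i) (y w (n + l - int i) (g i j))) = Q2"
    by (subst Sum_any_pair_swap) (simp add: Q2_def g_def algebra_simps)
  finally show ?thesis .
qed

text \<open>No operator has to be moved here. In \<open>A B w\<close> the outer negative mode of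
  \<open>A\<close> is opened by the associativity formula; in \<open>B A w\<close> the Jacobi
  identity for \<open>B\<close> is used with the vector \<open>A w\<close> in place of
  \<open>w\<close>.\<close>

lemma normal_product_rhs: "right_sum (normal_product A1 B1) l m n w u =
    (T1 + T2) + (T3 + T4)"
proof -
  define f where "f = (\<lambda>i j. A1 (- int j - 1) (B1 (l + int i + int j) w))"
  define g where "g = (\<lambda>i j. B1 (l + int i - int j - 1) (A1 (int j) w))"
  have finf: "finite {(i, j). f i j \<noteq> 0}"
    by (rule finite_pairs_add[OF fB(3), of l w])
      (simp add: f_def zeros)
  have fing: "finite {(i, j). g i j \<noteq> 0}"
    by (rule finite_pairs_snd[where q = 0 and u = w and p = "\<lambda>j. l - int j - 1"
        and v = "\<lambda>j. A1 (int j) w",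
        OF fA(3) _ fB(3)])
      (simp_all add: g_def zeros algebra_simps)
  have "right_sum (normal_product A1 B1) l m n w u = Sum_any (\<lambda>i.
      S3 (of_int m gchoose i) (y (Sum_any (f i) + Sum_any (g i)) (m + n - int i) u))"
    unfolding right_sum_def normal_product_nat f_def g_def ..
  also have "\<dots> = Sum_any (\<lambda>(i, j). S3 (of_int m gchoose i) (y (f i j) (m + n - int i) u)) +
      Sum_any (\<lambda>(i, j). S3 (of_int m gchoose i) (y (g i j) (m + n - int i) u))"
    by (rule Sum_any_linear_nested[OF linear_scaled[OF lin(2)] finf fing])
  also have "Sum_any (\<lambda>(i, j). S3 (of_int m gchoose i) (y (f i j) (m + n - int i) u)) =
      T1 + T2"
  proof -
    have "S3 (of_int m gchoose i) (y (f i j) (m + n - int i) u) = U1 (i, j) - U2 (i, j)" for i j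
    proof -
      have fin: "finite {r. S3 (schoose (- int j - 1) r)
          (A3 (- int j - 1 - int r) (y (B1 (l + int i + int j) w) (m + n - int i + int r) u)) \<noteq> 0}"
        by (rule fin_scaled[OF fin1[OF fA(1)]])
      have fin': "finite {r. S3 ((-1) powi (- int j - 1) * schoose (- int j - 1) r)
          (y (B1 (l + int i + int j) w) (m + n - int i + (- int j - 1) - int r) (A2 (int r) u)) \<noteq> 0}"
        using fin_scaled[OF fin2[OF fA(2), of _ _ 0]] by simp
      show ?thesis
        unfolding f_def jacobi_assoc[OF A] V3.scale_right_diff_distrib
          sum_scale[OF fin] sum_scale[OF fin']
        by (simp add: U1_def U2_def)
    qed
    then have "Sum_any (\<lambda>(i, j). S3 (of_int m gchoose i) (y (f i j) (m + n - int i) u)) =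
        Sum_any (\<lambda>x. U1 x - U2 x)"
      by (intro Sum_any.cong) auto
    also have "\<dots> = Sum_any U1 - Sum_any U2"
      by (rule Sum_any_subtractf[OF sum_T1(2) sum_T2(2)])
    finally show ?thesis unfolding sum_T1(1) sum_T2(1) by simp
  qed
  also have "Sum_any (\<lambda>(i, j). S3 (of_int m gchoose i) (y (g i j) (m + n - int i) u)) =
      T4 + T3"
  proof -
    define h where "h = (\<lambda>j i. S3 (of_int m gchoose i) (y (g i j) (m + n - int i) u))"
    have finh: "finite {(j, i). h j i \<noteq> 0}"
    proof -
      have "{(j, i). h j i \<noteq> 0} \<subseteq> prod.swap ` {(i, j). g i j \<noteq> 0}" by (force simp: h_def)
      then show ?thesis using fing by (meson finite_imageI finite_subset)
    qed
    let ?p = "\<lambda>j r. S3 (schoose (l - int j - 1) r) (G4 (j, r))"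
    let ?q = "\<lambda>j r. S3 (- ((-1) powi (l - int j - 1) * schoose (l - int j - 1) r)) (G3 (j, r))"
    have finp: "finite {(j, r). ?p j r \<noteq> 0}"
      by (rule finite_subset[OF _ fin_G4]) auto
    have finq: "finite {(j, r). ?q j r \<noteq> 0}"
      by (rule finite_subset[OF _ fin_G3]) auto
    have "Sum_any (\<lambda>(i, j). S3 (of_int m gchoose i) (y (g i j) (m + n - int i) u)) = Sum_any (\<lambda>(j, i). h j i)"
      unfolding h_def by (rule Sum_any_pair_swap)
    also have "\<dots> = Sum_any (\<lambda>j. Sum_any (h j))"
      by (rule Sum_any_nested[OF finh, symmetric])
    also have "\<dots> = Sum_any (\<lambda>j. S3 1 (Sum_any (?p j) + Sum_any (?q j)))"
    proof (rule Sum_any.cong)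
      fix j
      have "l - int j - 1 + int i = l + int i - int j - 1" for i by simp
      then have "Sum_any (h j) = right_sum B1 (l - int j - 1) m n (A1 (int j) w) u"
        unfolding right_sum_def h_def g_def by (simp only:)
      also have "\<dots> = left_sum B3 (l - int j - 1) m n (A1 (int j) w) u - mid_sum B2 (l - int j - 1) m n (A1 (int j) w) u"
        by (simp add: jacobiD[OF B])
      also have "left_sum B3 (l - int j - 1) m n (A1 (int j) w) u = Sum_any (?p j)"
        unfolding left_sum_def by (rule Sum_any.cong) (simp add: G4_def algebra_simps)
      also have "mid_sum B2 (l - int j - 1) m n (A1 (int j) w) u = - Sum_any (?q j)"
        unfolding mid_sum_def by (subst Sum_any_additive[of _ uminus])
          (use finite_slices(2)[OF finq, of j] in \<open>auto simp: G3_def algebra_simps intro!: Sum_any.cong\<close>)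
      finally show "Sum_any (h j) = S3 1 (Sum_any (?p j) + Sum_any (?q j))" by simp
    qed
    also have "\<dots> = Sum_any (\<lambda>(j, i). S3 1 (?p j i)) + Sum_any (\<lambda>(j, i). S3 1 (?q j i))"
      by (rule Sum_any_linear_nested[OF V3.linear_scale_self finp finq])
    also have "\<dots> = T4 + T3"
      by (simp add: T3_def T4_def case_prod_unfold)
    finally show ?thesis .
  qed
  finally show ?thesis by simp
qed

end

lemma jacobi_normal_product:
  assumes "jacobi A3 A2 A1" and "jacobi B3 B2 B1"
  shows "jacobi (normal_product A3 B3) (normal_product A2 B2) (normal_product A1 B1)"
  unfolding jacobi_def
  by (auto intro: int_field_normal_product jacobi_fields[OF assms(1)] jacobi_fields[OF assms(2)]
      simp: normal_product_lhs1[OF assms] normal_product_lhs2[OF assms] normal_product_rhs[OF assms])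

end

section \<open>Fields between two Heisenberg modules\<close>

locale heis_pair =
  fixes s2 :: "complex \<Rightarrow> 'b::ab_group_add \<Rightarrow> 'b" and s3 :: "complex \<Rightarrow> 'c::ab_group_add \<Rightarrow> 'c"
    and h2 :: "int \<Rightarrow> 'b \<Rightarrow> 'b" and h3 :: "int \<Rightarrow> 'c \<Rightarrow> 'c"
  assumes h2_field: "int_field s2 s2 h2" and h3_field: "int_field s3 s3 h3"
    and h2_comm: "h2 m (h2 n u) - h2 n (h2 m u) = s2 (of_int m when m + n = 0) u"
    and h3_comm: "h3 m (h3 n v) - h3 n (h3 m v) = s3 (of_int m when m + n = 0) v"
begin

sublocale V2: vector_space s2 using int_field_linear[OF h2_field] by (rule linear_vs)
sublocale V3: vector_space s3 using int_field_linear[OF h3_field] by (rule linear_vs)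

lemmas sum_scale = Sum_any_scale[OF V3.vector_space_axioms]

lemmas lin2 = int_field_linear[OF h2_field] and lin3 = int_field_linear[OF h3_field]

lemma h_0 [simp]: "h2 n 0 = 0" "h3 n 0 = 0"
  by (rule int_field_0[OF h2_field]) (rule int_field_0[OF h3_field])

text \<open>The index is now the exponent of \<open>x\<close> itself, an arbitrary complex number,
  at one fixed power of \<open>log x\<close>; truncation therefore concerns small real
  parts.\<close>

definition truncated :: "(complex \<Rightarrow> 'b \<Rightarrow> 'c) \<Rightarrow> bool"
  where "truncated Z \<longleftrightarrow> (\<forall>s. Vector_Spaces.linear s2 s3 (Z s)) \<and> (\<forall>u. \<exists>N. \<forall>s. Re s < N \<longrightarrow> Z s u = 0)"

lemma truncated_linear: "truncated Z \<Longrightarrow> Vector_Spaces.linear s2 s3 (Z s)"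
  by (simp add: truncated_def)

lemma truncated_zero_arg: "truncated Z \<Longrightarrow> Z s 0 = 0"
  by (rule linear_0[OF truncated_linear])

lemma truncated_trunc:
  assumes "truncated Z"
  shows "\<exists>N::nat. \<forall>i\<ge>N. \<forall>j. Z (s - of_nat i - of_nat j) u = 0"
proof -
  obtain N where N: "\<forall>s. Re s < N \<longrightarrow> Z s u = 0" using assms unfolding truncated_def by blast
  obtain M :: nat where "Re s - N < real M" using reals_Archimedean2 by blast
  then show ?thesis using N by (intro exI[of _ M]) auto
qed

lemma truncated_trunc':
  assumes "truncated Z"
  shows "\<exists>N::nat. \<forall>i\<ge>N. Z (s - of_nat i) u = 0"
  using truncated_trunc[OF assms, of s u] by (metis diff_zero of_nat_0)

lemma truncated_finite: "truncated Z \<Longrightarrow> finite {i::nat. Z (s - of_nat i) u \<noteq> 0}"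
  unfolding finite_nonzero_iff_eventually by (rule truncated_trunc')

lemma truncatedI:
  assumes "\<And>s u v. Z s (u + v) = Z s u + Z s v" "\<And>s c u. Z s (s2 c u) = s3 c (Z s u)"
    and "\<And>u. \<exists>N. \<forall>s. Re s < N \<longrightarrow> Z s u = 0"
  shows "truncated Z"
  using assms by (auto simp: truncated_def intro!: linearI V2.vector_space_axioms V3.vector_space_axioms)

lemma truncated_shift:
  assumes "truncated Z"
  shows "truncated (\<lambda>s. Z (s + d))"
  unfolding truncated_def
proof (intro conjI allI)
  fix u
  obtain N where N: "\<forall>s. Re s < N \<longrightarrow> Z s u = 0" using assms unfolding truncated_def by blast
  then show "\<exists>N. \<forall>s. Re s < N \<longrightarrow> Z (s + d) u = 0" by (intro exI[of _ "N - Re d"]) auto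
qed (rule truncated_linear[OF assms])

lemma truncated_add:
  assumes "truncated Z" "truncated Z'"
  shows "truncated (\<lambda>s u. Z s u + Z' s u)"
proof (rule truncatedI)
  fix u
  obtain N where N: "\<forall>s. Re s < N \<longrightarrow> Z s u = 0" using assms(1) unfolding truncated_def by blast
  obtain M where M: "\<forall>s. Re s < M \<longrightarrow> Z' s u = 0" using assms(2) unfolding truncated_def by blast
  show "\<exists>N. \<forall>s. Re s < N \<longrightarrow> Z s u + Z' s u = 0" using N M by (intro exI[of _ "min N M"]) auto
qed (auto simp: linear_add[OF truncated_linear[OF assms(1)]] linear_add[OF truncated_linear[OF assms(2)]]
    linear_scale[OF truncated_linear[OF assms(1)]] linear_scale[OF truncated_linear[OF assms(2)]] V3.scale_right_distrib)

lemma truncated_scale: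
  assumes "truncated Z"
  shows "truncated (\<lambda>s u. s3 (c s) (Z s u))"
proof (rule truncatedI)
  fix u
  obtain N where N: "\<forall>s. Re s < N \<longrightarrow> Z s u = 0" using assms(1) unfolding truncated_def by blast
  then show "\<exists>N. \<forall>s. Re s < N \<longrightarrow> s3 (c s) (Z s u) = 0" by auto
qed (auto simp: linear_add[OF truncated_linear[OF assms(1)]] linear_scale[OF truncated_linear[OF assms(1)]]
    V3.scale_right_distrib mult.commute)

lemma truncated_zero: "truncated (\<lambda>s u. 0)"
  by (rule truncatedI) auto

lemma truncated_sum:
  assumes "finite K" "\<And>k. k \<in> K \<Longrightarrow> truncated (Z k)"
  shows "truncated (\<lambda>s u. \<Sum>k\<in>K. Z k s u)"
  using assms by (induction K rule: finite_induct) (simp_all add: truncated_zero truncated_add)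

definition ad :: "int \<Rightarrow> (complex \<Rightarrow> 'b \<Rightarrow> 'c) \<Rightarrow> complex \<Rightarrow> 'b \<Rightarrow> 'c"
  where "ad m Z s u = h3 m (Z s u) - Z s (h2 m u)"

lemma truncated_ad:
  assumes "truncated Z"
  shows "truncated (ad m Z)"
proof (rule truncatedI)
  fix u
  obtain N where N: "\<forall>s. Re s < N \<longrightarrow> Z s u = 0" using assms unfolding truncated_def by blast
  obtain M where M: "\<forall>s. Re s < M \<longrightarrow> Z s (h2 m u) = 0" using assms unfolding truncated_def by blast
  show "\<exists>N. \<forall>s. Re s < N \<longrightarrow> ad m Z s u = 0"
    using N M by (intro exI[of _ "min N M"]) (auto simp: ad_def)
qed (auto simp: ad_def linear_add[OF truncated_linear[OF assms]] linear_scale[OF truncated_linear[OF assms]]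
    linear_add[OF lin2] linear_scale[OF lin2] linear_add[OF lin3] linear_scale[OF lin3] V3.scale_right_diff_distrib)

text \<open>Left multiplication by the series with terms \<open>a i h(-i-1) x^(i+1-p)\<close>.
  Correspondingly \<open>hright\<close> is right multiplication by the series with terms
  \<open>b i h(i) x^(-i-p)\<close>.\<close>

definition hleft :: "(nat \<Rightarrow> complex) \<Rightarrow> int \<Rightarrow> (complex \<Rightarrow> 'b \<Rightarrow> 'c) \<Rightarrow> complex \<Rightarrow> 'b \<Rightarrow> 'c"
  where "hleft a p Z s u =
    Sum_any (\<lambda>i. s3 (a i) (h3 (- int i - 1) (Z (s + of_int p - 1 - of_nat i) u)))"

definition hright :: "(nat \<Rightarrow> complex) \<Rightarrow> int \<Rightarrow> (complex \<Rightarrow> 'b \<Rightarrow> 'c) \<Rightarrow> complex \<Rightarrow> 'b \<Rightarrow> 'c"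
  where "hright b p Z s u = Sum_any (\<lambda>i. s3 (b i) (Z (s + of_int p + of_nat i) (h2 (int i) u)))"

text \<open>
  Covers the normally ordered product with \<open>\<partial>\<^sup>K h / K!\<close> as well as the part of \<open>(\<integral>\<^sup>-h) Z + Z (\<integral>\<^sup>+h)\<close> that is
  free of \<open>log x\<close>.
\<close>

definition hop where "hop a b p Z s u = hleft a p Z s u + hright b p Z s u"

lemma fin_h3: "finite {i::nat. F i \<noteq> 0} \<Longrightarrow> finite {i. s3 (a i) (h3 (q i) (F i)) \<noteq> 0}"
  by (rule finite_nonzero_mono) auto

lemma finite_left: "truncated Z \<Longrightarrow> finite {i. s3 (a i) (h3 (q i) (Z (s - of_nat i) u)) \<noteq> 0}"
  by (rule fin_h3[OF truncated_finite])

lemma h2_finite: "finite {i::nat. h2 (int i) u \<noteq> 0}"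
  using int_field_finite[OF h2_field, of 0 u] by simp

lemma finite_right: "truncated Z \<Longrightarrow> finite {i::nat. s3 (b i) (Z (q i) (h2 (int i) u)) \<noteq> 0}"
  by (rule finite_nonzero_mono[OF h2_finite[of u]]) (auto simp: truncated_zero_arg)

lemma hleft_add:
  assumes "truncated Z" "truncated Z'"
  shows "hleft a p (\<lambda>s u. Z s u + Z' s u) s u = hleft a p Z s u + hleft a p Z' s u"
  unfolding hleft_def linear_add[OF lin3] V3.scale_right_distrib
  by (rule Sum_any.distrib[OF finite_left[OF assms(1)] finite_left[OF assms(2)]])

lemma hright_add:
  assumes "truncated Z" "truncated Z'"
  shows "hright b p (\<lambda>s u. Z s u + Z' s u) s u = hright b p Z s u + hright b p Z' s u"
  unfolding hright_def V3.scale_right_distrib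
  by (rule Sum_any.distrib[OF finite_right[OF assms(1)] finite_right[OF assms(2)]])

lemma hop_add:
  assumes "truncated Z" "truncated Z'"
  shows "hop a b p (\<lambda>s u. Z s u + Z' s u) s u = hop a b p Z s u + hop a b p Z' s u"
  by (simp add: hop_def hleft_add[OF assms] hright_add[OF assms])

lemma hop_scale:
  assumes "truncated Z"
  shows "hop a b p (\<lambda>s u. s3 c (Z s u)) s u = s3 c (hop a b p Z s u)"
  unfolding hop_def hleft_def hright_def linear_scale[OF lin3] V3.scale_right_distrib
    sum_scale[OF finite_left[OF assms]]
    sum_scale[OF finite_right[OF assms]] V3.scale_scale
  by (simp only: mult.commute)

lemma hop_zero: "hop a b p (\<lambda>s u. 0) s u = 0"
  by (simp add: hop_def hleft_def hright_def)

lemma hop_sum: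
  assumes "finite K" "\<And>k. k \<in> K \<Longrightarrow> truncated (Z k)"
  shows "hop a b p (\<lambda>s u. \<Sum>k\<in>K. Z k s u) s u = (\<Sum>k\<in>K. hop a b p (Z k) s u)"
  using assms
proof (induction K rule: finite_induct)
  case (insert k K)
  then show ?case using hop_add[of "Z k" "\<lambda>s u. \<Sum>k\<in>K. Z k s u"] by (simp add: truncated_sum)
qed (simp add: hop_zero)

lemma hop_shift: "hop a b p (\<lambda>s. Z (s + d)) s u = hop a b p Z (s + d) u"
  by (simp add: hop_def hleft_def hright_def algebra_simps)

lemma hop_coeff: "hop (\<lambda>i. c * a i) (\<lambda>i. c * b i) p Z s u = s3 c (hop a b p Z s u)" if "truncated Z"
  unfolding hop_def hleft_def hright_def V3.scale_right_distrib
    sum_scale[OF finite_left[OF that]]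
    sum_scale[OF finite_right[OF that]] V3.scale_scale ..

lemma truncated_hleft:
  assumes "truncated Z"
  shows "truncated (hleft a p Z)"
proof (rule truncatedI)
  note fin = finite_left[OF assms]
  show "hleft a p Z s (u + v) = hleft a p Z s u + hleft a p Z s v" for s u v
    unfolding hleft_def linear_add[OF truncated_linear[OF assms]] linear_add[OF lin3] V3.scale_right_distrib
    by (rule Sum_any.distrib[OF fin fin])
  show "hleft a p Z s (s2 c u) = s3 c (hleft a p Z s u)" for s c u
    unfolding hleft_def linear_scale[OF truncated_linear[OF assms]] linear_scale[OF lin3]
      sum_scale[OF fin] V3.scale_scale by (simp only: mult.commute)
  fix u
  obtain N where N: "\<forall>s. Re s < N \<longrightarrow> Z s u = 0" using assms unfolding truncated_def by blast
  then have "hleft a p Z s u = 0" if "Re s < N - p" for s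
    using that by (simp add: hleft_def)
  then show "\<exists>N. \<forall>s. Re s < N \<longrightarrow> hleft a p Z s u = 0" by blast
qed

lemma truncated_hright:
  assumes "truncated Z"
  shows "truncated (hright b p Z)"
proof (rule truncatedI)
  note fin = finite_right[OF assms]
  show "hright b p Z s (u + v) = hright b p Z s u + hright b p Z s v" for s u v
    unfolding hright_def linear_add[OF lin2] linear_add[OF truncated_linear[OF assms]] V3.scale_right_distrib
    by (rule Sum_any.distrib[OF fin fin])
  show "hright b p Z s (s2 c u) = s3 c (hright b p Z s u)" for s c u
    unfolding hright_def linear_scale[OF truncated_linear[OF assms]] linear_scale[OF lin2]
      sum_scale[OF fin] V3.scale_scale by (simp only: mult.commute)
  fix u
  have "\<forall>i::nat. \<exists>N. \<forall>s. Re s < N \<longrightarrow> Z s (h2 (int i) u) = 0" using assms unfolding truncated_def by blast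
  from choice[OF this] obtain N where N: "\<forall>i::nat. \<forall>s. Re s < N i \<longrightarrow> Z s (h2 (int i) u) = 0" ..
  obtain K :: nat where K: "\<forall>i\<ge>K. h2 (int i) u = 0"
    using int_field_trunc[OF h2_field, of 0 u] by auto
  define M where "M = Min (insert 0 ((\<lambda>i. N i - real_of_int p - real i) ` {..<K}))"
  have M: "i < K \<Longrightarrow> M \<le> N i - real_of_int p - real i" for i by (auto simp: M_def)
  have "hright b p Z s u = 0" if s: "Re s < M" for s
  proof -
    have "Z (s + of_int p + of_nat i) (h2 (int i) u) = 0" for i
    proof (cases "i < K")
      case True
      then have "Re (s + of_int p + of_nat i) < N i" using M[OF True] s by simp
      then show ?thesis using N by blast
    qed (use K in \<open>simp add: truncated_zero_arg[OF assms]\<close>)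
    then show ?thesis by (simp add: hright_def)
  qed
  then show "\<exists>N. \<forall>s. Re s < N \<longrightarrow> hright b p Z s u = 0" by blast
qed

lemma truncated_hop:
  assumes "truncated Z"
  shows "truncated (hop a b p Z)"
  unfolding hop_def[abs_def] by (rule truncated_add[OF truncated_hleft[OF assms] truncated_hright[OF assms]])

section \<open>Commutativity of the multiplications by creation and annihilation series\<close>

lemma hleft_hleft:
  assumes "truncated Z"
  shows "hleft a p (hleft a' p' Z) s u = hleft a' p' (hleft a p Z) s u"
proof -
  let ?z = "\<lambda>i j. Z (s + of_int p + of_int p' - 2 - of_nat i - of_nat j) u"
  define f where "f = (\<lambda>i j. s3 (a i * a' j) (h3 (- int i - 1) (h3 (- int j - 1) (?z i j))))"
  have exp: "hleft a p (hleft a' p' Z) s u =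
      Sum_any (\<lambda>i. Sum_any (\<lambda>j. s3 (a i * a' j) (h3 (- int i - 1) (h3 (- int j - 1)
        (Z (s + of_int p + of_int p' - 2 - of_nat i - of_nat j) u)))))" for a p a' p'
  proof -
    have 1: "Sum_any (\<lambda>j. s3 (a i) (h3 (- int i - 1) (s3 (a' j) (h3 (- int j - 1)
        (Z (t - of_nat j) u))))) =
      s3 (a i) (h3 (- int i - 1) (Sum_any (\<lambda>j. s3 (a' j) (h3 (- int j - 1) (Z (t - of_nat j) u)))))" for i t
      unfolding Sum_any_linear[OF finite_left[OF assms] lin3] linear_scale[OF lin3]
      by (rule sum_scale[ symmetric],
          rule finite_nonzero_mono[OF finite_left[OF assms, of a' "\<lambda>j. - int j - 1" t u]])
        (simp only: flip: linear_scale[OF lin3], simp)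
    have 2: "s + of_int p - 1 - of_nat i + of_int p' - 1 - of_nat j =
        s + of_int p + of_int p' - 2 - of_nat i - of_nat j" for i j by simp
    show ?thesis unfolding hleft_def
      by (simp only: 1[symmetric] 2 linear_scale[OF lin3] V3.scale_scale)
  qed
  have fin: "finite {(i, j). f i j \<noteq> 0}"
  proof (rule finite_pairs_by_fst)
    show "\<exists>N. \<forall>i\<ge>N. \<forall>j. f i j = 0"
      using truncated_trunc[OF assms, of "s + of_int p + of_int p' - 2" u] by (simp add: f_def) (metis h_0(2))
    show "\<exists>N. \<forall>j\<ge>N. f i j = 0" for i
      using truncated_trunc'[OF assms, of "s + of_int p + of_int p' - 2 - of_nat i" u] by (simp add: f_def) (metis h_0(2))
  qed
  have "h3 (- int i - 1) (h3 (- int j - 1) v) = h3 (- int j - 1) (h3 (- int i - 1) v)" for i j v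
    using h3_comm[of "- int i - 1" "- int j - 1" v] by simp
  then have "f i j = s3 (a' j * a i) (h3 (- int j - 1) (h3 (- int i - 1)
      (Z (s + of_int p' + of_int p - 2 - of_nat j - of_nat i) u)))" for i j
    by (simp add: f_def algebra_simps)
  then have "Sum_any (\<lambda>j. Sum_any (\<lambda>i. f i j)) = hleft a' p' (hleft a p Z) s u"
    by (simp only: exp)
  moreover have "hleft a p (hleft a' p' Z) s u = Sum_any (\<lambda>i. Sum_any (\<lambda>j. f i j))"
    by (simp only: exp f_def)
  ultimately show ?thesis using Sum_any_swap[OF fin] by simp
qed

lemma hleft_hright:
  assumes "truncated Z"
  shows "hleft a p (hright b p' Z) s u = hright b p' (hleft a p Z) s u"
proof -
  define f where "f = (\<lambda>i j. s3 (a i * b j) (h3 (- int i - 1)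
    (Z (s + of_int p + of_int p' - 1 + of_nat j - of_nat i) (h2 (int j) u))))"
  have fin: "finite {(i, j). f i j \<noteq> 0}"
  proof (rule finite_pairs_by_snd)
    show "\<exists>N. \<forall>j\<ge>N. \<forall>i. f i j = 0"
      by (rule int_field_trunc_mono[OF h2_field, of 0 u]) (simp add: f_def truncated_zero_arg[OF assms])
    show "\<exists>N. \<forall>i\<ge>N. f i j = 0" for j
      using truncated_trunc'[OF assms, of "s + of_int p + of_int p' - 1 + of_nat j" "h2 (int j) u"] by (simp add: f_def) (metis h_0(2))
  qed
  have "hleft a p (hright b p' Z) s u = Sum_any (\<lambda>i. Sum_any (\<lambda>j. f i j))"
  proof -
    have 1: "Sum_any (\<lambda>j. s3 (a i) (h3 (- int i - 1) (s3 (b j) (Z (q j) (h2 (int j) u))))) =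
      s3 (a i) (h3 (- int i - 1) (Sum_any (\<lambda>j. s3 (b j) (Z (q j) (h2 (int j) u)))))" for i q
      unfolding Sum_any_linear[OF finite_right[OF assms] lin3] linear_scale[OF lin3]
      by (rule sum_scale[ symmetric],
          rule finite_nonzero_mono[OF finite_right[OF assms, of b q u]])
        (simp only: flip: linear_scale[OF lin3], simp)
    have 2: "s + of_int p - 1 - of_nat i + of_int p' + of_nat j =
        s + of_int p + of_int p' - 1 + of_nat j - of_nat i" for i j by simp
    show ?thesis unfolding hleft_def hright_def f_def
      by (simp only: 1[symmetric] 2 linear_scale[OF lin3] V3.scale_scale)
  qed
  moreover have "hright b p' (hleft a p Z) s u = Sum_any (\<lambda>j. Sum_any (\<lambda>i. f i j))"
  proof -
    have "s + of_int p' + of_nat j + of_int p - 1 - of_nat i =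
        s + of_int p + of_int p' - 1 + of_nat j - of_nat i" for i j by simp
    then show ?thesis unfolding hleft_def hright_def f_def
        sum_scale[OF finite_left[OF assms]] V3.scale_scale
      by (simp only: mult.commute)
  qed
  ultimately show ?thesis using Sum_any_swap[OF fin] by simp
qed

lemma hright_hright:
  assumes "truncated Z"
  shows "hright b p (hright b' p' Z) s u = hright b' p' (hright b p Z) s u"
proof -
  define f where "f = (\<lambda>i j. s3 (b i * b' j) (Z (s + of_int p + of_int p' + of_nat i + of_nat j)
    (h2 (int j) (h2 (int i) u))))"
  have exp: "hright b p (hright b' p' Z) s u =
      Sum_any (\<lambda>i. Sum_any (\<lambda>j. s3 (b i * b' j) (Z (s + of_int p + of_int p' + of_nat i + of_nat j)
    (h2 (int j) (h2 (int i) u)))))" for b p b' p'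
  proof -
    have "s + of_int p + of_nat i + of_int p' + of_nat j =
        s + of_int p + of_int p' + of_nat i + of_nat j" for i j by simp
    then show ?thesis unfolding hright_def
      by (simp only: sum_scale[OF finite_right[OF assms]] V3.scale_scale)
  qed
  have fin: "finite {(i, j). f i j \<noteq> 0}"
  proof (rule finite_pairs_by_fst)
    show "\<exists>N. \<forall>i\<ge>N. \<forall>j. f i j = 0"
      by (rule int_field_trunc_mono[OF h2_field, of 0 u]) (simp add: f_def truncated_zero_arg[OF assms])
    show "\<exists>N. \<forall>j\<ge>N. f i j = 0" for i
      by (rule int_field_trunc_mono[OF h2_field, of 0 "h2 (int i) u"]) (simp add: f_def truncated_zero_arg[OF assms])
  qed
  have "h2 (int i) (h2 (int j) v) = h2 (int j) (h2 (int i) v)" for i j v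
    using h2_comm[of "int i" "int j" v] by (cases "i = 0 \<and> j = 0") auto
  then have "f i j = s3 (b' j * b i) (Z (s + of_int p' + of_int p + of_nat j + of_nat i)
      (h2 (int i) (h2 (int j) u)))" for i j
    by (simp add: f_def algebra_simps)
  then have "Sum_any (\<lambda>j. Sum_any (\<lambda>i. f i j)) = hright b' p' (hright b p Z) s u"
    by (simp only: exp)
  moreover have "hright b p (hright b' p' Z) s u = Sum_any (\<lambda>i. Sum_any (\<lambda>j. f i j))"
    by (simp only: exp f_def)
  ultimately show ?thesis using Sum_any_swap[OF fin] by simp
qed

text \<open>On the left only negative modes occur and on the right only nonnegative ones; each of
  these families is commutative, and left multiplications commute with right
  multiplications.\<close>

lemma hop_commute:
  assumes "truncated Z"
  shows "hop a b p (hop a' b' p' Z) s u = hop a' b' p' (hop a b p Z) s u"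
proof -
  have "hop a b p (hop a' b' p' Z) s u =
      hleft a p (hleft a' p' Z) s u + hleft a p (hright b' p' Z) s u +
      (hright b p (hleft a' p' Z) s u + hright b p (hright b' p' Z) s u)" for a b p a' b' p'
    unfolding hop_def[abs_def] using assms
    by (simp add: hleft_add hright_add truncated_hleft truncated_hright)
  then show ?thesis
    using hleft_hleft[OF assms, of a p a' p' s u] hright_hright[OF assms, of b p b' p' s u]
    by (simp add: hleft_hright[OF assms])
qed

text \<open>The commutator of \<open>h(m)\<close> with the linear series behind \<open>hop\<close>
  is the scalar \<open>kappa a b m\<close> times \<open>x^(m-p)\<close>: a positive \<open>m\<close>
  meets \<open>h(-m)\<close> in the left part, and \<open>m \<le> 0\<close> meets
  \<open>h(-m)\<close> in the right part.\<close>

definition kappa :: "(nat \<Rightarrow> complex) \<Rightarrow> (nat \<Rightarrow> complex) \<Rightarrow> int \<Rightarrow> complex"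
  where "kappa a b m = of_int m * (if m > 0 then a (nat m - 1) else b (nat (- m)))"

lemma ad_hleft:
  assumes "truncated Z"
  shows "ad m (hleft a p Z) s u = hleft a p (ad m Z) s u +
    (s3 (of_int m * a (nat m - 1)) (Z (s + of_int p - of_int m) u) when m > 0)"
proof -
  let ?z = "\<lambda>i. Z (s + of_int p - 1 - of_nat i) u"
  let ?k = "\<lambda>i. s3 (a i) (s3 (of_int m when m - int i - 1 = 0) (?z i))"
  have fin: "finite {i. s3 (a i) (h3 (q i) (h3 (r i) (?z i))) \<noteq> 0}" for q r :: "nat \<Rightarrow> int"
    by (rule finite_nonzero_mono[OF truncated_finite[OF assms, of "s + of_int p - 1" u]]) simp
  have fin': "finite {i. s3 (a i) (h3 (- int i - 1) (ad m Z (s + of_int p - 1 - of_nat i) u)) \<noteq> 0}"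
    by (rule finite_left[OF truncated_ad[OF assms]])
  have fin'': "finite {i. ?k i \<noteq> 0}"
    by (rule finite_nonzero_mono[OF truncated_finite[OF assms, of "s + of_int p - 1" u]]) simp
  have "ad m (hleft a p Z) s u =
      Sum_any (\<lambda>i. s3 (a i) (h3 m (h3 (- int i - 1) (?z i)))) -
      Sum_any (\<lambda>i. s3 (a i) (h3 (- int i - 1) (Z (s + of_int p - 1 - of_nat i) (h2 m u))))"
    unfolding ad_def hleft_def Sum_any_linear[OF finite_left[OF assms] lin3] linear_scale[OF lin3] ..
  also have "\<dots> = Sum_any (\<lambda>i. s3 (a i) (h3 m (h3 (- int i - 1) (?z i))) -
      s3 (a i) (h3 (- int i - 1) (Z (s + of_int p - 1 - of_nat i) (h2 m u))))"
    by (rule Sum_any_subtractf[symmetric, OF fin finite_left[OF assms]])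
  also have "\<dots> = Sum_any (\<lambda>i. s3 (a i) (h3 (- int i - 1) (ad m Z (s + of_int p - 1 - of_nat i) u)) + ?k i)"
  proof (rule Sum_any.cong)
    fix i
    have "h3 m (h3 (- int i - 1) (?z i)) = h3 (- int i - 1) (h3 m (?z i)) + s3 (of_int m when m - int i - 1 = 0) (?z i)"
      using h3_comm[of m "- int i - 1" "?z i"] by (simp add: algebra_simps)
    then show "s3 (a i) (h3 m (h3 (- int i - 1) (?z i))) -
      s3 (a i) (h3 (- int i - 1) (Z (s + of_int p - 1 - of_nat i) (h2 m u))) =
      s3 (a i) (h3 (- int i - 1) (ad m Z (s + of_int p - 1 - of_nat i) u)) + ?k i"
      by (simp add: ad_def linear_diff[OF lin3] V3.scale_right_distrib V3.scale_right_diff_distrib)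
  qed
  also have "\<dots> = hleft a p (ad m Z) s u + Sum_any ?k"
    unfolding hleft_def by (rule Sum_any.distrib[OF fin' fin''])
  also have "Sum_any ?k = (s3 (of_int m * a (nat m - 1)) (Z (s + of_int p - of_int m) u) when m > 0)"
  proof (cases "m > 0")
    case True
    have "{i. ?k i \<noteq> 0} \<subseteq> {nat m - 1}" by (auto simp: when_def split: if_splits)
    then have "Sum_any ?k = sum ?k {nat m - 1}" by (intro Sum_any.expand_superset) auto
    moreover have "int (nat m - 1) = m - 1" using True by auto
    moreover have "(of_nat (nat m - 1) :: complex) = of_int m - 1" using True by (simp add: of_nat_diff)
    ultimately show ?thesis using True by (simp add: mult.commute algebra_simps)
  next
    case False
    then have "?k i = 0" for i by (auto simp: when_def)
    then show ?thesis using False by simp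
  qed
  finally show ?thesis .
qed

lemma ad_hright:
  assumes "truncated Z"
  shows "ad m (hright b p Z) s u = hright b p (ad m Z) s u +
    (s3 (of_int m * b (nat (- m))) (Z (s + of_int p - of_int m) u) when m \<le> 0)"
proof -
  let ?z = "\<lambda>i. Z (s + of_int p + of_nat i)"
  let ?k = "\<lambda>i. s3 (b i) (s3 (of_int m when m + int i = 0) (?z i u))"
  have fin: "finite {i. s3 (b i) (h3 m (?z i (h2 (int i) u))) \<noteq> 0}"
    by (rule finite_nonzero_mono[OF h2_finite[of u]]) (simp add: truncated_zero_arg[OF assms])
  have fin': "finite {i. s3 (b i) (ad m Z (s + of_int p + of_nat i) (h2 (int i) u)) \<noteq> 0}"
    by (rule finite_right[OF truncated_ad[OF assms]])
  have fin'': "finite {i. ?k i \<noteq> 0}"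
    by (rule finite_subset[of _ "{nat (- m)}"]) (auto simp: when_def split: if_splits)
  have "ad m (hright b p Z) s u =
      Sum_any (\<lambda>i. s3 (b i) (h3 m (?z i (h2 (int i) u)))) -
      Sum_any (\<lambda>i. s3 (b i) (?z i (h2 (int i) (h2 m u))))"
    unfolding ad_def hright_def Sum_any_linear[OF finite_right[OF assms] lin3] linear_scale[OF lin3] ..
  also have "\<dots> = Sum_any (\<lambda>i. s3 (b i) (h3 m (?z i (h2 (int i) u))) - s3 (b i) (?z i (h2 (int i) (h2 m u))))"
    by (rule Sum_any_subtractf[symmetric, OF fin finite_right[OF assms]])
  also have "\<dots> = Sum_any (\<lambda>i. s3 (b i) (ad m Z (s + of_int p + of_nat i) (h2 (int i) u)) + ?k i)"
  proof (rule Sum_any.cong)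
    fix i
    have "h2 (int i) (h2 m u) = h2 m (h2 (int i) u) - s2 (of_int m when m + int i = 0) u"
      using h2_comm[of m "int i" u] by (simp add: algebra_simps)
    then show "s3 (b i) (h3 m (?z i (h2 (int i) u))) - s3 (b i) (?z i (h2 (int i) (h2 m u))) =
      s3 (b i) (ad m Z (s + of_int p + of_nat i) (h2 (int i) u)) + ?k i"
      by (simp add: ad_def linear_diff[OF truncated_linear[OF assms]] linear_scale[OF truncated_linear[OF assms]]
          V3.scale_right_diff_distrib)
  qed
  also have "\<dots> = hright b p (ad m Z) s u + Sum_any ?k"
    unfolding hright_def by (rule Sum_any.distrib[OF fin' fin''])
  also have "Sum_any ?k = (s3 (of_int m * b (nat (- m))) (Z (s + of_int p - of_int m) u) when m \<le> 0)"
  proof (cases "m \<le> 0")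
    case True
    have "{i. ?k i \<noteq> 0} \<subseteq> {nat (- m)}" by (auto simp: when_def split: if_splits)
    then have "Sum_any ?k = sum ?k {nat (- m)}" by (intro Sum_any.expand_superset) auto
    moreover have "(of_nat (nat (- m)) :: complex) = - of_int m" using True by simp
    ultimately show ?thesis using True by (simp add: mult.commute)
  next
    case False
    then have "?k i = 0" for i by (auto simp: when_def)
    then show ?thesis using False by simp
  qed
  finally show ?thesis .
qed

text \<open>The Leibniz rule for the commutator with \<open>h(m)\<close>.\<close>

lemma ad_hop:
  assumes "truncated Z"
  shows "ad m (hop a b p Z) s u =
    hop a b p (ad m Z) s u + s3 (kappa a b m) (Z (s + of_int p - of_int m) u)"
proof -
  have "ad m (hop a b p Z) s u = ad m (hleft a p Z) s u + ad m (hright b p Z) s u"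
    by (simp add: ad_def hop_def linear_add[OF lin3])
  then show ?thesis
    by (auto simp: ad_hleft[OF assms] ad_hright[OF assms] hop_def kappa_def)
qed

text \<open>The part of \<open>d/dx\<close> that keeps the power of \<open>log x\<close>; the rest
  of \<open>ls_deriv\<close> comes from the next power of the logarithm.\<close>

definition shift_deriv :: "(complex \<Rightarrow> 'b \<Rightarrow> 'c) \<Rightarrow> complex \<Rightarrow> 'b \<Rightarrow> 'c"
  where "shift_deriv Z s u = s3 (s + 1) (Z (s + 1) u)"

lemma truncated_shift_deriv: "truncated Z \<Longrightarrow> truncated (shift_deriv Z)"
  unfolding shift_deriv_def[abs_def] by (rule truncated_scale[OF truncated_shift])

text \<open>The product rule: the new coefficients carry the exponents \<open>i + 1 - p\<close> and
  \<open>- p - i\<close> of the two series.\<close>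

lemma shift_deriv_hop:
  assumes "truncated Z"
  shows "shift_deriv (hop a b p Z) s u = hop a b p (shift_deriv Z) s u +
    hop (\<lambda>i. (of_nat i + 1 - of_int p) * a i) (\<lambda>i. - (of_int p + of_nat i) * b i) (p + 1) Z s u"
proof -
  have i1: "s + 1 + of_int p - 1 - of_nat i = s + of_int p - 1 - of_nat i + 1"
    "s + of_int (p + 1) - 1 - of_nat i = s + of_int p - 1 - of_nat i + 1" for i by simp_all
  have i2: "s + 1 + of_int p + of_nat i = s + of_int p + of_nat i + 1"
    "s + of_int (p + 1) + of_nat i = s + of_int p + of_nat i + 1" for i by simp_all
  have "finite {i::nat. Z (s + of_int p - of_nat i) u \<noteq> 0}" by (rule truncated_finite[OF assms])
  moreover have i3: "s + of_int p - of_nat i = s + of_int p - 1 - of_nat i + 1" for i by simp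
  ultimately have fin0: "finite {i::nat. Z (s + of_int p - 1 - of_nat i + 1) u \<noteq> 0}" by (simp only: i3)
  have fin1: "finite {i. s3 (c i) (h3 (q i) (Z (s + of_int p - 1 - of_nat i + 1) u)) \<noteq> 0}" for c q
    by (rule fin_h3[OF fin0])
  have "s3 (s + 1) (hleft a p Z (s + 1) u) = hleft a p (shift_deriv Z) s u +
      hleft (\<lambda>i. (of_nat i + 1 - of_int p) * a i) (p + 1) Z s u"
  proof -
    have "(s + 1) * a i = a i * (s + of_int p - 1 - of_nat i + 1) + (of_nat i + 1 - of_int p) * a i" for i
      by (simp add: algebra_simps)
    then show ?thesis
      unfolding hleft_def shift_deriv_def i1 sum_scale[OF fin1]
        V3.scale_scale linear_scale[OF lin3]
      by (simp only: V3.scale_left_distrib Sum_any.distrib[OF fin1 fin1])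
  qed
  moreover have "s3 (s + 1) (hright b p Z (s + 1) u) = hright b p (shift_deriv Z) s u +
      hright (\<lambda>i. - (of_int p + of_nat i) * b i) (p + 1) Z s u"
  proof -
    have "(s + 1) * b i = b i * (s + of_int p + of_nat i + 1) + - (of_int p + of_nat i) * b i" for i
      by (simp add: algebra_simps)
    then show ?thesis
      unfolding hright_def shift_deriv_def i2 sum_scale[OF finite_right[OF assms]]
        V3.scale_scale
      by (simp only: V3.scale_left_distrib Sum_any.distrib[OF finite_right[OF assms] finite_right[OF assms]])
  qed
  ultimately show ?thesis by (simp add: shift_deriv_def hop_def V3.scale_right_distrib)
qed

end

section \<open>Fock spaces\<close>

locale fock_space =
  fixes sc :: "complex \<Rightarrow> 'w::ab_group_add \<Rightarrow> 'w" and h0 :: "'w \<Rightarrow> 'w"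
  assumes sc: "vector_space sc" and h0: "Vector_Spaces.linear sc sc h0"
begin

sublocale W: vector_space sc by (rule sc)
sublocale F: vector_space "fock_scale sc" by (rule vector_space_fock[OF sc])

abbreviation "H \<equiv> heis sc h0"

lemma lookup_scale: "Poly_Mapping.lookup (fock_scale sc c f) \<mu> = sc c (Poly_Mapping.lookup f \<mu>)"
  by (rule lookup_fock_scale[OF sc])

lemma lookup_annihilate: "Poly_Mapping.lookup (fock_annihilate sc i f) \<nu> =
    sc (of_nat ((i + 1) * (count \<nu> i + 1))) (Poly_Mapping.lookup f (add_mset i \<nu>))"
  by (simp add: fock_annihilate.rep_eq when_def)

lemma lookup_map_h0: "Poly_Mapping.lookup (Poly_Mapping.map h0 f) \<nu> = h0 (Poly_Mapping.lookup f \<nu>)"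
  by (simp add: Poly_Mapping.map.rep_eq when_def linear_0[OF h0])

lemma heis_linear: "Vector_Spaces.linear (fock_scale sc) (fock_scale sc) (H n)"
proof (rule linearI[OF F.vector_space_axioms F.vector_space_axioms])
  show "H n (u + v) = H n u + H n v" for u v
    by (rule poly_mapping_eqI)
      (simp add: heis_def lookup_add fock_create.rep_eq lookup_annihilate lookup_map_h0 linear_add[OF h0]
        W.scale_right_distrib)
  show "H n (fock_scale sc c u) = fock_scale sc c (H n u)" for c u
    by (rule poly_mapping_eqI)
      (simp add: heis_def lookup_scale fock_create.rep_eq lookup_annihilate lookup_map_h0 linear_scale[OF h0]
        mult.commute)
qed

lemma heis_field: "int_field (fock_scale sc) (fock_scale sc) H"
  unfolding int_field_def
proof (intro conjI allI heis_linear)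
  fix u :: "'w fock"
  have "finite (\<Union>\<mu>\<in>Poly_Mapping.keys u. set_mset \<mu>)" by simp
  then obtain K where K: "\<forall>i\<in>(\<Union>\<mu>\<in>Poly_Mapping.keys u. set_mset \<mu>). i < K"
    using finite_nat_set_iff_bounded by blast
  have "H n u = 0" if n: "n \<ge> int K + 1" for n
  proof (rule poly_mapping_eqI)
    fix \<nu>
    have "add_mset (nat n - 1) \<nu> \<notin> Poly_Mapping.keys u"
    proof
      assume "add_mset (nat n - 1) \<nu> \<in> Poly_Mapping.keys u"
      then have "nat n - 1 < K" using K by force
      then show False using n by linarith
    qed
    then show "Poly_Mapping.lookup (H n u) \<nu> = Poly_Mapping.lookup 0 \<nu>"
      using n by (simp add: heis_def lookup_annihilate in_keys_iff)
  qed
  then show "\<exists>N. \<forall>n\<ge>N. H n u = 0" by blast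
qed

lemma heis_comm: "H m (H n u) - H n (H m u) = fock_scale sc (of_int m when m + n = 0) u"
  by (rule heis_commutator[OF sc h0])

lemma heis_create: "H (- int K - 1) u = fock_create K u"
  by (simp add: heis_def nat_add_distrib)

lemma create_linear: "Vector_Spaces.linear (fock_scale sc) (fock_scale sc) (fock_create K)"
  using heis_linear[of "- int K - 1"] by (simp add: heis_create[abs_def])

lemma fock_create_single: "fock_create K (Poly_Mapping.single \<mu> w) = Poly_Mapping.single (add_mset K \<mu>) (w :: 'w)"
  by (rule poly_mapping_eqI) (auto simp: fock_create.rep_eq lookup_single when_def)

lemma heis_vac:
  "H (int i) (Poly_Mapping.single {#} w) = (Poly_Mapping.single {#} (h0 w) when i = 0)"
  by (rule poly_mapping_eqI)
    (auto simp: heis_def lookup_annihilate lookup_map_h0 lookup_single when_def linear_0[OF h0])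

lemma fock_induct_single:
  assumes "\<And>u v. P u \<Longrightarrow> P v \<Longrightarrow> P (u + v)" and "\<And>\<mu> w. P (Poly_Mapping.single \<mu> w)"
  shows "P (u :: 'w fock)"
proof -
  have "u = (\<Sum>\<mu>\<in>Poly_Mapping.keys u. Poly_Mapping.single \<mu> (Poly_Mapping.lookup u \<mu>))"
    by (rule poly_mapping_eqI) (simp add: lookup_sum lookup_single when_def in_keys_iff)
  moreover have "P (\<Sum>\<mu>\<in>K. Poly_Mapping.single \<mu> (g \<mu>))" if "finite K" for K g
    using that by (induction K rule: finite_induct) (use assms assms(2)[of "{#}" 0] in auto)
  ultimately show ?thesis by (metis finite_keys)
qed

lemma fock_induct [case_names add vac create]:
  assumes add: "\<And>u v. P u \<Longrightarrow> P v \<Longrightarrow> P (u + v)" and vac: "\<And>w. P (Poly_Mapping.single {#} w)"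
    and create: "\<And>K u. P u \<Longrightarrow> P (fock_create K u)"
  shows "P (u :: 'w fock)"
proof (rule fock_induct_single[of P, OF add])
  show "P (Poly_Mapping.single \<mu> w)" for \<mu> w
    by (induction \<mu>) (use vac create in \<open>auto simp flip: fock_create_single\<close>)
qed

text \<open>The operator \<open>L(-1)\<close> in terms of Heisenberg modes; no conformal vector
  enters here.\<close>

definition virasoro :: "'w fock \<Rightarrow> 'w fock"
  where "virasoro u = Sum_any (\<lambda>j. H (- int j - 1) (H (int j) u))"

lemma heis_finite: "finite {j::nat. H (int j) u \<noteq> 0}"
  using int_field_finite[OF heis_field, of 0 u] by simp

lemma heis_0 [simp]: "H n 0 = 0"
  by (rule linear_0[OF heis_linear])

lemma virasoro_finite: "finite {j::nat. H (q j) (H (int j) u) \<noteq> 0}"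
  by (rule finite_nonzero_mono[OF heis_finite[of u]]) simp

lemma virasoro_add: "virasoro (u + v) = virasoro u + virasoro v"
  unfolding virasoro_def linear_add[OF heis_linear]
  by (rule Sum_any.distrib[OF virasoro_finite virasoro_finite])

lemma virasoro_vac: "virasoro (Poly_Mapping.single {#} w) = fock_create 0 (Poly_Mapping.single {#} (h0 w))"
  unfolding virasoro_def heis_vac
  by (subst Sum_any.expand_superset[of "{0}"]) (auto simp: heis_create[of 0, simplified] when_def)

lemma virasoro_create:
  "virasoro (fock_create K u) =
    fock_create K (virasoro u) + fock_scale sc (of_nat K + 1) (fock_create (K + 1) u)"
proof -
  let ?k = "\<lambda>j. H (- int j - 1) (fock_scale sc (of_nat j when j = K + 1) u)"
  have eq: "H (- int j - 1) (H (int j) (fock_create K u)) =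
      H (- int K - 1) (H (- int j - 1) (H (int j) u)) + ?k j" for j
  proof -
    have "H (int j) (fock_create K u) = H (- int K - 1) (H (int j) u) + fock_scale sc (of_nat j when j = K + 1) u"
      using heis_comm[of "int j" "- int K - 1" u] by (auto simp: heis_create when_def algebra_simps)
    moreover have "H (- int j - 1) (H (- int K - 1) v) = H (- int K - 1) (H (- int j - 1) v)" for v
      using heis_comm[of "- int j - 1" "- int K - 1" v] by simp
    ultimately show ?thesis by (simp only: linear_add[OF heis_linear])
  qed
  have sub: "{j. ?k j \<noteq> 0} \<subseteq> {K + 1}"
    by (auto simp: when_def linear_0[OF heis_linear] split: if_splits)
  have "virasoro (fock_create K u) =
      Sum_any (\<lambda>j. H (- int K - 1) (H (- int j - 1) (H (int j) u))) + Sum_any ?k"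
    unfolding virasoro_def eq
    by (rule Sum_any.distrib[OF finite_nonzero_mono[OF virasoro_finite[of "\<lambda>j. - int j - 1" u]] finite_subset[OF sub]]) simp_all
  also have "Sum_any (\<lambda>j. H (- int K - 1) (H (- int j - 1) (H (int j) u))) = fock_create K (virasoro u)"
    unfolding virasoro_def heis_create[symmetric, of K]
    by (rule Sum_any_linear[symmetric, OF virasoro_finite heis_linear])
  also have "Sum_any ?k = sum ?k {K + 1}" by (rule Sum_any.expand_superset) (use sub in auto)
  also have "\<dots> = fock_scale sc (of_nat K + 1) (fock_create (K + 1) u)"
    using heis_create[of "K + 1"] by (simp add: linear_scale[OF heis_linear] add.commute)
  finally show ?thesis .
qed

lemma fock_vertex_Sum_any:
  "fock_vertex sc h0 v n u = Sum_any (\<lambda>\<mu>. fock_scale sc (Poly_Mapping.lookup v \<mu>) (monomial_vertex sc h0 \<mu> n u))"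
  unfolding fock_vertex_def
  by (rule Sum_any.expand_superset[symmetric]) (auto simp: in_keys_iff)

lemma fock_vertex_add: "fock_vertex sc h0 (v + v') n u = fock_vertex sc h0 v n u + fock_vertex sc h0 v' n u"
proof -
  have "finite {\<mu>. fock_scale sc (Poly_Mapping.lookup v \<mu>) (monomial_vertex sc h0 \<mu> n u) \<noteq> 0}" for v
    by (rule finite_subset[of _ "Poly_Mapping.keys v"]) (auto simp: in_keys_iff)
  then show ?thesis
    unfolding fock_vertex_Sum_any lookup_add F.scale_left_distrib by (intro Sum_any.distrib) auto
qed

lemma fock_vertex_single:
  "fock_vertex sc h0 (Poly_Mapping.single \<mu> c) n u = fock_scale sc c (monomial_vertex sc h0 \<mu> n u)"
  unfolding fock_vertex_Sum_any
  by (subst Sum_any.expand_superset[of "{\<mu>}"]) (auto simp: lookup_single when_def)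

lemma normal_product_id:
  assumes "\<And>n. A n 0 = (0 :: 'w fock)"
  shows "normal_product A (\<lambda>n u. u when n = -1) n u = A n u"
proof -
  have "normal_product A (\<lambda>n u. u when n = -1) n u =
      Sum_any (\<lambda>j. A (- int j - 1) (u when n + int j = -1)) + Sum_any (\<lambda>j. A (int j) u when n - int j - 1 = -1)"
    by (rule normal_product_nat)
  also have "\<dots> = A n u"
  proof (cases "n < 0")
    case True
    have "Sum_any (\<lambda>j. A (- int j - 1) (u when n + int j = -1)) =
        (\<Sum>j\<in>{nat (- n - 1)}. A (- int j - 1) (u when n + int j = -1))"
      by (rule Sum_any.expand_superset) (auto simp: when_def assms split: if_splits)
    moreover have "(A (int j) u when n - int j - 1 = -1) = 0" for j using True by simp
    ultimately show ?thesis using True by (simp add: assms)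
  next
    case False
    have "Sum_any (\<lambda>j. A (int j) u when n - int j - 1 = -1) =
        (\<Sum>j\<in>{nat n}. A (int j) u when n - int j - 1 = -1)"
      by (rule Sum_any.expand_superset) (auto simp: when_def split: if_splits)
    moreover have "A (- int j - 1) (u when n + int j = -1) = 0" for j using False by (simp add: assms when_def)
    ultimately show ?thesis using False by simp
  qed
  finally show ?thesis .
qed

text \<open>The quadratic part of \<open>omega p\<close> is \<open>h(-1)^2 / 2\<close>, whose
  normally ordered square counts each product \<open>h(-j-1) h(j)\<close> twice. The field of the
  part with \<open>alpha(-2)\<close> is a derivative, so it contributes nothing to the mode of index
  0.\<close>

lemma omega_0_eq_virasoro:
  assumes "p \<ge> 1"
  shows "fock_vertex sc h0 (omega p) 0 u = virasoro u"
proof -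
  interpret C: vector_space "(*) :: complex \<Rightarrow> complex \<Rightarrow> complex"
    by unfold_locales (simp_all add: algebra_simps)
  have cs: "Poly_Mapping.single \<mu> x = (Poly_Mapping.single \<mu> y :: complex fock)" if "x = y" for \<mu> x y
    using that by simp
  have fs: "fock_scale (*) c (Poly_Mapping.single \<mu> x) = (Poly_Mapping.single \<mu> (c * x) :: complex fock)" for c \<mu> x
    by (rule poly_mapping_eqI) (simp add: lookup_fock_scale[OF C.vector_space_axioms] lookup_single when_def)
  have cr: "fock_create K (Poly_Mapping.single \<mu> x) = (Poly_Mapping.single (add_mset K \<mu>) x :: complex fock)" for K \<mu> x
    by (rule poly_mapping_eqI) (auto simp: fock_create.rep_eq lookup_single when_def)
  have al: "alpha p * alpha p = 2 * of_nat p" using alpha_form by (simp add: hform_def)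
  have om: "omega p = Poly_Mapping.single {#0, 0#} (1 / 2) +
      Poly_Mapping.single {#1#} ((of_nat p - 1) / (2 * of_nat p) * alpha p)"
    using assms al by (simp add: omega_def Let_def hmode_def heis_def fs cr del: single_one)
  have np: "normal_product H (\<lambda>n u. u when n = -1) = H"
    by (intro ext normal_product_id) simp
  have m1: "monomial_vertex sc h0 {#0, 0#} 0 u = virasoro u + virasoro u"
    by (simp add: monomial_vertex_def np normal_product_nat virasoro_def)
  have "field_deriv (fock_scale sc) H 0 u = 0" "\<And>n. field_deriv (fock_scale sc) H n 0 = 0"
    by (simp_all add: field_deriv_def)
  then have m2: "monomial_vertex sc h0 {#1#} 0 u = 0"
    by (simp add: monomial_vertex_def normal_product_id)
  show ?thesis
    unfolding om fock_vertex_add fock_vertex_single m1 m2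
    by (simp flip: F.scale_left_distrib add: F.scale_right_distrib)
qed

end

section \<open>Intertwining operators generated from the lowest-weight space\<close>

locale fock_modules =
  W1: fock_space sc h0 + W2: fock_space sc2 h02 + W3: fock_space sc3 h03
  for sc :: "complex \<Rightarrow> 'a::ab_group_add \<Rightarrow> 'a" and h0 :: "'a \<Rightarrow> 'a"
    and sc2 :: "complex \<Rightarrow> 'b::ab_group_add \<Rightarrow> 'b" and h02 :: "'b \<Rightarrow> 'b"
    and sc3 :: "complex \<Rightarrow> 'c::ab_group_add \<Rightarrow> 'c" and h03 :: "'c \<Rightarrow> 'c"
begin

sublocale heis_pair "fock_scale sc2" "fock_scale sc3" "heis sc2 h02" "heis sc3 h03"
  by unfold_locales (rule W2.heis_field W3.heis_field W2.heis_comm W3.heis_comm)+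

abbreviation "s1 \<equiv> fock_scale sc"
abbreviation "s2 \<equiv> fock_scale sc2"
abbreviation "s3 \<equiv> fock_scale sc3"

text \<open>
  The normally ordered product with \<open>\<partial>\<^sup>K h(x) / K!\<close>.
\<close>

definition dress where "dress K = hop (\<lambda>i. of_nat (i choose K)) (\<lambda>i. (-1) ^ K * of_nat ((K + i) choose K)) (int K + 1)"

lemma truncated_dress: "truncated Z \<Longrightarrow> truncated (dress K Z)"
  unfolding dress_def by (rule truncated_hop)

lemma dress_commute: "truncated Z \<Longrightarrow> dress K (dress L Z) = dress L (dress K Z)"
  unfolding dress_def by (intro ext hop_commute)

lemma dress_add: "truncated Z \<Longrightarrow> truncated Z' \<Longrightarrow> dress K (\<lambda>s u. Z s u + Z' s u) = (\<lambda>s u. dress K Z s u + dress K Z' s u)"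
  unfolding dress_def by (intro ext hop_add)

lemma dress_scale: "truncated Z \<Longrightarrow> dress K (\<lambda>s u. s3 c (Z s u)) = (\<lambda>s u. s3 c (dress K Z s u))"
  unfolding dress_def by (intro ext hop_scale)

text \<open>The commutator of \<open>h(m)\<close> with \<open>h(x)\<close> is
  \<open>m x^(m-1)\<close>; its \<open>K\<close>-th derivative divided by \<open>K!\<close> has the
  coefficient \<open>m\<close> times \<open>(m - 1) choose K\<close>, which absorption
  rewrites.\<close>

lemma kappa_dress:
  "kappa (\<lambda>i. of_nat (i choose K)) (\<lambda>i. (-1) ^ K * of_nat ((K + i) choose K)) m =
    of_nat (K + 1) * (of_int m gchoose (K + 1))"
proof -
  have "of_nat (K + 1) * (of_int m gchoose (K + 1)) = (of_int m :: complex) * (of_int (m - 1) gchoose K)"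
    using gbinomial_absorption[of K "of_int m :: complex"] by simp
  moreover have "of_int (m - 1) gchoose K = (of_nat ((nat m - 1) choose K) :: complex)" if "m > 0"
  proof -
    have "m - 1 = int (nat m - 1)" using that by simp
    then show ?thesis by (metis binomial_gbinomial of_int_of_nat_eq)
  qed
  moreover have "of_int (m - 1) gchoose K = ((-1) ^ K * of_nat ((K + nat (- m)) choose K) :: complex)" if "m \<le> 0"
  proof -
    have "m - 1 = - int (nat (- m)) - 1" using that by simp
    then show ?thesis
      using gbinomial_minus_nat[of "nat (- m)" K] binomial_symmetric[of K "nat (- m) + K"]
      by (simp add: add.commute del: of_int_diff of_int_minus)
  qed
  ultimately show ?thesis by (simp add: kappa_def del: of_nat_add of_int_diff)
qed

lemma ad_dress:
  assumes "truncated Z"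
  shows "ad m (dress K Z) s u = dress K (ad m Z) s u +
    s3 (of_nat (K + 1) * (of_int m gchoose (K + 1))) (Z (s - of_int m + of_nat (K + 1)) u)"
  unfolding dress_def ad_hop[OF assms] kappa_dress by (simp add: algebra_simps)

text \<open>The product rule, where differentiating the \<open>K\<close>-th divided derivative of
  \<open>h(x)\<close> gives \<open>K + 1\<close> times the next one.\<close>

lemma shift_deriv_dress:
  assumes "truncated Z"
  shows "shift_deriv (dress K Z) s u = dress K (shift_deriv Z) s u + s3 (of_nat (K + 1)) (dress (K + 1) Z s u)"
proof -
  have a: "(of_nat i + 1 - of_int (int K + 1)) * of_nat (i choose K) =
      (of_nat (K + 1) * of_nat (i choose (K + 1)) :: complex)" for i
  proof -
    have "of_nat (Suc K) * (of_nat i gchoose Suc K) = (of_nat i - of_nat K) * (of_nat i gchoose K :: complex)"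
      by (simp only: gbinomial_absorption gbinomial_absorb_comp)
    then show ?thesis by (simp add: binomial_gbinomial)
  qed
  have b: "- (of_int (int K + 1) + of_nat i) * ((-1) ^ K * of_nat ((K + i) choose K)) =
      (of_nat (K + 1) * ((-1) ^ (K + 1) * of_nat ((K + 1 + i) choose (K + 1))) :: complex)" for i
  proof -
    have "Suc K * (Suc (K + i) choose Suc K) = Suc (K + i) * ((K + i) choose K)"
      by (rule Suc_times_binomial)
    from arg_cong[OF this, of "\<lambda>x. - ((-1 :: complex) ^ K * of_nat x)"] show ?thesis
      by (simp add: algebra_simps del: binomial_Suc_Suc)
  qed
  have p: "int (K + 1) + 1 = int K + 1 + 1" by simp
  show ?thesis
    unfolding dress_def shift_deriv_hop[OF assms] a b hop_coeff[OF assms] p ..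
qed

end

text \<open>The requirements on the lowest-weight space. There \<open>h(n) w = 0\<close> for
  \<open>n > 0\<close>, so \<open>base_ad\<close> is the commutator formula for \<open>w\<close>;
  and \<open>L(-1) w = h(-1) h(0) w\<close>, so \<open>base_deriv\<close> is the derivative
  property.\<close>

locale fock_intertwiner = fock_modules sc h0 sc2 h02 sc3 h03
  for sc :: "complex \<Rightarrow> 'a::ab_group_add \<Rightarrow> 'a" and h0
    and sc2 :: "complex \<Rightarrow> 'b::ab_group_add \<Rightarrow> 'b" and h02
    and sc3 :: "complex \<Rightarrow> 'c::ab_group_add \<Rightarrow> 'c" and h03 +
  fixes base :: "'a \<Rightarrow> ('b fock, 'c fock) log_series"
  assumes base_truncated: "truncated (\<lambda>s. base w s k)"
    and base_linear: "Vector_Spaces.linear sc (fock_scale sc3) (\<lambda>w. base w s k u)"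
    and base_ad: "ad m (\<lambda>s. base w s k) s u = base (h0 w) (s - of_int m) k u"
    and base_deriv: "ls_deriv (fock_scale sc3) (base w) s k u = dress 0 (\<lambda>s. base (h0 w) s k) s u"
    and base_logs: "\<exists>K. \<forall>w s u. \<forall>k>K. base w s k u = 0"
begin

text \<open>
  The sorting of the multiset is immaterial, because the operators \<open>dress K\<close> commute on \<open>truncated\<close> fields.
\<close>

definition Ylist :: "nat list \<Rightarrow> 'a \<Rightarrow> nat \<Rightarrow> complex \<Rightarrow> 'b fock \<Rightarrow> 'c fock"
  where "Ylist xs w k = foldr dress xs (\<lambda>s. base w s k)"

definition Y :: "'a fock \<Rightarrow> ('b fock, 'c fock) log_series"
  where "Y v s k u = Sum_any (\<lambda>\<mu>. Ylist (sorted_list_of_multiset \<mu>) (Poly_Mapping.lookup v \<mu>) k s u)"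

lemma truncated_foldr: "truncated Z \<Longrightarrow> truncated (foldr dress xs Z)"
  by (induction xs) (auto intro: truncated_dress)

lemma truncated_Ylist: "truncated (Ylist xs w k)"
  unfolding Ylist_def by (rule truncated_foldr[OF base_truncated])

lemma Ylist_insort: "Ylist (insort i xs) w k = dress i (Ylist xs w k)"
proof (induction xs)
  case (Cons x xs)
  have "Ylist (insort i (x # xs)) w k =
      (if i \<le> x then dress i (Ylist (x # xs) w k) else dress x (Ylist (insort i xs) w k))"
    by (simp add: Ylist_def)
  also have "dress x (Ylist (insort i xs) w k) = dress i (Ylist (x # xs) w k)"
    using dress_commute[OF truncated_Ylist, of x i xs w k] by (simp add: Cons) (simp add: Ylist_def)
  finally show ?case by simp
qed (simp add: Ylist_def)

lemma Ylist_add: "Ylist xs (w + w') k = (\<lambda>s u. Ylist xs w k s u + Ylist xs w' k s u)"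
proof (induction xs)
  case Nil
  show ?case by (simp add: Ylist_def linear_add[OF base_linear])
next
  case (Cons x xs)
  have "Ylist (x # xs) (w + w') k = dress x (Ylist xs (w + w') k)" by (simp add: Ylist_def)
  also have "\<dots> = (\<lambda>s u. dress x (Ylist xs w k) s u + dress x (Ylist xs w' k) s u)"
    unfolding Cons by (rule dress_add[OF truncated_Ylist truncated_Ylist])
  finally show ?case by (simp add: Ylist_def)
qed

lemma Ylist_scale: "Ylist xs (sc c w) k = (\<lambda>s u. s3 c (Ylist xs w k s u))"
proof (induction xs)
  case Nil
  show ?case by (simp add: Ylist_def linear_scale[OF base_linear])
next
  case (Cons x xs)
  have "Ylist (x # xs) (sc c w) k = dress x (Ylist xs (sc c w) k)" by (simp add: Ylist_def)
  also have "\<dots> = (\<lambda>s u. s3 c (dress x (Ylist xs w k) s u))"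
    unfolding Cons by (rule dress_scale[OF truncated_Ylist])
  finally show ?case by (simp add: Ylist_def)
qed

lemma Ylist_0: "Ylist xs 0 k s u = 0"
  using Ylist_scale[of xs 0 0 k] by simp

lemma Y_finite: "finite {\<mu>. Ylist (sorted_list_of_multiset \<mu>) (Poly_Mapping.lookup v \<mu>) k s u \<noteq> 0}"
  by (rule finite_subset[of _ "Poly_Mapping.keys v"]) (auto simp: in_keys_iff Ylist_0)

lemma Y_keys: "Y v s k u =
    (\<Sum>\<mu>\<in>Poly_Mapping.keys v. Ylist (sorted_list_of_multiset \<mu>) (Poly_Mapping.lookup v \<mu>) k s u)"
  unfolding Y_def by (rule Sum_any.expand_superset) (auto simp: in_keys_iff Ylist_0)

lemma Y_single: "Y (Poly_Mapping.single \<mu> w) s k u = Ylist (sorted_list_of_multiset \<mu>) w k s u"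
  unfolding Y_def by (subst Sum_any.expand_superset[of "{\<mu>}"]) (auto simp: lookup_single when_def Ylist_0)

lemma Y_vac: "Y (Poly_Mapping.single {#} w) = base w"
  by (intro ext) (simp add: Y_single Ylist_def)

lemma truncated_Y: "truncated (\<lambda>s. Y v s k)"
proof -
  have "(\<lambda>s. Y v s k) = (\<lambda>s u. \<Sum>\<mu>\<in>Poly_Mapping.keys v.
      Ylist (sorted_list_of_multiset \<mu>) (Poly_Mapping.lookup v \<mu>) k s u)"
    by (intro ext) (rule Y_keys)
  then show ?thesis by (simp add: truncated_sum truncated_Ylist)
qed

lemma Y_add: "Y (v + v') s k u = Y v s k u + Y v' s k u"
  unfolding Y_def lookup_add Ylist_add by (rule Sum_any.distrib; rule Y_finite)

lemma Y_scale: "Y (s1 c v) s k u = s3 c (Y v s k u)"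
  unfolding Y_def W1.lookup_scale Ylist_scale
  by (rule Sum_any_scale[symmetric, OF W3.F.vector_space_axioms], rule Y_finite)

lemma Y_linear: "Vector_Spaces.linear s1 s3 (\<lambda>v. Y v s k u)"
  by (rule linearI) (simp_all add: Y_add Y_scale W1.F.vector_space_axioms W3.F.vector_space_axioms)

lemma Y_0: "Y 0 s k u = 0"
  by (rule linear_0[OF Y_linear])

lemma Y_create: "Y (fock_create K v) s k u = dress K (\<lambda>s. Y v s k) s u"
proof (induction v arbitrary: s u rule: W1.fock_induct_single)
  case (1 v v')
  then have "Y (fock_create K (v + v')) s k u = dress K (\<lambda>s. Y v s k) s u + dress K (\<lambda>s. Y v' s k) s u"
    by (simp add: linear_add[OF W1.create_linear] Y_add)
  also have "\<dots> = dress K (\<lambda>s. Y (v + v') s k) s u"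
    unfolding Y_add by (simp only: dress_add[OF truncated_Y truncated_Y])
  finally show ?case .
next
  case (2 \<mu> w)
  have "(\<lambda>s. Y (Poly_Mapping.single \<mu> w) s k) = Ylist (sorted_list_of_multiset \<mu>) w k"
    by (intro ext) (rule Y_single)
  then show ?case
    by (simp add: W1.fock_create_single Y_single Ylist_insort)
qed

text \<open>The commutator formula, by induction over creation operators. The scalar commutator of
  \<open>h(m)\<close> with the factor added by \<open>dress K\<close> matches that of
  \<open>h(i)\<close> with \<open>h(-K-1)\<close>, which is nonzero for \<open>i = K + 1\<close>
  only.\<close>

lemma Y_ad:
  "ad m (\<lambda>s. Y v s k) s u = Sum_any (\<lambda>i. s3 (of_int m gchoose i)
    (Y (W1.H (int i) v) (s - of_int m + of_nat i) k u))"
proof (induction v arbitrary: s u rule: W1.fock_induct)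
  case (add v v')
  have fin: "finite {i. s3 (c i) (Y (W1.H (int i) v) (q i) k u) \<noteq> 0}" for c q v
    by (rule finite_nonzero_mono[OF W1.heis_finite[of v]]) (simp add: Y_0)
  have "ad m (\<lambda>s. Y (v + v') s k) s u = ad m (\<lambda>s. Y v s k) s u + ad m (\<lambda>s. Y v' s k) s u"
    unfolding ad_def Y_add linear_add[OF W3.heis_linear] by simp
  then show ?case
    unfolding add linear_add[OF W1.heis_linear] Y_add W3.F.scale_right_distrib
    by (simp only: Sum_any.distrib[OF fin fin])
next
  case (vac w)
  have "ad m (\<lambda>s. Y (Poly_Mapping.single {#} w) s k) s u = base (h0 w) (s - of_int m) k u"
    unfolding Y_vac by (rule base_ad)
  moreover have "Sum_any (\<lambda>i. s3 (of_int m gchoose i)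
      (Y (W1.H (int i) (Poly_Mapping.single {#} w)) (s - of_int m + of_nat i) k u)) =
      base (h0 w) (s - of_int m) k u"
    unfolding W1.heis_vac
    by (subst Sum_any.expand_superset[of "{0}"]) (auto simp: when_def Y_0 Y_vac)
  ultimately show ?case by simp
next
  case (create K v)
  \<comment> \<open>One bound serves all exponents and arguments, so the induction hypothesis
    becomes a finite sum of truncated fields, to which \<open>dress K\<close> can be applied term by
    term.\<close>
  obtain N where N: "\<forall>i\<ge>N. W1.H (int i) v = 0"
    using int_field_trunc[OF W1.heis_field, of 0 v] by auto
  let ?Z = "\<lambda>i. (\<lambda>s u. s3 (of_int m gchoose i) (Y (W1.H (int i) v) (s + (of_nat i - of_int m)) k u))"
  have truncatedZ: "truncated (?Z i)" for i by (rule truncated_scale[OF truncated_shift[OF truncated_Y]])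
  have "ad m (\<lambda>s. Y v s k) = (\<lambda>s u. \<Sum>i<N. ?Z i s u)"
  proof (intro ext)
    fix s u
    have "ad m (\<lambda>s. Y v s k) s u = (\<Sum>i<N. s3 (of_int m gchoose i)
        (Y (W1.H (int i) v) (s - of_int m + of_nat i) k u))"
      unfolding create by (rule Sum_any.expand_superset) (use N in \<open>auto simp: Y_0 not_less[symmetric] intro: ccontr\<close>)
    then show "ad m (\<lambda>s. Y v s k) s u = (\<Sum>i<N. ?Z i s u)" by (simp add: algebra_simps)
  qed
  then have "dress K (ad m (\<lambda>s. Y v s k)) s u = (\<Sum>i<N. dress K (?Z i) s u)"
    by (simp only: dress_def hop_sum[OF finite_lessThan truncatedZ])
  also have "\<dots> = (\<Sum>i<N. s3 (of_int m gchoose i)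
      (Y (fock_create K (W1.H (int i) v)) (s - of_int m + of_nat i) k u))"
  proof (rule sum.cong[OF refl])
    fix i
    have "dress K (?Z i) s u = s3 (of_int m gchoose i)
        (dress K (\<lambda>s. Y (W1.H (int i) v) (s + (of_nat i - of_int m)) k) s u)"
      by (simp only: dress_scale[OF truncated_shift[OF truncated_Y]])
    then show "dress K (?Z i) s u = s3 (of_int m gchoose i)
        (Y (fock_create K (W1.H (int i) v)) (s - of_int m + of_nat i) k u)"
      unfolding Y_create dress_def hop_shift[of _ _ _ "\<lambda>s. Y (W1.H (int i) v) s k"]
      by (simp add: algebra_simps)
  qed
  also have "\<dots> = Sum_any (\<lambda>i. s3 (of_int m gchoose i)
      (Y (fock_create K (W1.H (int i) v)) (s - of_int m + of_nat i) k u))"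
    by (rule Sum_any.expand_superset[symmetric])
      (use N in \<open>auto simp: Y_0 linear_0[OF W1.create_linear] not_less[symmetric] intro: ccontr\<close>)
  finally have main: "dress K (ad m (\<lambda>s. Y v s k)) s u = \<dots>" .
  let ?F = "\<lambda>i. s3 (of_int m gchoose i) (Y (fock_create K (W1.H (int i) v)) (s - of_int m + of_nat i) k u)"
  let ?G = "\<lambda>i. s3 (of_int m gchoose i) (Y (s1 (of_nat i when i = K + 1) v) (s - of_int m + of_nat i) k u)"
  have finF: "finite {i. ?F i \<noteq> 0}"
    by (rule finite_nonzero_mono[OF W1.heis_finite[of v]]) (simp add: Y_0 linear_0[OF W1.create_linear])
  have subG: "{i. ?G i \<noteq> 0} \<subseteq> {K + 1}"
    by (auto simp: when_def Y_0 split: if_splits)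
  have "heis sc h0 (int i) (fock_create K v) =
      fock_create K (W1.H (int i) v) + s1 (of_nat i when i = K + 1) v" for i
    using W1.heis_comm[of "int i" "- int K - 1" v] by (auto simp: W1.heis_create when_def algebra_simps)
  then have "Sum_any (\<lambda>i. s3 (of_int m gchoose i)
      (Y (W1.H (int i) (fock_create K v)) (s - of_int m + of_nat i) k u)) =
      Sum_any (\<lambda>i. ?F i + ?G i)"
    by (simp only: Y_add W3.F.scale_right_distrib)
  also have "\<dots> = Sum_any ?F + Sum_any ?G"
    by (rule Sum_any.distrib[OF finF finite_subset[OF subG]]) simp
  also have "Sum_any ?G = sum ?G {K + 1}"
    by (rule Sum_any.expand_superset) (use subG in auto)
  also have "\<dots> = s3 (of_nat (K + 1) * (of_int m gchoose (K + 1))) (Y v (s - of_int m + of_nat (K + 1)) k u)"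
    by (simp add: Y_scale mult.commute)
  finally show ?case
    unfolding Y_create ad_dress[OF truncated_Y] main by simp
qed

text \<open>The summand with \<open>dress (K + 1)\<close> in the product rule is the image of the
  commutator of \<open>L(-1)\<close> with \<open>h(-K-1)\<close>, namely
  \<open>(K + 1) h(-K-2)\<close>.\<close>

lemma Y_deriv: "ls_deriv s3 (Y v) s k u = Y (W1.virasoro v) s k u"
proof (induction v arbitrary: s k u rule: W1.fock_induct)
  case (add v v')
  have "ls_deriv s3 (Y (v + v')) s k u = ls_deriv s3 (Y v) s k u + ls_deriv s3 (Y v') s k u"
    by (simp add: ls_deriv_def Y_add W3.F.scale_right_distrib)
  then show ?case by (simp only: add W1.virasoro_add Y_add[of "W1.virasoro v"])
next
  case (vac w)
  show ?case by (simp add: W1.virasoro_vac Y_create Y_vac base_deriv)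
next
  case (create K v)
  let ?Z = "\<lambda>s. Y v s k" and ?L = "\<lambda>s. Y v s (k + 1)"
  let ?D = "\<lambda>s u. s3 (of_nat k + 1) (?L (s + 1) u)"
  have Y_create': "(\<lambda>s. Y (fock_create K v) s k) = dress K (\<lambda>s. Y v s k)" for k
    by (intro ext) (rule Y_create)
  have truncatedD: "truncated ?D" by (rule truncated_scale[OF truncated_shift[OF truncated_Y]])
  have "ls_deriv s3 (Y (fock_create K v)) s k u =
      shift_deriv (\<lambda>s. Y (fock_create K v) s k) s u + s3 (of_nat k + 1) (Y (fock_create K v) (s + 1) (k + 1) u)"
    by (simp add: ls_deriv_def shift_deriv_def)
  also have "Y (fock_create K v) (s + 1) (k + 1) u = dress K (\<lambda>s. ?L (s + 1)) s u"
    unfolding Y_create dress_def hop_shift[of _ _ _ ?L] ..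
  also have "s3 (of_nat k + 1) (dress K (\<lambda>s. ?L (s + 1)) s u) = dress K ?D s u"
    by (simp only: dress_scale[OF truncated_shift[OF truncated_Y]])
  also have "shift_deriv (\<lambda>s. Y (fock_create K v) s k) s u =
      dress K (shift_deriv ?Z) s u + s3 (of_nat (K + 1)) (dress (K + 1) ?Z s u)"
    unfolding Y_create' by (rule shift_deriv_dress[OF truncated_Y])
  also have "dress K (shift_deriv ?Z) s u + s3 (of_nat (K + 1)) (dress (K + 1) ?Z s u) + dress K ?D s u =
      dress K (\<lambda>s u. shift_deriv ?Z s u + ?D s u) s u + s3 (of_nat (K + 1)) (dress (K + 1) ?Z s u)"
    by (simp only: dress_add[OF truncated_shift_deriv[OF truncated_Y] truncatedD]) simp
  also have "(\<lambda>s u. shift_deriv ?Z s u + ?D s u) = (\<lambda>s. Y (W1.virasoro v) s k)"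
    unfolding create[symmetric] by (simp add: ls_deriv_def shift_deriv_def fun_eq_iff)
  finally show ?case
    by (simp add: W1.virasoro_create Y_add Y_scale Y_create add.commute)
qed

lemma jacobi_setting_Y:
  "jacobi_setting s1 s2 s3 (\<lambda>w q. Y w (c - of_int q) k)"
proof
  fix w
  have "\<exists>N. \<forall>n\<ge>N. Y w (c - of_int n) k u = 0" for u
  proof -
    obtain N where N: "\<forall>s. Re s < N \<longrightarrow> Y w s k u = 0" using truncated_Y[of w k] unfolding truncated_def by blast
    have "Y w (c - of_int n) k u = 0" if "n \<ge> \<lfloor>Re c - N\<rfloor> + 1" for n
    proof -
      have "Re c - N < of_int n" using that by linarith
      then show ?thesis using N by simp
    qed
    then show ?thesis by blast
  qed
  then show "int_field s2 s3 (\<lambda>q. Y w (c - of_int q) k)"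
    using truncated_linear[OF truncated_Y] by (simp add: int_field_def)
qed (simp_all add: Y_add Y_scale)

lemma jacobi_heis:
  "jacobi_setting.jacobi s1 s2 s3 (\<lambda>w q. Y w (c - of_int q) k) W3.H W2.H W1.H"
proof -
  interpret J: jacobi_setting s1 s2 s3 "\<lambda>w q. Y w (c - of_int q) k"
    by (rule jacobi_setting_Y)
  show ?thesis
  proof (rule J.jacobiI[OF W3.heis_field W2.heis_field W1.heis_field])
    fix m n w u
    have sb0: "schoose 0 i = (if i = 0 then 1 else 0)" for i
      by (simp add: schoose_def gbinomial_0_left)
    have "J.left_sum W3.H 0 m n w u = W3.H m (Y w (c - of_int n) k u)"
      unfolding J.left_sum_def by (subst Sum_any.expand_superset[of "{0}"]) (auto simp: sb0)
    moreover have "J.mid_sum W2.H 0 m n w u = Y w (c - of_int n) k (W2.H m u)"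
      unfolding J.mid_sum_def by (subst Sum_any.expand_superset[of "{0}"]) (auto simp: sb0)
    moreover have "J.right_sum W1.H 0 m n w u = ad m (\<lambda>s. Y w s k) (c - of_int n) u"
      unfolding J.right_sum_def Y_ad by (simp add: algebra_simps)
    ultimately show "J.left_sum W3.H 0 m n w u - J.mid_sum W2.H 0 m n w u = J.right_sum W1.H 0 m n w u"
      by (simp add: ad_def)
  next
    fix l n :: int and w u assume l: "l < 0"
    define K where "K = nat (- l - 1)"
    have K: "l = - int K - 1" using l by (simp add: K_def)
    have "J.right_sum W1.H l 0 n w u = Y (W1.H l w) (c - of_int n) k u"
      unfolding J.right_sum_def by (subst Sum_any.expand_superset[of "{0}"]) (auto simp: gbinomial_0_left)
    also have "\<dots> = dress K (\<lambda>s. Y w s k) (c - of_int n) u"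
      by (simp only: K W1.heis_create Y_create)
    also have "\<dots> = J.left_sum W3.H l 0 n w u - J.mid_sum W2.H l 0 n w u"
    proof -
      \<comment> \<open>Since \<open>i choose K\<close> vanishes for \<open>i < K\<close>, the sum
        starts at \<open>K\<close>; the shifted coefficients are those of
        \<open>(1 - y)^(-K-1)\<close>.\<close>
      have "hleft (\<lambda>i. of_nat (i choose K)) (int K + 1) (\<lambda>s. Y w s k) (c - of_int n) u =
          Sum_any (\<lambda>r. s3 (of_nat ((K + r) choose K)) (W3.H (- int (K + r) - 1)
            (Y w (c - of_int n + of_int (int K + 1) - 1 - of_nat (K + r)) k u)))"
        unfolding hleft_def
      proof (rule Sum_any_reindex_inj)
        show "inj (\<lambda>r. K + r)" by (auto simp: inj_def)
        fix x assume "x \<notin> range (\<lambda>r. K + r)"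
        then have "x < K" by (metis le_add_diff_inverse not_less rangeI)
        then show "s3 (of_nat (x choose K)) (W3.H (- int x - 1)
            (Y w (c - of_int n + of_int (int K + 1) - 1 - of_nat x) k u)) = 0" by simp
      qed
      also have "\<dots> = J.left_sum W3.H l 0 n w u"
      proof -
        have "- int (K + r) - 1 = 0 + (- int K - 1) - int r"
          "c - of_int n + of_int (int K + 1) - 1 - of_nat (K + r) = c - of_int (n + int r)" for r
          by simp_all
        then show ?thesis unfolding J.left_sum_def K schoose_minus by (simp only:)
      qed
      finally have 1: "hleft (\<lambda>i. of_nat (i choose K)) (int K + 1) (\<lambda>s. Y w s k) (c - of_int n) u = \<dots>" .
      have fin: "finite {r. s3 (a r) (Y w (q r) k (W2.H (int r) u)) \<noteq> 0}" for a q
        by (rule finite_right[OF truncated_Y])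
      have "(-1 :: complex) powi (- int K - 1) = - ((-1) ^ K)"
        by (simp add: power_int_def nat_add_distrib)
      then have "J.mid_sum W2.H l 0 n w u = Sum_any (\<lambda>r. - s3 ((-1) ^ K * of_nat ((K + r) choose K))
          (Y w (c - of_int n + of_int (int K + 1) + of_nat r) k (W2.H (int r) u)))"
        unfolding J.mid_sum_def K schoose_minus by (simp add: algebra_simps)
      also have "\<dots> = - hright (\<lambda>i. (-1) ^ K * of_nat ((K + i) choose K)) (int K + 1) (\<lambda>s. Y w s k) (c - of_int n) u"
        unfolding hright_def by (rule Sum_any_additive[symmetric, OF fin]) simp_all
      finally show ?thesis using 1 by (simp add: dress_def hop_def)
    qed
    finally show "J.left_sum W3.H l 0 n w u - J.mid_sum W2.H l 0 n w u = J.right_sum W1.H l 0 n w u" ..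
  qed
qed

lemma jacobi_fock_vertex:
  "jacobi_setting.jacobi s1 s2 s3 (\<lambda>w q. Y w (c - of_int q) k)
    (fock_vertex sc3 h03 v) (fock_vertex sc2 h02 v) (fock_vertex sc h0 v)"
proof -
  interpret J: jacobi_setting s1 s2 s3 "\<lambda>w q. Y w (c - of_int q) k"
    by (rule jacobi_setting_Y)
  have deriv: "J.jacobi ((field_deriv s3 ^^ i) W3.H) ((field_deriv s2 ^^ i) W2.H)
      ((field_deriv s1 ^^ i) W1.H)" for i
    by (induction i) (simp_all add: jacobi_heis J.jacobi_deriv)
  have "J.jacobi
      (foldr (\<lambda>i. normal_product (\<lambda>n u. s3 (1 / fact i) ((field_deriv s3 ^^ i) W3.H n u))) xs (\<lambda>n u. u when n = -1))
      (foldr (\<lambda>i. normal_product (\<lambda>n u. s2 (1 / fact i) ((field_deriv s2 ^^ i) W2.H n u))) xs (\<lambda>n u. u when n = -1))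
      (foldr (\<lambda>i. normal_product (\<lambda>n u. s1 (1 / fact i) ((field_deriv s1 ^^ i) W1.H n u))) xs (\<lambda>n u. u when n = -1))" for xs
  proof (induction xs)
    case (Cons x xs)
    show ?case
      unfolding foldr.simps o_def by (rule J.jacobi_normal_product[OF J.jacobi_scale[OF deriv] Cons])
  qed (simp add: J.jacobi_id)
  then have mon: "J.jacobi (monomial_vertex sc3 h03 \<mu>) (monomial_vertex sc2 h02 \<mu>) (monomial_vertex sc h0 \<mu>)" for \<mu>
    unfolding monomial_vertex_def .
  show ?thesis
    unfolding fock_vertex_def by (rule J.jacobi_sum[OF finite_keys J.jacobi_scale[OF mon]])
qed

lemma log_intertwining:
  assumes "p \<ge> 1"
  shows "log_intertwining_operator V (omega p)
    (fock_module sc3 h03) (fock_module sc h0) (fock_module sc2 h02) Y"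
proof -
  have logs: "\<exists>K. \<forall>k>K. \<forall>s u. Y w s k u = 0" for w
  proof -
    obtain K where K: "\<forall>w s u. \<forall>k>K. base w s k u = 0" using base_logs by blast
    have "Ylist xs w k s u = 0" if "k > K" for xs w k s u
    proof -
      have "Ylist xs w k = (\<lambda>s u. 0)"
      proof (induction xs)
        case (Cons x xs)
        have "Ylist (x # xs) w k = dress x (Ylist xs w k)" by (simp add: Ylist_def)
        then show ?case unfolding Cons by (simp add: dress_def hop_zero fun_eq_iff)
      qed (use K that in \<open>simp add: Ylist_def fun_eq_iff\<close>)
      then show ?thesis by simp
    qed
    then show ?thesis by (intro exI[of _ K]) (simp add: Y_def)
  qed
  moreover have "\<exists>N. \<forall>s k. Re s < N \<longrightarrow> Y w s k u = 0" for w u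
  proof -
    \<comment> \<open>The bound so far depends on the power of the logarithm; only the powers up to
      \<open>K\<close> occur, so a minimum can be taken.\<close>
    obtain K where K: "\<forall>k>K. \<forall>s u. Y w s k u = 0" using logs by blast
    have "\<forall>k. \<exists>N. \<forall>s. Re s < N \<longrightarrow> Y w s k u = 0" using truncated_Y[of w] unfolding truncated_def by blast
    from choice[OF this] obtain N where N: "\<forall>k. \<forall>s. Re s < N k \<longrightarrow> Y w s k u = 0" ..
    have "Y w s k u = 0" if "Re s < Min (N ` {..K})" for s k
    proof (cases "k \<le> K")
      case True
      then have "Re s < N k" using that by simp
      then show ?thesis using N by blast
    qed (use K in simp)
    then show ?thesis by blast
  qed
  moreover have "Y (fock_vertex sc h0 (omega p) 0 w) = ls_deriv s3 (Y w)" for w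
    by (intro ext) (simp add: W1.omega_0_eq_virasoro[OF assms] Y_deriv)
  moreover have "Sum_any (\<lambda>i. s3 ((-1) ^ i * (of_int l gchoose i))
        (fock_vertex sc3 h03 v (m + l - int i) (Y w (- (n + of_nat i) - 1) k u))) -
      Sum_any (\<lambda>i. s3 ((-1) powi l * (-1) ^ i * (of_int l gchoose i))
        (Y w (- (n + of_int l - of_nat i) - 1) k (fock_vertex sc2 h02 v (m + int i) u))) =
      Sum_any (\<lambda>i. s3 (of_int m gchoose i)
        (Y (fock_vertex sc h0 v (l + int i) w) (- (of_int m + n - of_nat i) - 1) k u))" for v w u l m n k
  proof -
    \<comment> \<open>The coset is anchored at \<open>- n - 1\<close>, so that the complex index
      \<open>n\<close> of the Jacobi identity becomes the integer 0.\<close>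
    interpret J: jacobi_setting s1 s2 s3 "\<lambda>w q. Y w (- n - 1 - of_int q) k"
      by (rule jacobi_setting_Y)
    have "J.left_sum (fock_vertex sc3 h03 v) l m 0 w u - J.mid_sum (fock_vertex sc2 h02 v) l m 0 w u =
        J.right_sum (fock_vertex sc h0 v) l m 0 w u"
      using J.jacobiD[OF jacobi_fock_vertex, of v l m 0 w u] by simp
    then show ?thesis
      unfolding J.left_sum_def J.mid_sum_def J.right_sum_def schoose_def by (simp add: algebra_simps)
  qed
  ultimately show ?thesis
    unfolding log_intertwining_operator_def fock_module_def vmodule.simps
    using Y_linear truncated_linear[OF truncated_Y] by blast
qed

end

section \<open>Exponential series\<close>

lemma ls_int_of_int: "ls_int c (of_int e) 0 u = c e u"
  by (simp add: ls_int_def)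

lemma ls_int_mult:
  assumes "\<And>e. c e 0 = 0"
  shows "(ls_int c \<odot> B) s k u = Sum_any (\<lambda>e. c e (B (s - of_int e) k u))"
proof -
  let ?f = "\<lambda>(t, j). ls_int c (s - t) (k - j) (B t j u) when j \<le> k"
  have "Sum_any ?f = Sum_any (\<lambda>e. ?f (s - of_int e, k))"
  proof (rule Sum_any_reindex_inj)
    show "inj (\<lambda>e. (s - complex_of_int e, k))" by (auto simp: inj_def)
    fix x assume x: "x \<notin> range (\<lambda>e. (s - complex_of_int e, k))"
    obtain t j where tj: "x = (t, j)" by (cases x)
    show "?f x = 0"
    proof (rule ccontr)
      assume "?f x \<noteq> 0"
      then have "s - t \<in> \<int>" "k = j" by (auto simp: tj ls_int_def when_def split: if_splits)
      then obtain e where "s - t = of_int e" by (auto elim: Ints_cases)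
      then have "x = (s - of_int e, k)" using \<open>k = j\<close> tj by (simp add: algebra_simps)
      then show False using x by blast
    qed
  qed
  then show ?thesis by (simp add: ls_mult_def ls_int_of_int)
qed

lemma ls_const_mult:
  assumes "f 0 = 0"
  shows "(ls_const f \<odot> B) s k u = f (B s k u)"
proof -
  have "ls_const f = ls_int (\<lambda>e u. f u when e = 0)"
    by (auto simp: fun_eq_iff ls_const_def ls_int_def when_def elim!: Ints_cases)
  then have "(ls_const f \<odot> B) s k u = Sum_any (\<lambda>e. f (B (s - of_int e) k u) when e = 0)"
    using ls_int_mult[of "\<lambda>e u. f u when e = 0" B s k u] by (simp add: assms)
  also have "\<dots> = f (B s k u)"
    by (subst Sum_any.expand_superset[of "{0}"]) (auto simp: when_def)
  finally show ?thesis .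
qed

lemma Sum_any_triangle:
  fixes f :: "nat \<Rightarrow> nat \<Rightarrow> 'a::comm_monoid_add"
  assumes "finite {(i, j). f i j \<noteq> 0}"
  shows "Sum_any (\<lambda>i. \<Sum>j<i. f (i - Suc j) j) = Sum_any (\<lambda>j. Sum_any (\<lambda>i. f i j))"
proof -
  let ?g = "\<lambda>i j. f (i - Suc j) j when j < i"
  have "{(i, j). ?g i j \<noteq> 0} \<subseteq> (\<lambda>(i, j). (i + Suc j, j)) ` {(i, j). f i j \<noteq> 0}"
  proof
    fix x assume "x \<in> {(i, j). ?g i j \<noteq> 0}"
    then obtain i j where "x = (i, j)" "j < i" "f (i - Suc j) j \<noteq> 0" by auto
    then show "x \<in> (\<lambda>(i, j). (i + Suc j, j)) ` {(i, j). f i j \<noteq> 0}"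
      by (intro image_eqI[of _ _ "(i - Suc j, j)"]) auto
  qed
  then have fin: "finite {(i, j). ?g i j \<noteq> 0}" using assms by (meson finite_imageI finite_subset)
  have "Sum_any (?g i) = (\<Sum>j<i. f (i - Suc j) j)" for i
    by (subst Sum_any.expand_superset[of "{..<i}"]) auto
  moreover have "Sum_any (\<lambda>i. ?g i j) = Sum_any (\<lambda>i. f i j)" for j
  proof -
    have "Sum_any (\<lambda>i. ?g i j) = Sum_any (\<lambda>i. ?g (i + Suc j) j)"
    proof (rule Sum_any_reindex_inj)
      fix x assume "x \<notin> range (\<lambda>i. i + Suc j)"
      then have "x < Suc j" by (metis add.commute le_add_diff_inverse not_less rangeI)
      then show "?g x j = 0" by simp
    qed (auto simp: inj_def)
    then show ?thesis by simp
  qed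
  ultimately show ?thesis using Sum_any_swap[OF fin] by simp
qed

locale exp_family = vector_space S for S :: "complex \<Rightarrow> 'u::ab_group_add \<Rightarrow> 'u" +
  fixes g :: "nat \<Rightarrow> 'u \<Rightarrow> 'u"
  assumes g_linear: "Vector_Spaces.linear S S (g i)"
    and g_comm: "g i (g j u) = g j (g i u)"
begin

text \<open>\<open>P n e\<close> is the coefficient of \<open>y^e\<close> in the \<open>n\<close>-th
  power of the series with terms \<open>g i y^(i+1)\<close>.\<close>

fun P :: "nat \<Rightarrow> nat \<Rightarrow> 'u \<Rightarrow> 'u"
  where "P 0 e u = (u when e = 0)"
  | "P (Suc n) e u = (\<Sum>i<e. g i (P n (e - Suc i) u))"

text \<open>The exponentiated series has no constant term, so powers above \<open>e\<close> do not
  reach \<open>y^e\<close> and the sum may stop there.\<close>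

definition X :: "nat \<Rightarrow> 'u \<Rightarrow> 'u"
  where "X e u = (\<Sum>n\<le>e. S (1 / fact n) (P n e u))"

lemma g_0 [simp]: "g i 0 = 0"
  by (rule linear_0[OF g_linear])

lemma g_sum: "g i (sum f K) = (\<Sum>k\<in>K. g i (f k))"
  by (induction K rule: infinite_finite_induct) (simp_all add: linear_add[OF g_linear])

lemma P_eq_0: "e < n \<Longrightarrow> P n e u = 0"
  by (induction n arbitrary: e) (auto intro!: sum.neutral)

lemma sum_triangle_swap:
  "(\<Sum>i<e. \<Sum>j<e - Suc i. f i j) = (\<Sum>j<e. \<Sum>i<e - Suc j. (f i j :: 'u))" for e :: nat
proof -
  have "{..<e - Suc i} = {j \<in> {..<e}. i + j + 1 < e}" "{..<e - Suc j} = {i \<in> {..<e}. i + j + 1 < e}" for i j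
    by auto
  then show ?thesis using sum.swap_restrict[of "{..<e}" "{..<e}" f "\<lambda>i j. i + j + 1 < e"] by simp
qed

text \<open>Coefficientwise, \<open>y d/dy A^(n+1) = (n + 1) (y A') A^n\<close>, which requires the
  coefficients of \<open>A\<close> to commute.\<close>

lemma P_deriv:
  "S (of_nat e) (P (Suc n) e u) = S (of_nat (Suc n)) (\<Sum>i<e. S (of_nat (Suc i)) (g i (P n (e - Suc i) u)))"
proof (induction n arbitrary: e)
  case 0
  have "S (of_nat e) (P (Suc 0) e u) = (\<Sum>i<e. S (of_nat e) (g i (u when e - Suc i = 0)))"
    by (simp add: scale_sum_right)
  also have "\<dots> = (\<Sum>i<e. S (of_nat (Suc i)) (g i (u when e - Suc i = 0)))"
  proof (rule sum.cong[OF refl])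
    fix i assume "i \<in> {..<e}"
    then show "S (of_nat e) (g i (u when e - Suc i = 0)) = S (of_nat (Suc i)) (g i (u when e - Suc i = 0))"
      by (cases "e = Suc i") auto
  qed
  finally show ?case by (simp del: of_nat_Suc add: of_nat_Suc[of 0])
next
  case (Suc n)
  have "S (of_nat e) (P (Suc (Suc n)) e u) = (\<Sum>i<e. S (of_nat e) (g i (P (Suc n) (e - Suc i) u)))"
    by (simp only: P.simps(2)[of "Suc n"] scale_sum_right)
  also have "\<dots> = (\<Sum>i<e. S (of_nat (Suc i)) (g i (P (Suc n) (e - Suc i) u)) +
      g i (S (of_nat (e - Suc i)) (P (Suc n) (e - Suc i) u)))"
  proof (rule sum.cong[OF refl])
    fix i assume "i \<in> {..<e}"
    then have "of_nat e = (of_nat (Suc i) + of_nat (e - Suc i) :: complex)"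
      by (simp flip: of_nat_add)
    then show "S (of_nat e) (g i (P (Suc n) (e - Suc i) u)) = S (of_nat (Suc i)) (g i (P (Suc n) (e - Suc i) u)) +
      g i (S (of_nat (e - Suc i)) (P (Suc n) (e - Suc i) u))"
      by (simp only: linear_scale[OF g_linear] scale_left_distrib)
  qed
  also have "\<dots> = (\<Sum>i<e. S (of_nat (Suc i)) (g i (P (Suc n) (e - Suc i) u))) +
      (\<Sum>i<e. \<Sum>j<e - Suc i. S (of_nat (Suc n)) (S (of_nat (Suc j)) (g i (g j (P n (e - Suc i - Suc j) u)))))"
    unfolding Suc sum.distrib linear_scale[OF g_linear] g_sum scale_sum_right ..
  also have "(\<Sum>i<e. \<Sum>j<e - Suc i. S (of_nat (Suc n)) (S (of_nat (Suc j)) (g i (g j (P n (e - Suc i - Suc j) u))))) =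
      (\<Sum>j<e. \<Sum>i<e - Suc j. S (of_nat (Suc n)) (S (of_nat (Suc j)) (g j (g i (P n (e - Suc j - Suc i) u)))))"
  proof (subst sum_triangle_swap, intro sum.cong refl)
    fix i j
    have "e - Suc i - Suc j = e - Suc j - Suc i" by simp
    then show "S (of_nat (Suc n)) (S (of_nat (Suc j)) (g i (g j (P n (e - Suc i - Suc j) u)))) =
        S (of_nat (Suc n)) (S (of_nat (Suc j)) (g j (g i (P n (e - Suc j - Suc i) u))))"
      by (simp only: g_comm[of i j])
  qed
  also have "\<dots> = S (of_nat (Suc n)) (\<Sum>j<e. S (of_nat (Suc j)) (g j (P (Suc n) (e - Suc j) u)))"
    by (simp only: P.simps(2) g_sum scale_sum_right)
  finally show ?case
    by (simp only: of_nat_Suc[of "Suc n"] scale_left_distrib scale_one)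
qed

lemma X_0 [simp]: "X 0 u = u"
  by (simp add: X_def)

text \<open>
  The coefficients of \<open>exp A\<close> with \<open>A(y) = \<Sum> g\<^sub>i y\<^sup>i\<^sup>+\<^sup>1\<close>, from \<open>y d/dy exp A = (y A') exp A\<close>; the index of \<open>g\<close> is shifted
  by one.
\<close>

lemma X_deriv: "S (of_nat e) (X e u) = (\<Sum>i<e. S (of_nat (Suc i)) (g i (X (e - Suc i) u)))"
proof (cases e)
  case (Suc e')
  have f: "1 / fact (Suc n) * (of_nat (Suc n) :: complex) = 1 / fact n" for n
    by (simp add: field_simps del: of_nat_Suc)
  have "S (of_nat e) (X e u) = (\<Sum>n\<le>e. S (1 / fact n) (S (of_nat e) (P n e u)))"
    unfolding X_def scale_sum_right by (simp only: scale_left_commute)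
  also have "\<dots> = (\<Sum>n<e. S (1 / fact (Suc n)) (S (of_nat e) (P (Suc n) e u)))"
    unfolding Suc lessThan_Suc_atMost by (subst sum.atMost_Suc_shift) simp
  also have "\<dots> = (\<Sum>n<e. \<Sum>i<e. S (1 / fact n) (S (of_nat (Suc i)) (g i (P n (e - Suc i) u))))"
    unfolding P_deriv by (simp only: scale_scale f) (simp only: scale_sum_right scale_scale)
  also have "\<dots> = (\<Sum>i<e. \<Sum>n<e. S (of_nat (Suc i)) (g i (S (1 / fact n) (P n (e - Suc i) u))))"
    by (subst sum.swap) (simp only: scale_left_commute linear_scale[OF g_linear])
  also have "\<dots> = (\<Sum>i<e. S (of_nat (Suc i)) (g i (X (e - Suc i) u)))"
  proof (rule sum.cong[OF refl])
    fix i assume "i \<in> {..<e}"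
    then have "{..e - Suc i} \<subseteq> {..<e}" by auto
    then have "(\<Sum>n<e. S (1 / fact n) (P n (e - Suc i) u)) = X (e - Suc i) u"
      unfolding X_def by (intro sum.mono_neutral_right) (auto simp: P_eq_0)
    then show "(\<Sum>n<e. S (of_nat (Suc i)) (g i (S (1 / fact n) (P n (e - Suc i) u)))) =
        S (of_nat (Suc i)) (g i (X (e - Suc i) u))"
      by (simp only: flip: g_sum scale_sum_right)
  qed
  finally show ?thesis .
qed simp

lemma X_linear: "Vector_Spaces.linear S S (X e)"
proof -
  have add: "P n e (u + v) = P n e u + P n e v" for n e u v
    by (induction n arbitrary: e) (auto simp: linear_add[OF g_linear] sum.distrib when_def)
  have sc: "P n e (S c u) = S c (P n e u)" for n e c u
    by (induction n arbitrary: e) (auto simp: linear_scale[OF g_linear] scale_sum_right when_def)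
  show ?thesis
    by (rule linearI[OF vector_space_axioms vector_space_axioms])
      (simp_all add: X_def add sc scale_right_distrib sum.distrib scale_sum_right mult.commute)
qed

lemma X_zero [simp]: "X e 0 = 0"
  by (rule linear_0[OF X_linear])

text \<open>If the commutator of \<open>h\<close> with \<open>A(y)\<close> is the scalar
  \<open>c y^m\<close>, then that with \<open>exp A\<close> is \<open>c y^m exp A\<close>. Instead
  of expanding powers, the recursion \<open>X_deriv\<close> is used, in which \<open>X e\<close> is
  determined by lower coefficients for \<open>e > 0\<close>.\<close>

lemma commutator_X:
  assumes h: "Vector_Spaces.linear S S h"
    and comm: "\<And>i u. h (g i u) - g i (h u) = S (c when Suc i = m) u"
  shows "h (X e u) - X e (h u) = (S c (X (e - m) u) when m > 0 \<and> m \<le> e)"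
proof (induction e rule: less_induct)
  case (less e)
  show ?case
  proof (cases "e = 0")
    case False
    let ?D = "h (X e u) - X e (h u)"
    let ?t = "\<lambda>i. S (of_nat (Suc i)) (S (c when Suc i = m) (X (e - Suc i) u))"
    let ?r = "\<lambda>i. S (of_nat (Suc i)) (g i (S c (X (e - Suc i - m) u) when m > 0 \<and> m \<le> e - Suc i))"
    have hsum: "h (sum f K) = (\<Sum>k\<in>K. h (f k))" for f and K :: "nat set"
      by (induction K rule: infinite_finite_induct) (simp_all add: linear_add[OF h] linear_0[OF h])
    have "S (of_nat e) ?D = h (S (of_nat e) (X e u)) - S (of_nat e) (X e (h u))"
      by (simp only: scale_right_diff_distrib linear_scale[OF h])
    also have "\<dots> = (\<Sum>i<e. S (of_nat (Suc i)) (h (g i (X (e - Suc i) u))) -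
        S (of_nat (Suc i)) (g i (X (e - Suc i) (h u))))"
      by (simp only: X_deriv hsum linear_scale[OF h] sum_subtractf)
    also have "\<dots> = (\<Sum>i<e. ?t i + ?r i)"
    proof (rule sum.cong[OF refl])
      fix i assume "i \<in> {..<e}"
      then have IH: "h (X (e - Suc i) u) = X (e - Suc i) (h u) + (S c (X (e - Suc i - m) u) when m > 0 \<and> m \<le> e - Suc i)"
        using less[of "e - Suc i"] by (simp add: algebra_simps)
      have "h (g i v) = g i (h v) + S (c when Suc i = m) v" for v
        using comm[of i v] by (simp add: algebra_simps)
      then show "S (of_nat (Suc i)) (h (g i (X (e - Suc i) u))) - S (of_nat (Suc i)) (g i (X (e - Suc i) (h u))) =
          ?t i + ?r i"
        unfolding IH by (simp only: IH linear_add[OF g_linear] scale_right_distrib) simp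
    qed
    also have "\<dots> = (\<Sum>i<e. ?t i) + (\<Sum>i<e. ?r i)" by (rule sum.distrib)
    also have "(\<Sum>i<e. ?t i) = (S (of_nat m * c) (X (e - m) u) when m > 0 \<and> m \<le> e)"
    proof (cases "m > 0 \<and> m \<le> e")
      case True
      then have "(\<Sum>i<e. ?t i) = (\<Sum>i\<in>{m - 1}. ?t i)"
        by (intro sum.mono_neutral_right) (auto simp: when_def split: if_splits)
      then show ?thesis using True by simp
    qed (auto intro!: sum.neutral simp: when_def)
    also have "(\<Sum>i<e. ?r i) = (S (of_nat (e - m) * c) (X (e - m) u) when m > 0 \<and> m \<le> e)"
    proof (cases "m > 0 \<and> m \<le> e")
      case True
      have "(\<Sum>i<e. ?r i) = (\<Sum>i<e - m. ?r i)"
        using True by (intro sum.mono_neutral_right) (auto simp: when_def)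
      also have "\<dots> = (\<Sum>i<e - m. S c (S (of_nat (Suc i)) (g i (X (e - m - Suc i) u))))"
        using True by (intro sum.cong refl) (auto simp: linear_scale[OF g_linear] mult.commute add.commute simp del: of_nat_Suc)
      also have "\<dots> = S c (S (of_nat (e - m)) (X (e - m) u))"
        by (simp only: X_deriv scale_sum_right)
      finally show ?thesis using True by (simp add: mult.commute)
    qed (auto intro!: sum.neutral simp: when_def)
    \<comment> \<open>The two sums carry the weights \<open>m\<close> and \<open>e - m\<close>;
      together they give the factor \<open>e\<close>, which can be cancelled.\<close>
    finally have "S (of_nat e) ?D = S (of_nat e) (S c (X (e - m) u) when m > 0 \<and> m \<le> e)"
      by (auto simp: when_def of_nat_diff algebra_simps simp flip: scale_left_distrib)
    then show ?thesis using False by (simp only: scale_cancel_left) simp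
  qed (auto simp: when_def)
qed

text \<open>The sign \<open>\<sigma>\<close> handles \<open>E^-\<close> and \<open>E^+\<close>
  together: with \<open>y = x^\<sigma>\<close> both exponents are power series in \<open>y\<close>
  without constant term.\<close>

lemma ls_power_eq:
  assumes \<sigma>: "\<sigma> = 1 \<or> \<sigma> = (-1 :: int)"
  shows "ls_power (ls_int (\<lambda>e u. g (nat (\<sigma> * e) - 1) u when \<sigma> * e > 0)) n =
    ls_int (\<lambda>e u. P n (nat (\<sigma> * e)) u when \<sigma> * e \<ge> 0)" (is "ls_power ?A n = _")
proof (induction n)
  case 0
  show ?case
    using \<sigma> by (auto simp: fun_eq_iff ls_const_def ls_int_def when_def elim!: Ints_cases)
next
  case (Suc n)
  show ?case
  proof (intro ext)
    fix s k u
    let ?d = "\<lambda>e u. P n (nat (\<sigma> * e)) u when \<sigma> * e \<ge> 0"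
    let ?f = "\<lambda>e. g (nat (\<sigma> * e) - 1) (ls_int ?d (s - of_int e) k u) when \<sigma> * e > 0"
    have \<sigma>2: "\<sigma> * (\<sigma> * x) = x" for x using \<sigma> by auto
    have "ls_power ?A (Suc n) s k u = Sum_any ?f"
      unfolding ls_power.simps Suc by (rule ls_int_mult) simp
    also have "\<dots> = Sum_any (\<lambda>i. ?f (\<sigma> * (int i + 1)))"
    proof (rule Sum_any_reindex_inj)
      show "inj (\<lambda>i. \<sigma> * (int i + 1))" using \<sigma> by (auto simp: inj_def)
      fix x assume x: "x \<notin> range (\<lambda>i. \<sigma> * (int i + 1))"
      show "?f x = 0"
      proof (cases "\<sigma> * x > 0")
        case True
        then have "x = \<sigma> * (int (nat (\<sigma> * x - 1)) + 1)" by (simp add: \<sigma>2)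
        then show ?thesis using x by blast
      qed simp
    qed
    also have "\<dots> = Sum_any (\<lambda>i. g i (ls_int ?d (s - of_int (\<sigma> * (int i + 1))) k u))"
      by (simp add: \<sigma>2 nat_add_distrib)
    also have "\<dots> = ls_int (\<lambda>e u. P (Suc n) (nat (\<sigma> * e)) u when \<sigma> * e \<ge> 0) s k u"
    proof (cases "s \<in> \<int> \<and> k = 0")
      case True
      then obtain q where q: "s = of_int q" by (auto elim: Ints_cases)
      have "ls_int ?d (s - of_int (\<sigma> * (int i + 1))) k u = (P n (nat (\<sigma> * q) - Suc i) u when int i < \<sigma> * q)" for i
      proof -
        have "ls_int ?d (of_int (q - \<sigma> * (int i + 1))) 0 u = ?d (q - \<sigma> * (int i + 1)) u"
          by (rule ls_int_of_int)
        moreover have "\<sigma> * (q - \<sigma> * (int i + 1)) = \<sigma> * q - (int i + 1)" by (simp only: right_diff_distrib \<sigma>2)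
        moreover have "nat (\<sigma> * q - (int i + 1)) = nat (\<sigma> * q) - Suc i" by (simp add: nat_diff_distrib')
        ultimately show ?thesis using True by (simp add: q when_def)
      qed
      then have "Sum_any (\<lambda>i. g i (ls_int ?d (s - of_int (\<sigma> * (int i + 1))) k u)) =
          Sum_any (\<lambda>i. g i (P n (nat (\<sigma> * q) - Suc i) u when int i < \<sigma> * q))" by simp
      also have "\<dots> = (\<Sum>i<nat (\<sigma> * q). g i (P n (nat (\<sigma> * q) - Suc i) u when int i < \<sigma> * q))"
        by (rule Sum_any.expand_superset) (auto simp: when_def zless_nat_eq_int_zless split: if_splits)
      also have "\<dots> = P (Suc n) (nat (\<sigma> * q)) u"
        by (auto intro!: sum.cong simp: zless_nat_eq_int_zless)
      finally show ?thesis using True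
        by (cases "\<sigma> * q \<ge> 0") (simp_all add: q ls_int_def)
    next
      case False
      moreover have "s - of_int e \<in> \<int> \<longleftrightarrow> s \<in> \<int>" for e
        by (metis Ints_diff Ints_add Ints_of_int diff_add_cancel)
      ultimately show ?thesis by (auto simp: ls_int_def)
    qed
    finally show "ls_power ?A (Suc n) s k u = ls_int (\<lambda>e u. P (Suc n) (nat (\<sigma> * e)) u when \<sigma> * e \<ge> 0) s k u" .
  qed
qed

lemma ls_exp_eq:
  assumes \<sigma>: "\<sigma> = 1 \<or> \<sigma> = (-1 :: int)"
  shows "ls_exp S (ls_int (\<lambda>e u. g (nat (\<sigma> * e) - 1) u when \<sigma> * e > 0)) =
    ls_int (\<lambda>e u. X (nat (\<sigma> * e)) u when \<sigma> * e \<ge> 0)"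
proof (intro ext)
  fix s k u
  have "ls_exp S (ls_int (\<lambda>e u. g (nat (\<sigma> * e) - 1) u when \<sigma> * e > 0)) s k u =
      Sum_any (\<lambda>n. S (1 / fact n) (ls_int (\<lambda>e u. P n (nat (\<sigma> * e)) u when \<sigma> * e \<ge> 0) s k u))"
    by (simp only: ls_exp_def ls_power_eq[OF \<sigma>])
  also have "\<dots> = ls_int (\<lambda>e u. X (nat (\<sigma> * e)) u when \<sigma> * e \<ge> 0) s k u"
  proof (cases "s \<in> \<int> \<and> k = 0 \<and> \<sigma> * \<lfloor>Re s\<rfloor> \<ge> 0")
    case True
    have "Sum_any (\<lambda>n. S (1 / fact n) (P n (nat (\<sigma> * \<lfloor>Re s\<rfloor>)) u)) = X (nat (\<sigma> * \<lfloor>Re s\<rfloor>)) u"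
      unfolding X_def by (rule Sum_any.expand_superset) (auto simp: P_eq_0 not_less[symmetric])
    then show ?thesis using True by (simp add: ls_int_def)
  qed (auto simp: ls_int_def)
  finally show "ls_exp S (ls_int (\<lambda>e u. g (nat (\<sigma> * e) - 1) u when \<sigma> * e > 0)) s k u =
    ls_int (\<lambda>e u. X (nat (\<sigma> * e)) u when \<sigma> * e \<ge> 0) s k u" .
qed

lemma ls_exp_mult:
  assumes \<sigma>: "\<sigma> = 1 \<or> \<sigma> = (-1 :: int)"
  shows "(ls_exp S (ls_int (\<lambda>e u. g (nat (\<sigma> * e) - 1) u when \<sigma> * e > 0)) \<odot> B) s k u =
    Sum_any (\<lambda>i. X i (B (s - of_int (\<sigma> * int i)) k u))"
proof -
  let ?f = "\<lambda>e. X (nat (\<sigma> * e)) (B (s - of_int e) k u) when \<sigma> * e \<ge> 0"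
  have \<sigma>2: "\<sigma> * (\<sigma> * x) = x" for x using \<sigma> by auto
  have "Sum_any ?f = Sum_any (\<lambda>i. ?f (\<sigma> * int i))"
  proof (rule Sum_any_reindex_inj)
    show "inj (\<lambda>i. \<sigma> * int i)" using \<sigma> by (auto simp: inj_def)
    fix x assume x: "x \<notin> range (\<lambda>i. \<sigma> * int i)"
    show "?f x = 0"
    proof (cases "\<sigma> * x \<ge> 0")
      case True
      then have "x = \<sigma> * int (nat (\<sigma> * x))" by (simp add: \<sigma>2)
      then show ?thesis using x by blast
    qed simp
  qed
  then show ?thesis unfolding ls_exp_eq[OF \<sigma>] by (subst ls_int_mult) (simp_all add: \<sigma>2)
qed

end

section \<open>Exponentials of Heisenberg modes\<close>

context heis_pair
begin

text \<open>Left multiplication by the series with terms \<open>X i x^(\<sigma> i)\<close>;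
  \<open>locfin\<close> below is the support condition under which each coefficient is a finite
  sum.\<close>

definition expop :: "int \<Rightarrow> (nat \<Rightarrow> 'c \<Rightarrow> 'c) \<Rightarrow> (complex \<Rightarrow> 'b \<Rightarrow> 'c) \<Rightarrow> complex \<Rightarrow> 'b \<Rightarrow> 'c"
  where "expop \<sigma> X Z s u = Sum_any (\<lambda>i. X i (Z (s - of_int (\<sigma> * int i)) u))"

definition locfin :: "int \<Rightarrow> (complex \<Rightarrow> 'b \<Rightarrow> 'c) \<Rightarrow> bool"
  where "locfin \<sigma> Z \<longleftrightarrow> (\<forall>s u. finite {i::nat. Z (s - of_int (\<sigma> * int i)) u \<noteq> 0})"

context
  fixes X :: "nat \<Rightarrow> 'c \<Rightarrow> 'c" and Z :: "complex \<Rightarrow> 'b \<Rightarrow> 'c" and \<sigma> :: int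
  assumes X_linear: "\<And>i. Vector_Spaces.linear s3 s3 (X i)"
    and locfin: "locfin \<sigma> Z" and Z_linear: "\<And>s. Vector_Spaces.linear s2 s3 (Z s)"
begin

lemma expop_finite: "finite {i. X i (Z (s - of_int (\<sigma> * int i)) u) \<noteq> 0}"
proof (rule finite_nonzero_mono)
  show "finite {i::nat. Z (s - of_int (\<sigma> * int i)) u \<noteq> 0}" using locfin by (simp add: locfin_def)
qed (simp add: linear_0[OF X_linear])

lemma expop_finite': "finite {i. f i (X i (Z (s - of_int (\<sigma> * int i)) u)) \<noteq> 0}" if "\<And>i. f i 0 = 0"
  by (rule finite_nonzero_mono[OF expop_finite[of s u]]) (simp add: that)

lemma expop_linear: "Vector_Spaces.linear s2 s3 (expop \<sigma> X Z s)"
proof (rule linearI[OF V2.vector_space_axioms V3.vector_space_axioms])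
  show "expop \<sigma> X Z s (u + v) = expop \<sigma> X Z s u + expop \<sigma> X Z s v" for u v
    unfolding expop_def linear_add[OF Z_linear] linear_add[OF X_linear]
    by (rule Sum_any.distrib[OF expop_finite expop_finite])
  show "expop \<sigma> X Z s (s2 c u) = s3 c (expop \<sigma> X Z s u)" for c u
    unfolding expop_def linear_scale[OF Z_linear] linear_scale[OF X_linear]
    by (rule sum_scale[OF expop_finite, symmetric])
qed

lemma ad_expop:
  assumes comm: "\<And>e v. h3 m (X e v) - X e (h3 m v) = (s3 c (X (e - M) v) when M > 0 \<and> M \<le> e)"
  shows "ad m (expop \<sigma> X Z) s u =
    expop \<sigma> X (ad m Z) s u + (s3 c (expop \<sigma> X Z (s - of_int (\<sigma> * int M)) u) when M > 0)"
proof -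
  let ?z = "\<lambda>i. Z (s - of_int (\<sigma> * int i))"
  let ?r = "\<lambda>i. s3 c (X (i - M) (?z i u)) when M > 0 \<and> M \<le> i"
  have finr: "finite {i. ?r i \<noteq> 0}"
  proof (rule finite_nonzero_mono)
    show "finite {i::nat. ?z i u \<noteq> 0}" using locfin by (simp add: locfin_def)
  qed (simp add: linear_0[OF X_linear])
  have fina: "finite {i. X i (ad m Z (s - of_int (\<sigma> * int i)) u) \<noteq> 0}"
  proof (rule finite_nonzero_mono)
    have "finite ({i::nat. ?z i u \<noteq> 0} \<union> {i::nat. ?z i (h2 m u) \<noteq> 0})" using locfin by (simp add: locfin_def)
    then show "finite {i. ad m Z (s - of_int (\<sigma> * int i)) u \<noteq> 0}"
      by (rule rev_finite_subset) (auto simp: ad_def)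
  qed (simp add: linear_0[OF X_linear])
  have "ad m (expop \<sigma> X Z) s u =
      Sum_any (\<lambda>i. h3 m (X i (?z i u))) - Sum_any (\<lambda>i. X i (?z i (h2 m u)))"
    unfolding ad_def expop_def by (subst Sum_any_linear[OF expop_finite lin3]) simp
  also have "\<dots> = Sum_any (\<lambda>i. h3 m (X i (?z i u)) - X i (?z i (h2 m u)))"
    by (rule Sum_any_subtractf[symmetric, OF expop_finite'[of "\<lambda>_. h3 m"] expop_finite]) simp
  also have "\<dots> = Sum_any (\<lambda>i. X i (ad m Z (s - of_int (\<sigma> * int i)) u) + ?r i)"
  proof (rule Sum_any.cong)
    fix i
    have "h3 m (X i (?z i u)) = X i (h3 m (?z i u)) + ?r i"
      using comm[of i "?z i u"] by (simp add: algebra_simps)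
    then show "h3 m (X i (?z i u)) - X i (?z i (h2 m u)) = X i (ad m Z (s - of_int (\<sigma> * int i)) u) + ?r i"
      by (simp add: ad_def linear_diff[OF X_linear])
  qed
  also have "\<dots> = expop \<sigma> X (ad m Z) s u + Sum_any ?r"
    unfolding expop_def by (rule Sum_any.distrib[OF fina finr])
  also have "Sum_any ?r = (s3 c (expop \<sigma> X Z (s - of_int (\<sigma> * int M)) u) when M > 0)"
  proof (cases "M > 0")
    case True
    have "Sum_any ?r = Sum_any (\<lambda>i. ?r (i + M))"
    proof (rule Sum_any_reindex_inj)
      fix x assume "x \<notin> range (\<lambda>i. i + M)"
      then have "x < M" by (metis add.commute le_add_diff_inverse not_less rangeI)
      then show "?r x = 0" by simp
    qed (auto simp: inj_def)
    also have "\<dots> = Sum_any (\<lambda>i. s3 c (X i (Z (s - of_int (\<sigma> * int M) - of_int (\<sigma> * int i)) u)))"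
      using True by (simp add: algebra_simps)
    also have "\<dots> = s3 c (expop \<sigma> X Z (s - of_int (\<sigma> * int M)) u)"
      unfolding expop_def by (rule sum_scale[OF expop_finite, symmetric])
    finally show ?thesis using True by simp
  qed simp
  finally show ?thesis .
qed

text \<open>Multiplying the coefficient at \<open>x^s\<close> by \<open>s\<close> is the Euler
  operator \<open>x d/dx\<close>. This is its product rule, with \<open>X_deriv\<close> supplying
  the derivative of the exponential.\<close>

lemma euler_expop:
  assumes X_deriv: "\<And>e v. s3 (of_nat e) (X e v) = (\<Sum>i<e. s3 c (h3 (q i) (X (e - Suc i) v)))"
  shows "s3 s (expop \<sigma> X Z s u) = expop \<sigma> X (\<lambda>t u. s3 t (Z t u)) s u +
    Sum_any (\<lambda>j. s3 (of_int \<sigma> * c) (h3 (q j) (expop \<sigma> X Z (s - of_int (\<sigma> * (int j + 1))) u)))"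
proof -
  let ?z = "\<lambda>i. Z (s - of_int (\<sigma> * int i)) u"
  let ?f = "\<lambda>i j. s3 (of_int \<sigma> * c) (h3 (q j) (X i (?z (i + Suc j))))"
  have zfin: "finite {i::nat. ?z i \<noteq> 0}" using locfin by (simp add: locfin_def)
  have finf: "finite {(i, j). ?f i j \<noteq> 0}"
  proof -
    obtain K where K: "\<forall>i\<in>{i::nat. ?z i \<noteq> 0}. i < K" using zfin finite_nat_set_iff_bounded by blast
    have "{(i, j). ?f i j \<noteq> 0} \<subseteq> {..<K} \<times> {..<K}"
    proof clarify
      fix i j assume "?f i j \<noteq> 0"
      then have "?z (i + Suc j) \<noteq> 0" by (auto simp: linear_0[OF X_linear])
      then have "i + Suc j < K" using K by blast
      then show "i \<in> {..<K} \<and> j \<in> {..<K}" by simp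
    qed
    then show ?thesis by (rule finite_subset) simp
  qed
  have fin1: "finite {i. X i (s3 (t i) (?z i)) \<noteq> 0}" for t
    by (rule finite_nonzero_mono[OF zfin]) (simp add: linear_0[OF X_linear])
  have fin2: "finite {i. s3 (t i) (s3 (of_nat i) (X i (?z i))) \<noteq> 0}" for t
    by (rule finite_nonzero_mono[OF zfin]) (simp add: linear_0[OF X_linear])
  have "s3 s (expop \<sigma> X Z s u) = Sum_any (\<lambda>i. s3 s (X i (?z i)))"
    unfolding expop_def by (rule sum_scale[OF expop_finite])
  also have "\<dots> = Sum_any (\<lambda>i. X i (s3 (s - of_int (\<sigma> * int i)) (?z i)) + s3 (of_int \<sigma>) (s3 (of_nat i) (X i (?z i))))"
    by (rule Sum_any.cong) (simp add: linear_scale[OF X_linear] flip: V3.scale_left_distrib)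
  also have "\<dots> = expop \<sigma> X (\<lambda>t u. s3 t (Z t u)) s u + Sum_any (\<lambda>i. s3 (of_int \<sigma>) (s3 (of_nat i) (X i (?z i))))"
    unfolding expop_def by (rule Sum_any.distrib[OF fin1 fin2])
  also have "Sum_any (\<lambda>i. s3 (of_int \<sigma>) (s3 (of_nat i) (X i (?z i)))) = Sum_any (\<lambda>i. \<Sum>j<i. ?f (i - Suc j) j)"
    by (intro Sum_any.cong) (auto simp: X_deriv V3.scale_sum_right intro!: sum.cong)
  also have "\<dots> = Sum_any (\<lambda>j. Sum_any (\<lambda>i. ?f i j))" by (rule Sum_any_triangle[OF finf])
  also have "\<dots> = Sum_any (\<lambda>j. s3 (of_int \<sigma> * c) (h3 (q j) (expop \<sigma> X Z (s - of_int (\<sigma> * (int j + 1))) u)))"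
  proof (rule Sum_any.cong)
    fix j
    let ?y = "\<lambda>i. X i (Z (s - of_int (\<sigma> * (int j + 1)) - of_int (\<sigma> * int i)) u)"
    have "finite {i. h3 (q j) (?y i) \<noteq> 0}"
      by (rule expop_finite'[of "\<lambda>_. h3 (q j)"]) simp
    moreover have "s - of_int (\<sigma> * int (i + Suc j)) = s - of_int (\<sigma> * (int j + 1)) - of_int (\<sigma> * int i)" for i
      by (simp add: algebra_simps)
    ultimately show "Sum_any (\<lambda>i. ?f i j) =
        s3 (of_int \<sigma> * c) (h3 (q j) (expop \<sigma> X Z (s - of_int (\<sigma> * (int j + 1))) u))"
      unfolding expop_def Sum_any_linear[OF expop_finite lin3]
      by (simp only: sum_scale)
  qed
  finally show ?thesis .
qed

end

end

section \<open>The coefficients of \<open>E^-\<close> and \<open>E^+\<close> on a Fock space\<close>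

context fock_space
begin

definition em_gen :: "complex \<Rightarrow> nat \<Rightarrow> 'w fock \<Rightarrow> 'w fock"
  where "em_gen a i u = fock_scale sc (a / of_nat (Suc i)) (H (- int i - 1) u)"

definition ep_gen :: "complex \<Rightarrow> nat \<Rightarrow> 'w fock \<Rightarrow> 'w fock"
  where "ep_gen a i u = fock_scale sc (- a / of_nat (Suc i)) (H (int i + 1) u)"

lemma exp_family_em_gen: "exp_family (fock_scale sc) (em_gen a)"
proof (intro exp_family.intro F.vector_space_axioms exp_family_axioms.intro)
  show "Vector_Spaces.linear (fock_scale sc) (fock_scale sc) (em_gen a i)" for i
    unfolding em_gen_def[abs_def] by (rule linear_scaled[OF heis_linear])
  show "em_gen a i (em_gen a j u) = em_gen a j (em_gen a i u)" for i j u
    using heis_comm[of "- int i - 1" "- int j - 1" u]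
    by (simp add: em_gen_def linear_scale[OF heis_linear] mult.commute)
qed

lemma exp_family_ep_gen: "exp_family (fock_scale sc) (ep_gen a)"
proof (intro exp_family.intro F.vector_space_axioms exp_family_axioms.intro)
  show "Vector_Spaces.linear (fock_scale sc) (fock_scale sc) (ep_gen a i)" for i
    unfolding ep_gen_def[abs_def] by (rule linear_scaled[OF heis_linear])
  show "ep_gen a i (ep_gen a j u) = ep_gen a j (ep_gen a i u)" for i j u
  proof -
    have "H (int i + 1) (H (int j + 1) u) = H (int j + 1) (H (int i + 1) u)"
      using heis_comm[of "int i + 1" "int j + 1" u] by simp
    then show ?thesis
      by (simp only: ep_gen_def linear_scale[OF heis_linear] F.scale_scale mult.commute)
  qed
qed

definition "Em a = exp_family.X (fock_scale sc) (em_gen a)"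
definition "Ep a = exp_family.X (fock_scale sc) (ep_gen a)"

lemmas Em_linear = exp_family.X_linear[OF exp_family_em_gen, folded Em_def]
  and Ep_linear = exp_family.X_linear[OF exp_family_ep_gen, folded Ep_def]

lemma E_minus_mult: "(E_minus sc h0 a \<odot> B) s k u = Sum_any (\<lambda>i. Em a i (B (s - of_nat i) k u))"
proof -
  have "(\<lambda>e u. fock_scale sc a (int_h_term sc h0 e u) when e > 0) =
      (\<lambda>e u. em_gen a (nat (1 * e) - 1) u when 1 * e > 0)"
  proof (intro ext)
    fix e :: int and u
    show "(fock_scale sc a (int_h_term sc h0 e u) when e > 0) = (em_gen a (nat (1 * e) - 1) u when 1 * e > 0)"
    proof (cases "e > 0")
      case True
      then have "- int (nat e - 1) - 1 = - e" "Suc (nat e - 1) = nat e" "of_nat (nat e) = (of_int e :: complex)" by auto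
      then show ?thesis using True by (simp add: int_h_term_def em_gen_def del: One_nat_def)
    qed simp
  qed
  then show ?thesis
    unfolding E_minus_def Em_def
    using exp_family.ls_exp_mult[OF exp_family_em_gen, of 1 a B s k u] by (simp del: One_nat_def)
qed

lemma E_plus_mult: "(E_plus sc h0 a \<odot> B) s k u = Sum_any (\<lambda>i. Ep a i (B (s + of_nat i) k u))"
proof -
  have "(\<lambda>e u. fock_scale sc a (int_h_term sc h0 e u) when e < 0) =
      (\<lambda>e u. ep_gen a (nat (- 1 * e) - 1) u when - 1 * e > 0)"
  proof (intro ext)
    fix e :: int and u
    show "(fock_scale sc a (int_h_term sc h0 e u) when e < 0) = (ep_gen a (nat (- 1 * e) - 1) u when - 1 * e > 0)"
    proof (cases "e < 0")
      case True
      then have "int (nat (- e) - 1) + 1 = - e" "Suc (nat (- e) - 1) = nat (- e)"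
        "of_nat (nat (- e)) = (- of_int e :: complex)" by auto
      then show ?thesis using True by (simp add: int_h_term_def ep_gen_def del: One_nat_def)
    qed simp
  qed
  then show ?thesis
    unfolding E_plus_def Ep_def
    using exp_family.ls_exp_mult[OF exp_family_ep_gen, of "-1" a B s k u] by (simp del: One_nat_def)
qed

text \<open>Only \<open>h(-m)\<close> in the exponent fails to commute with \<open>h(m)\<close>, and
  the factor \<open>1/m\<close> there cancels the \<open>m\<close> of the Heisenberg relation. For
  \<open>m \<le> 0\<close> the value \<open>nat m = 0\<close> switches the right side off.\<close>

lemma heis_Em:
  "H m (Em a e u) - Em a e (H m u) = (fock_scale sc a (Em a (e - nat m) u) when nat m > 0 \<and> nat m \<le> e)"
  unfolding Em_def
proof (rule exp_family.commutator_X[OF exp_family_em_gen heis_linear])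
  fix i u
  have "H m (em_gen a i u) - em_gen a i (H m u) =
      fock_scale sc (a / of_nat (Suc i)) (H m (H (- int i - 1) u) - H (- int i - 1) (H m u))"
    by (simp add: em_gen_def linear_scale[OF heis_linear] F.scale_right_diff_distrib)
  also have "\<dots> = fock_scale sc (a when Suc i = nat m) u"
    unfolding heis_comm
  proof (cases "Suc i = nat m")
    case True
    then have m: "m = int (Suc i)" by linarith
    have "a / of_nat (Suc i) * of_nat (Suc i) = a" by (simp del: of_nat_Suc)
    then show "fock_scale sc (a / of_nat (Suc i)) (fock_scale sc (of_int m when m + (- int i - 1) = 0) u) =
      fock_scale sc (a when Suc i = nat m) u" by (simp add: m del: of_nat_Suc)
  next
    case False
    then have "m + (- int i - 1) \<noteq> 0" by linarith
    then show "fock_scale sc (a / of_nat (Suc i)) (fock_scale sc (of_int m when m + (- int i - 1) = 0) u) =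
      fock_scale sc (a when Suc i = nat m) u" using False by simp
  qed
  finally show "H m (em_gen a i u) - em_gen a i (H m u) = fock_scale sc (a when Suc i = nat m) u" .
qed

lemma heis_Ep:
  "H m (Ep a e u) - Ep a e (H m u) = (fock_scale sc a (Ep a (e - nat (- m)) u) when nat (- m) > 0 \<and> nat (- m) \<le> e)"
  unfolding Ep_def
proof (rule exp_family.commutator_X[OF exp_family_ep_gen heis_linear])
  fix i u
  have "H m (ep_gen a i u) - ep_gen a i (H m u) =
      fock_scale sc (- a / of_nat (Suc i)) (H m (H (int i + 1) u) - H (int i + 1) (H m u))"
    by (simp only: ep_gen_def linear_scale[OF heis_linear] F.scale_right_diff_distrib)
  also have "\<dots> = fock_scale sc (a when Suc i = nat (- m)) u"
    unfolding heis_comm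
  proof (cases "Suc i = nat (- m)")
    case True
    then have m: "m = - int (Suc i)" by linarith
    have "- a / of_nat (Suc i) * - of_nat (Suc i) = a" by (simp del: of_nat_Suc)
    moreover have "of_int m = (- of_nat (Suc i) :: complex)" "m + (int i + 1) = 0" by (simp_all add: m)
    ultimately show "fock_scale sc (- a / of_nat (Suc i)) (fock_scale sc (of_int m when m + (int i + 1) = 0) u) =
      fock_scale sc (a when Suc i = nat (- m)) u" using True by (simp only: F.scale_scale when_def simp_thms if_True)
  next
    case False
    then have "m + (int i + 1) \<noteq> 0" by linarith
    then show "fock_scale sc (- a / of_nat (Suc i)) (fock_scale sc (of_int m when m + (int i + 1) = 0) u) =
      fock_scale sc (a when Suc i = nat (- m)) u" using False by simp
  qed
  finally show "H m (ep_gen a i u) - ep_gen a i (H m u) = fock_scale sc (a when Suc i = nat (- m)) u" .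
qed

lemma Em_deriv:
  "fock_scale sc (of_nat e) (Em a e u) = (\<Sum>i<e. fock_scale sc a (H (- int i - 1) (Em a (e - Suc i) u)))"
  unfolding Em_def exp_family.X_deriv[OF exp_family_em_gen]
  by (intro sum.cong refl) (simp add: em_gen_def del: of_nat_Suc)

lemma Ep_deriv:
  "fock_scale sc (of_nat e) (Ep a e u) = (\<Sum>i<e. fock_scale sc (- a) (H (int i + 1) (Ep a (e - Suc i) u)))"
  unfolding Ep_def exp_family.X_deriv[OF exp_family_ep_gen]
  by (intro sum.cong refl) (simp add: ep_gen_def del: of_nat_Suc F.scale_minus_left)

text \<open>Positive modes annihilate the lowest-weight vectors, so only the constant term acts on
  them; moving past \<open>h(-K-1)\<close> costs a shift by \<open>K + 1\<close>, which raises the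
  bound by that amount.\<close>

lemma Ep_nilpotent: "\<exists>N. \<forall>e\<ge>N. Ep a e u = 0"
proof (induction u rule: fock_induct)
  case (add u v)
  then obtain N M where "\<forall>e\<ge>N. Ep a e u = 0" "\<forall>e\<ge>M. Ep a e v = 0" by blast
  then show ?case by (intro exI[of _ "max N M"]) (simp add: linear_add[OF Ep_linear])
next
  case (vac w)
  have "Ep a e (Poly_Mapping.single {#} w) = (Poly_Mapping.single {#} w when e = 0)" for e
  proof (induction e rule: less_induct)
    case (less e)
    show ?case
    proof (cases "e = 0")
      case True
      then show ?thesis using exp_family.X_0[OF exp_family_ep_gen] by (simp add: Ep_def)
    next
      case False
      have "H (int i + 1) (Poly_Mapping.single {#} w) = 0" for i
        using heis_vac[of "Suc i" w] by (simp add: add.commute)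
      then have "fock_scale sc (of_nat e) (Ep a e (Poly_Mapping.single {#} w)) = 0"
        unfolding Ep_deriv by (intro sum.neutral) (auto simp: less when_def)
      then show ?thesis using False by simp
    qed
  qed
  then show ?case by (intro exI[of _ 1]) auto
next
  case (create K u)
  then obtain N where N: "\<forall>e\<ge>N. Ep a e u = 0" by blast
  have "Ep a e (fock_create K u) = 0" if "e \<ge> N + Suc K" for e
    using heis_Ep[of "- int K - 1" a e u] that N by (simp add: heis_create linear_0[OF create_linear] nat_add_distrib)
  then show ?case by blast
qed

end

section \<open>The logarithmic vertex operators\<close>

text \<open>\<open>T_h0\<close> is equivariance for the tensor product action, and
  \<open>nilpotent\<close> says that \<open>h(0) - lam\<close> has square zero, in the form in which
  it is applied.\<close>

locale fock_log_data = fock_modules sc h0 sc2 h02 sc3 h03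
  for sc :: "complex \<Rightarrow> 'a::ab_group_add \<Rightarrow> 'a" and h0
    and sc2 :: "complex \<Rightarrow> 'b::ab_group_add \<Rightarrow> 'b" and h02
    and sc3 :: "complex \<Rightarrow> 'c::ab_group_add \<Rightarrow> 'c" and h03 +
  fixes T :: "'a \<Rightarrow> 'b \<Rightarrow> 'c" and lam :: complex
  assumes T_left: "Vector_Spaces.linear sc sc3 (\<lambda>w. T w c)"
    and T_right: "Vector_Spaces.linear sc2 sc3 (T w)"
    and T_h0: "h03 (T w c) = T (h0 w) c + T w (h02 c)"
    and h02_scalar: "h02 c = sc2 lam c"
    and nilpotent: "h0 (h0 w - sc lam w) = sc lam (h0 w - sc lam w)"
begin

definition "T_fock w = Poly_Mapping.map (T w)"

lemma lookup_T_fock: "Poly_Mapping.lookup (T_fock w u) \<mu> = T w (Poly_Mapping.lookup u \<mu>)"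
  by (simp add: T_fock_def Poly_Mapping.map.rep_eq when_def linear_0[OF T_right])

lemma T_fock_right: "Vector_Spaces.linear s2 s3 (T_fock w)"
  by (rule linearI[OF W2.F.vector_space_axioms W3.F.vector_space_axioms]; rule poly_mapping_eqI)
    (simp_all add: lookup_T_fock lookup_add W2.lookup_scale W3.lookup_scale linear_add[OF T_right] linear_scale[OF T_right])

lemma T_fock_add: "T_fock (w + w') u = T_fock w u + T_fock w' u"
  by (rule poly_mapping_eqI) (simp add: lookup_T_fock lookup_add linear_add[OF T_left])

lemma T_fock_scale: "T_fock (sc c w) u = s3 c (T_fock w u)"
  by (rule poly_mapping_eqI) (simp add: lookup_T_fock W3.lookup_scale linear_scale[OF T_left])

lemma heis_T_fock: "heis sc3 h03 m (T_fock w u) = T_fock w (W2.H m u) + (T_fock (h0 w) u when m = 0)"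
  by (rule poly_mapping_eqI)
    (simp add: heis_def lookup_add lookup_T_fock fock_create.rep_eq W2.lookup_annihilate W3.lookup_annihilate
      W2.lookup_map_h0 W3.lookup_map_h0 linear_scale[OF T_right] linear_0[OF T_right] T_h0 add.commute)

lemma heis2_0: "heis sc2 h02 0 u = s2 lam u"
  by (rule poly_mapping_eqI) (simp add: heis_def W2.lookup_map_h0 W2.lookup_scale h02_scalar)

definition "N w = h0 w - sc lam w"

lemma N_linear: "N (w + w') = N w + N w'" "N (sc c w) = sc c (N w)"
  by (simp_all add: N_def linear_add[OF W1.h0] linear_scale[OF W1.h0] W1.W.scale_right_distrib
      W1.W.scale_right_diff_distrib mult.commute)

lemma h0_N: "h0 (N w) = sc lam (N w)" using nilpotent by (simp add: N_def)

lemma h0_eq: "h0 w = sc lam w + N w" by (simp add: N_def)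

lemma N_h0: "N (h0 w) = sc lam (N w)"
  by (simp add: N_def linear_diff[OF W1.h0] linear_scale[OF W1.h0]) (metis N_def h0_N linear_diff[OF W1.h0] linear_scale[OF W1.h0])

text \<open>\<open>T(w) x^(lam h_s(0))\<close>: since \<open>h(0)\<close> acts on the second module
  as \<open>lam\<close>, the single exponent \<open>lam * lam\<close> occurs.\<close>

definition tau :: "'a \<Rightarrow> complex \<Rightarrow> 'b fock \<Rightarrow> 'c fock"
  where "tau w s u = (T_fock w u when s = lam * lam)"

lemma tau_linear: "Vector_Spaces.linear s2 s3 (tau w s)"
  by (rule linearI[OF W2.F.vector_space_axioms W3.F.vector_space_axioms])
    (simp_all add: tau_def linear_add[OF T_fock_right] linear_scale[OF T_fock_right] when_def)

lemma locfin_tau: "locfin (-1) (tau w)"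
  unfolding locfin_def
proof (intro allI)
  fix s u
  have "finite ((\<lambda>i::nat. s - of_int (- 1 * int i)) -` {lam * lam})"
    by (rule finite_vimageI) (auto simp: inj_def)
  then show "finite {i::nat. tau w (s - of_int (- 1 * int i)) u \<noteq> 0}"
    by (rule rev_finite_subset) (auto simp: tau_def when_def split: if_splits)
qed

text \<open>The factors \<open>E^+\<close> and \<open>E^-\<close> are applied in two stages because
  their finiteness has different sources: for \<open>G\<close> the single exponent of
  \<open>tau\<close>, for \<open>Phi\<close> the lower truncation of \<open>G\<close>, which in turn
  rests on \<open>Ep_nilpotent\<close>.\<close>

definition "G w = expop (-1) (W3.Ep lam) (tau w)"
definition "Phi w = expop 1 (W3.Em lam) (G w)"

lemma G_linear: "Vector_Spaces.linear s2 s3 (G w s)"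
  unfolding G_def by (rule expop_linear[OF W3.Ep_linear locfin_tau tau_linear])

lemma truncated_G: "truncated (G w)"
  unfolding truncated_def
proof (intro conjI allI)
  fix u
  obtain K where K: "\<forall>e\<ge>K. W3.Ep lam e (T_fock w u) = 0" using W3.Ep_nilpotent by blast
  have "G w s u = 0" if s: "Re s < Re (lam * lam) - real K" for s
  proof -
    have "W3.Ep lam i (tau w (s - of_int (- 1 * int i)) u) = 0" for i
    proof (cases "s + of_nat i = lam * lam")
      case True
      then have "Re s + real i = Re (lam * lam)" by (metis Re_complex_of_real plus_complex.sel(1) of_real_of_nat_eq)
      then have "i \<ge> K" using s by linarith
      then show ?thesis using K True by (simp add: tau_def)
    qed (simp add: tau_def linear_0[OF W3.Ep_linear])
    then show ?thesis by (simp add: G_def expop_def)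
  qed
  then show "\<exists>N. \<forall>s. Re s < N \<longrightarrow> G w s u = 0" by blast
qed (rule G_linear)

lemma locfin_truncated: "truncated Z \<Longrightarrow> locfin 1 Z"
  using truncated_finite by (simp add: locfin_def)

lemma truncated_Phi: "truncated (Phi w)"
  unfolding truncated_def
proof (intro conjI allI)
  show "Vector_Spaces.linear s2 s3 (Phi w s)" for s
    unfolding Phi_def by (rule expop_linear[OF W3.Em_linear locfin_truncated[OF truncated_G] G_linear])
  fix u
  obtain K where K: "\<forall>s. Re s < K \<longrightarrow> G w s u = 0" using truncated_G[of w] unfolding truncated_def by blast
  then have "Phi w s u = 0" if "Re s < K" for s
    using that by (simp add: Phi_def expop_def linear_0[OF W3.Em_linear])
  then show "\<exists>N. \<forall>s. Re s < N \<longrightarrow> Phi w s u = 0" by blast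
qed

lemmas G_finite = expop_finite[OF W3.Ep_linear locfin_tau tau_linear]
  and Phi_finite = expop_finite[OF W3.Em_linear locfin_truncated[OF truncated_G] G_linear]

lemma G_add: "G (w + w') s u = G w s u + G w' s u"
proof -
  have t: "tau (w + w') t u = tau w t u + tau w' t u" for t by (simp add: tau_def T_fock_add when_def)
  show ?thesis
    unfolding G_def expop_def t linear_add[OF W3.Ep_linear]
    by (rule Sum_any.distrib[OF G_finite G_finite])
qed

lemma G_scale: "G (sc c w) s u = s3 c (G w s u)"
proof -
  have t: "tau (sc c w) t u = s3 c (tau w t u)" for t by (simp add: tau_def T_fock_scale when_def)
  show ?thesis
    unfolding G_def expop_def t linear_scale[OF W3.Ep_linear]
    by (rule sum_scale[OF G_finite, symmetric])
qed

lemma Phi_add: "Phi (w + w') s u = Phi w s u + Phi w' s u"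
  unfolding Phi_def expop_def G_add linear_add[OF W3.Em_linear]
  by (rule Sum_any.distrib[OF Phi_finite
        Phi_finite])

lemma Phi_scale: "Phi (sc c w) s u = s3 c (Phi w s u)"
  unfolding Phi_def expop_def G_scale linear_scale[OF W3.Em_linear]
  by (rule sum_scale[OF Phi_finite, symmetric])

lemma ad_G: "ad m (G w) s u = (s3 lam (G w (s - of_int m) u) when m < 0) + (G (h0 w) s u when m = 0)"
proof -
  have "ad m (tau w) = (\<lambda>s u. tau (h0 w) s u when m = 0)"
    by (intro ext) (auto simp: ad_def tau_def heis_T_fock linear_0[OF W3.heis_linear] when_def)
  then have "expop (-1) (W3.Ep lam) (ad m (tau w)) s u = (G (h0 w) s u when m = 0)"
    by (simp add: G_def expop_def when_def linear_0[OF W3.Ep_linear])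
  moreover have "ad m (G w) s u = expop (-1) (W3.Ep lam) (ad m (tau w)) s u +
      (s3 lam (G w (s - of_int (- 1 * int (nat (- m)))) u) when nat (- m) > 0)"
    unfolding G_def by (rule ad_expop[OF W3.Ep_linear locfin_tau tau_linear W3.heis_Ep])
  ultimately show ?thesis by (auto simp: when_def)
qed

text \<open>A positive \<open>m\<close> is met by \<open>E^-\<close> and a negative one by
  \<open>E^+\<close>, each giving \<open>lam x^m\<close>. The zero mode commutes with both
  exponentials and acts through \<open>T\<close>, so it alone detects the nilpotent part of
  \<open>h(0)\<close>.\<close>

lemma ad_Phi: "ad m (Phi w) s u = (if m = 0 then Phi (h0 w) s u else s3 lam (Phi w (s - of_int m) u))"
proof -
  have c: "ad m (Phi w) s u = expop 1 (W3.Em lam) (ad m (G w)) s u +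
      (s3 lam (Phi w (s - of_int (1 * int (nat m))) u) when nat m > 0)"
    unfolding Phi_def
    by (rule ad_expop[OF W3.Em_linear locfin_truncated[OF truncated_G] G_linear W3.heis_Em])
  have "ad m (G w) = (\<lambda>s u. (s3 lam (G w (s - of_int m) u) when m < 0) + (G (h0 w) s u when m = 0))"
    by (intro ext) (rule ad_G)
  then have e: "expop 1 (W3.Em lam) (ad m (G w)) s u =
      (s3 lam (Phi w (s - of_int m) u) when m < 0) + (Phi (h0 w) s u when m = 0)"
  proof -
    assume c: "ad m (G w) = (\<lambda>s u. (s3 lam (G w (s - of_int m) u) when m < 0) + (G (h0 w) s u when m = 0))"
    consider "m < 0" | "m = 0" | "m > 0" by linarith
    then show ?thesis
    proof cases
      case 1
      have idx: "s - of_int (1 * int i) - of_int m = s - of_int m - of_int (1 * int i)" for i by simp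
      have "expop 1 (W3.Em lam) (\<lambda>s u. s3 lam (G w (s - of_int m) u)) s u =
          s3 lam (expop 1 (W3.Em lam) (G w) (s - of_int m) u)"
        unfolding expop_def idx linear_scale[OF W3.Em_linear]
          sum_scale[OF Phi_finite] ..
      then show ?thesis using 1 by (simp add: c Phi_def)
    next
      case 2
      then show ?thesis unfolding c by (simp add: Phi_def expop_def)
    next
      case 3
      then show ?thesis unfolding c by (simp add: expop_def linear_0[OF W3.Em_linear])
    qed
  qed
  show ?thesis unfolding c e by (auto simp: when_def)
qed

text \<open>The exponent \<open>lam * lam\<close> is \<open>lam h(0)\<close>, and the positive modes
  produced by differentiating \<open>E^+\<close> commute with \<open>G\<close> by
  \<open>ad_G\<close>; hence all modes can be placed on the right.\<close>

lemma euler_G: "s3 s (G w s u) = hright (\<lambda>_. lam) 0 (G w) s u"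
proof -
  have "s3 s (G w s u) = expop (-1) (W3.Ep lam) (\<lambda>t u. s3 t (tau w t u)) s u +
    Sum_any (\<lambda>j. s3 (of_int (-1) * (- lam)) (W3.H (int j + 1) (G w (s - of_int (- 1 * (int j + 1))) u)))"
    unfolding G_def by (rule euler_expop[OF W3.Ep_linear locfin_tau tau_linear W3.Ep_deriv])
  also have "expop (-1) (W3.Ep lam) (\<lambda>t u. s3 t (tau w t u)) s u = s3 lam (G w s (W2.H 0 u))"
  proof -
    have "s3 t (tau w t u) = s3 (lam * lam) (tau w t u)" for t by (simp add: tau_def when_def)
    then have "expop (-1) (W3.Ep lam) (\<lambda>t u. s3 t (tau w t u)) s u = s3 (lam * lam) (G w s u)"
      unfolding G_def expop_def
      by (simp only: linear_scale[OF W3.Ep_linear] flip: sum_scale[OF G_finite])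
    then show ?thesis by (simp add: heis2_0 linear_scale[OF G_linear])
  qed
  also have "Sum_any (\<lambda>j. s3 (of_int (-1) * (- lam)) (W3.H (int j + 1) (G w (s - of_int (- 1 * (int j + 1))) u))) =
      Sum_any (\<lambda>j. s3 lam (G w (s + of_int 0 + of_nat (Suc j)) (W2.H (int (Suc j)) u)))"
  proof (rule Sum_any.cong)
    fix j
    have "heis sc3 h03 (int j + 1) (G w t u) = G w t (W2.H (int j + 1) u)" for t
      using ad_G[of "int j + 1" w t u] by (simp add: ad_def)
    then show "s3 (of_int (-1) * (- lam)) (W3.H (int j + 1) (G w (s - of_int (- 1 * (int j + 1))) u)) =
        s3 lam (G w (s + of_int 0 + of_nat (Suc j)) (W2.H (int (Suc j)) u))"
      by (simp add: algebra_simps)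
  qed
  also have "s3 lam (G w s (W2.H 0 u)) + \<dots> = hright (\<lambda>_. lam) 0 (G w) s u"
    unfolding hright_def by (subst Sum_any_Suc[OF finite_right[OF truncated_G]]) simp
  finally show ?thesis .
qed

text \<open>The differential equation of a vertex operator,
  \<open>x d/dx Phi = lam x h(x) Phi\<close> with the product normally ordered: \<open>E^-\<close>
  provides the negative modes and \<open>euler_G\<close> the others.\<close>

lemma euler_Phi: "s3 s (Phi w s u) = s3 lam (hop (\<lambda>_. 1) (\<lambda>_. 1) 0 (Phi w) s u)"
proof -
  have "s3 s (Phi w s u) = expop 1 (W3.Em lam) (\<lambda>t u. s3 t (G w t u)) s u +
    Sum_any (\<lambda>j. s3 (of_int 1 * lam) (W3.H (- int j - 1) (Phi w (s - of_int (1 * (int j + 1))) u)))"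
    unfolding Phi_def by (rule euler_expop[OF W3.Em_linear locfin_truncated[OF truncated_G] G_linear W3.Em_deriv])
  also have "Sum_any (\<lambda>j. s3 (of_int 1 * lam) (W3.H (- int j - 1) (Phi w (s - of_int (1 * (int j + 1))) u))) =
      hleft (\<lambda>_. lam) 0 (Phi w) s u"
    by (simp add: hleft_def algebra_simps)
  also have "expop 1 (W3.Em lam) (\<lambda>t u. s3 t (G w t u)) s u = hright (\<lambda>_. lam) 0 (Phi w) s u"
  proof -
    let ?f = "\<lambda>i j. s3 lam (W3.Em lam i (G w (s + of_nat j - of_nat i) (W2.H (int j) u)))"
    have fin: "finite {(i, j). ?f i j \<noteq> 0}"
    proof (rule finite_pairs_by_snd)
      show "\<exists>N. \<forall>j\<ge>N. \<forall>i. ?f i j = 0"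
        by (rule int_field_trunc_mono[OF h2_field, of 0 u])
          (simp add: truncated_zero_arg[OF truncated_G] linear_0[OF W3.Em_linear])
      show "\<exists>N. \<forall>i\<ge>N. ?f i j = 0" for j
        using truncated_trunc'[OF truncated_G[of w], of "s + of_nat j" "heis sc2 h02 (int j) u"]
        by (rule eventually_zero_mono) (simp add: linear_0[OF W3.Em_linear])
    qed
    have X: "W3.Em lam i (s3 t (G w t u)) = Sum_any (\<lambda>j. s3 lam (W3.Em lam i (G w (t + of_nat j) (W2.H (int j) u))))" for i t
      unfolding euler_G hright_def Sum_any_linear[OF finite_right[OF truncated_G] W3.Em_linear] linear_scale[OF W3.Em_linear]
      by simp
    have "expop 1 (W3.Em lam) (\<lambda>t u. s3 t (G w t u)) s u = Sum_any (\<lambda>i. Sum_any (\<lambda>j. ?f i j))"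
    proof -
      have "s - of_int (1 * int i) + of_nat j = s + of_nat j - of_nat i" for i j by simp
      then show ?thesis unfolding expop_def by (simp only: X)
    qed
    also have "\<dots> = Sum_any (\<lambda>j. Sum_any (\<lambda>i. ?f i j))" by (rule Sum_any_swap[OF fin])
    also have "\<dots> = hright (\<lambda>_. lam) 0 (Phi w) s u"
      unfolding hright_def Phi_def expop_def
      using Phi_finite
      by (simp add: sum_scale)
    finally show ?thesis .
  qed
  finally have "s3 s (Phi w s u) = hop (\<lambda>_. lam * 1) (\<lambda>_. lam * 1) 0 (Phi w) s u"
    by (simp add: hop_def add.commute)
  then show ?thesis by (simp only: hop_coeff[OF truncated_Phi])
qed

lemma dress_0: "dress 0 Z s u = hop (\<lambda>_. 1) (\<lambda>_. 1) 0 Z (s + 1) u"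
  by (simp add: dress_def hop_def hleft_def hright_def algebra_simps)

lemma shift_deriv_Phi: "shift_deriv (Phi w) s u = s3 lam (dress 0 (Phi w) s u)"
  unfolding shift_deriv_def euler_Phi dress_0 ..

text \<open>
  The value \<open>- 1 / 0 = 0\<close> at \<open>i = 0\<close> is intended: \<open>h(0)\<close> enters \<open>\<integral>\<^sup>+h\<close> with \<open>log x\<close> only.
\<close>

definition "integral = hop (\<lambda>i. 1 / of_nat (Suc i)) (\<lambda>i. - 1 / of_nat i) 0"

text \<open>The commutator of \<open>h(m)\<close> with \<open>int h\<close> is \<open>x^m\<close>
  for \<open>m \<noteq> 0\<close>, because integration divides by the factor \<open>m\<close> of the
  Heisenberg relation; \<open>h(0)\<close> is central.\<close>

lemma kappa_integral: "kappa (\<lambda>i. 1 / of_nat (Suc i)) (\<lambda>i. - 1 / of_nat i) m = (if m = 0 then 0 else 1)"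
proof -
  have "Suc (nat m - 1) = nat m" if "m > 0" using that by simp
  then show ?thesis by (auto simp: kappa_def simp del: of_nat_Suc)
qed

text \<open>The coefficient of \<open>log x\<close> comes from \<open>h(0) log x\<close> in
  \<open>int^+ h\<close>, since \<open>h(0)\<close> acts on the second module as \<open>lam\<close>.
  Writing the series for all \<open>w\<close> by means of \<open>N\<close> treats both basis vectors
  of the lowest-weight space at once.\<close>

definition base :: "'a \<Rightarrow> ('b fock, 'c fock) log_series"
  where "base w s k u =
    (if k = 0 then integral (Phi (N w)) s u + Phi w s u
     else if k = 1 then s3 lam (Phi (N w) s u) else 0)"

lemma integral_add: "truncated Z \<Longrightarrow> truncated Z' \<Longrightarrow> integral (\<lambda>s u. Z s u + Z' s u) s u = integral Z s u + integral Z' s u"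
  unfolding integral_def by (rule hop_add)

lemma integral_scale: "truncated Z \<Longrightarrow> integral (\<lambda>s u. s3 c (Z s u)) s u = s3 c (integral Z s u)"
  unfolding integral_def by (rule hop_scale)

lemma truncated_integral: "truncated Z \<Longrightarrow> truncated (integral Z)"
  unfolding integral_def by (rule truncated_hop)

lemma base_0: "(\<lambda>s. base w s 0) = (\<lambda>s u. integral (Phi (N w)) s u + Phi w s u)"
  by (intro ext) (simp add: base_def)

lemma base_1: "(\<lambda>s. base w s 1) = (\<lambda>s u. s3 lam (Phi (N w) s u))"
  by (intro ext) (simp add: base_def)

lemma base_2: "k \<ge> 2 \<Longrightarrow> (\<lambda>s. base w s k) = (\<lambda>s u. 0)"
  by (intro ext) (simp add: base_def)

lemma integral_shift: "integral (\<lambda>s. Z (s + d)) s u = integral Z (s + d) u"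
  unfolding integral_def by (rule hop_shift)

lemma Phi_fun_add: "Phi (w + w') = (\<lambda>s u. Phi w s u + Phi w' s u)" by (intro ext) (rule Phi_add)
lemma Phi_fun_scale: "Phi (sc c w) = (\<lambda>s u. s3 c (Phi w s u))" by (intro ext) (rule Phi_scale)

sublocale fock_intertwiner sc h0 sc2 h02 sc3 h03 base
proof (intro fock_intertwiner.intro fock_modules_axioms fock_intertwiner_axioms.intro)
  fix w and k :: nat
  consider "k = 0" | "k = 1" | "k \<ge> 2" by linarith
  then show "truncated (\<lambda>s. base w s k)"
    by cases (simp_all only: base_0 base_1 base_2 truncated_add truncated_integral truncated_Phi truncated_scale truncated_zero)
next
  fix s and k :: nat and u
  have "base (w + w') s k u = base w s k u + base w' s k u" for w w'
    by (simp add: base_def N_linear Phi_fun_add integral_add truncated_Phi W3.F.scale_right_distrib)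
  moreover have "base (sc c w) s k u = s3 c (base w s k u)" for c w
    by (simp add: base_def N_linear Phi_fun_scale integral_scale truncated_Phi W3.F.scale_right_distrib mult.commute)
  ultimately show "Vector_Spaces.linear sc s3 (\<lambda>w. base w s k u)"
    by (intro linearI) (simp_all add: W1.sc W3.F.vector_space_axioms)
next
  fix m w and k :: nat and s u
  show "ad m (\<lambda>s. base w s k) s u = base (h0 w) (s - of_int m) k u"
  proof -
    have cPhi: "ad m (Phi w) = (\<lambda>s u. if m = 0 then Phi (h0 w) s u else s3 lam (Phi w (s + - of_int m) u))" for w
      by (intro ext) (simp add: ad_Phi)
    consider "k = 0" | "k = 1" | "k \<ge> 2" by linarith
    then show ?thesis
    proof cases
      case 1
      have e1: "ad m (\<lambda>s. base w s k) s u = ad m (integral (Phi (N w))) s u + ad m (Phi w) s u"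
        unfolding 1 base_0 by (simp add: ad_def linear_add[OF lin3])
      have e2: "ad m (integral (Phi (N w))) s u =
          integral (ad m (Phi (N w))) s u + (if m = 0 then 0 else Phi (N w) (s - of_int m) u)"
        unfolding integral_def ad_hop[OF truncated_Phi] kappa_integral by simp
      show ?thesis
      proof (cases "m = 0")
        case True
        then have "ad m (Phi w) = Phi (h0 w)" for w by (intro ext) (simp add: ad_Phi)
        then show ?thesis unfolding e1 e2 using True by (simp only: 1 base_def h0_N N_h0) simp
      next
        case False
        have "integral (ad m (Phi (N w))) s u = integral (\<lambda>s u. s3 lam (Phi (N w) (s + - of_int m) u)) s u"
          by (simp only: cPhi False if_False)
        also have "\<dots> = s3 lam (integral (\<lambda>s. Phi (N w) (s + - of_int m)) s u)"
          by (rule integral_scale[OF truncated_shift[OF truncated_Phi]])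
        also have "\<dots> = s3 lam (integral (Phi (N w)) (s + - of_int m) u)"
          by (simp only: integral_shift)
        finally have "integral (ad m (Phi (N w))) s u = s3 lam (integral (Phi (N w)) (s - of_int m) u)"
          by simp
        moreover have "integral (Phi (N (h0 w))) (s - of_int m) u = s3 lam (integral (Phi (N w)) (s - of_int m) u)"
          unfolding N_h0 Phi_fun_scale by (rule integral_scale[OF truncated_Phi])
        \<comment> \<open>With \<open>h(0) w = lam w + N w\<close> the target exceeds
          \<open>lam\<close> times the given series by \<open>Phi(N w)\<close>; this is the scalar
          commutator of \<open>h(m)\<close> with the integral found in \<open>e2\<close>.\<close>
        moreover have "Phi (h0 w) (s - of_int m) u = s3 lam (Phi w (s - of_int m) u) + Phi (N w) (s - of_int m) u"
          by (subst h0_eq) (simp add: Phi_add Phi_scale)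
        ultimately show ?thesis unfolding e1 e2 using False by (simp add: 1 cPhi base_def)
      qed
    next
      case 2
      have "ad m (\<lambda>s. base w s k) s u = s3 lam (ad m (Phi (N w)) s u)"
        unfolding 2 base_1 by (simp add: ad_def linear_scale[OF lin3] W3.F.scale_right_diff_distrib)
      then show ?thesis by (simp add: 2 ad_Phi base_def h0_N N_h0 Phi_scale)
    next
      case 3
      then show ?thesis by (simp only: base_2 ad_def) (simp add: base_def linear_0[OF lin3])
    qed
  qed
next
  fix w s and k :: nat and u
  have truncatedI: "truncated (integral (Phi (N w)))" by (rule truncated_integral[OF truncated_Phi])
  have d: "ls_deriv s3 (base w) s k u = shift_deriv (\<lambda>s. base w s k) s u + s3 (of_nat k + 1) (base w (s + 1) (k + 1) u)"
    by (simp add: ls_deriv_def shift_deriv_def)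
  consider "k = 0" | "k = 1" | "k \<ge> 2" by linarith
  then show "ls_deriv s3 (base w) s k u = dress 0 (\<lambda>s. base (h0 w) s k) s u"
  proof cases
    case 1
    have int_dress: "integral (dress 0 Z) s u = dress 0 (integral Z) s u" if "truncated Z" for Z s u
      unfolding integral_def dress_def by (rule hop_commute[OF that])
    have "shift_deriv (\<lambda>s. base w s 0) s u = shift_deriv (integral (Phi (N w))) s u + shift_deriv (Phi w) s u"
      unfolding base_0 by (simp add: shift_deriv_def W3.F.scale_right_distrib)
    moreover have "shift_deriv (integral (Phi (N w))) s u + s3 lam (Phi (N w) (s + 1) u) =
        s3 lam (dress 0 (integral (Phi (N w))) s u) + dress 0 (Phi (N w)) s u"
    proof -
      have "shift_deriv (Phi (N w)) = (\<lambda>s u. s3 lam (dress 0 (Phi (N w)) s u))"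
        by (intro ext) (rule shift_deriv_Phi)
      then have 1: "integral (shift_deriv (Phi (N w))) s u = s3 lam (dress 0 (integral (Phi (N w))) s u)"
        by (simp add: integral_scale truncated_dress truncated_Phi int_dress)
      have a: "(\<lambda>i. (of_nat i + 1 - of_int 0) * (1 / of_nat (Suc i))) = (\<lambda>_. 1 :: complex)"
        by (intro ext) (simp add: add.commute del: of_nat_Suc flip: of_nat_Suc)
      have b: "(\<lambda>i. - (of_int 0 + of_nat i) * (- 1 / of_nat i)) = (\<lambda>i. if i = 0 then 0 else 1 :: complex)"
        by (intro ext) simp
      have "shift_deriv (integral (Phi (N w))) s u = integral (shift_deriv (Phi (N w))) s u +
          hop (\<lambda>_. 1) (\<lambda>i. if i = 0 then 0 else 1) 1 (Phi (N w)) s u"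
        unfolding integral_def shift_deriv_hop[OF truncated_Phi] a b by simp
      \<comment> \<open>The differentiated integral lacks the mode 0. The missing
        \<open>h(0)/x\<close> comes from differentiating \<open>log x\<close> in the next
        coefficient and equals \<open>lam/x\<close> here.\<close>
      moreover have "hop (\<lambda>_. 1) (\<lambda>i. if i = 0 then 0 else 1) 1 (Phi (N w)) s u + s3 lam (Phi (N w) (s + 1) u) =
          dress 0 (Phi (N w)) s u"
      proof -
        have "hright (\<lambda>_. 1) 1 (Phi (N w)) s u = Phi (N w) (s + 1) (W2.H 0 u) +
            hright (\<lambda>i. if i = 0 then 0 else 1) 1 (Phi (N w)) s u"
          unfolding hright_def
          by (subst (1 2) Sum_any_Suc[OF finite_right[OF truncated_Phi]]) simp
        moreover have "Phi (N w) (s + 1) (W2.H 0 u) = s3 lam (Phi (N w) (s + 1) u)"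
          by (simp add: heis2_0 linear_scale[OF truncated_linear[OF truncated_Phi]])
        ultimately show ?thesis by (simp add: dress_def hop_def)
      qed
      ultimately show ?thesis using 1 by (simp add: algebra_simps)
    qed
    moreover have "dress 0 (\<lambda>s. base (h0 w) s 0) s u =
        s3 lam (dress 0 (integral (Phi (N w))) s u) + (s3 lam (dress 0 (Phi w) s u) + dress 0 (Phi (N w)) s u)"
    proof -
      have "integral (Phi (N (h0 w))) = (\<lambda>s u. s3 lam (integral (Phi (N w)) s u))"
        unfolding N_h0 Phi_fun_scale by (intro ext) (rule integral_scale[OF truncated_Phi])
      moreover have "Phi (h0 w) = (\<lambda>s u. s3 lam (Phi w s u) + Phi (N w) s u)"
        by (subst h0_eq) (simp add: Phi_fun_add Phi_fun_scale)
      ultimately show ?thesis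
        unfolding base_0
        by (simp add: dress_add dress_scale truncated_add truncated_scale truncated_Phi truncatedI)
    qed
    moreover have "base w (s + 1) (0 + 1) u = s3 lam (Phi (N w) (s + 1) u)"
      by (simp add: base_def)
    ultimately show ?thesis unfolding d unfolding 1 by (simp add: shift_deriv_Phi algebra_simps)
  next
    case 2
    have "shift_deriv (\<lambda>s. base w s 1) s u = s3 lam (shift_deriv (Phi (N w)) s u)"
      unfolding base_1 by (simp add: shift_deriv_def mult.commute)
    then show ?thesis unfolding d unfolding 2 base_1 N_h0 Phi_fun_scale
      by (simp add: base_def shift_deriv_Phi dress_scale truncated_scale truncated_Phi)
  next
    case 3
    then show ?thesis unfolding d by (simp add: base_2 dress_def hop_zero shift_deriv_def) (simp add: base_def)
  qed
next
  show "\<exists>K. \<forall>w s u. \<forall>k>K. base w s k u = 0"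
    by (rule exI[of _ 1]) (simp add: base_def)
qed

end

section \<open>The prescribed series\<close>

context fock_log_data
begin

text \<open>\<open>R\<close> stands for the rightmost factors of the prescribed series, which on a
  module where \<open>h(0)\<close> is the scalar \<open>lam\<close> collapse to the monomial
  \<open>x^(lam^2)\<close>.\<close>

lemma series_Phi:
  assumes R: "\<And>s k u. R s k u = (u when s = lam * lam \<and> k = 0)"
  shows "E_minus sc3 h03 lam \<odot> E_plus sc3 h03 lam \<odot> ls_const (Poly_Mapping.map (T w)) \<odot> R =
    (\<lambda>s k u. Phi w s u when k = 0)"
proof -
  have t: "(ls_const (Poly_Mapping.map (T w)) \<odot> R) s k u = (tau w s u when k = 0)" for s k u
    using ls_const_mult[of "T_fock w" R s k u]
    by (auto simp: T_fock_def[symmetric] linear_0[OF T_fock_right] R tau_def when_def)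
  have g: "(E_plus sc3 h03 lam \<odot> ls_const (Poly_Mapping.map (T w)) \<odot> R) s k u = (G w s u when k = 0)" for s k u
    unfolding W3.E_plus_mult t by (auto simp: G_def expop_def when_def linear_0[OF W3.Ep_linear])
  show ?thesis
    unfolding fun_eq_iff W3.E_minus_mult g by (auto simp: Phi_def expop_def when_def linear_0[OF W3.Em_linear])
qed

lemma int_h_minus_mult:
  "(int_h_minus sc3 h03 \<odot> (\<lambda>s k u. Z s u when k = 0)) s k u =
    (hleft (\<lambda>i. 1 / of_nat (Suc i)) 0 Z s u when k = 0)"
proof -
  let ?c = "\<lambda>e u. int_h_term sc3 h03 e u when e > 0"
  have c0: "?c e 0 = 0" for e by (simp add: int_h_term_def)
  have "(int_h_minus sc3 h03 \<odot> (\<lambda>s k u. Z s u when k = 0)) s k u =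
      Sum_any (\<lambda>e. ?c e (Z (s - of_int e) u when k = 0))"
    unfolding int_h_minus_def by (rule ls_int_mult) (rule c0)
  also have "\<dots> = Sum_any (\<lambda>i. ?c (int i + 1) (Z (s - of_int (int i + 1)) u when k = 0))"
  proof (rule Sum_any_reindex_inj)
    fix e :: int assume e: "e \<notin> range (\<lambda>i. int i + 1)"
    show "?c e (Z (s - of_int e) u when k = 0) = 0"
    proof (cases "e > 0")
      case True
      then have "e = int (nat (e - 1)) + 1" by simp
      then show ?thesis using e by blast
    qed simp
  qed (auto simp: inj_def)
  also have "\<dots> = (hleft (\<lambda>i. 1 / of_nat (Suc i)) 0 Z s u when k = 0)"
  proof (cases "k = 0")
    case True
    have "- (int i + 1) = - int i - 1" "s - of_int (int i + 1) = s + of_int 0 - 1 - of_nat i"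
      "(of_int (int i + 1) :: complex) = of_nat (Suc i)" for i by simp_all
    then show ?thesis using True unfolding hleft_def int_h_term_def by (simp only: when_simps) simp
  qed (simp add: c0 int_h_term_def)
  finally show ?thesis .
qed

lemma mult_int_h_plus:
  assumes "truncated Z"
  shows "((\<lambda>s k u. Z s u when k = 0) \<odot> int_h_plus sc2 h02) s k u =
    (hright (\<lambda>i. - 1 / of_nat i) 0 Z s u when k = 0) + (Z s (heis sc2 h02 0 u) when k = 1)"
proof -
  note Z0 = truncated_zero_arg[OF assms]
  let ?c = "\<lambda>e u. int_h_term sc2 h02 e u when e < 0"
  have "((\<lambda>s k u. Z s u when k = 0) \<odot> int_h_plus sc2 h02) s k u =
      Sum_any (\<lambda>(t, j). (Z (s - t) (int_h_plus sc2 h02 t j u) when k - j = 0) when j \<le> k)"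
    by (simp add: ls_mult_def)
  also have "\<dots> = Sum_any (\<lambda>t. Z (s - t) (int_h_plus sc2 h02 t k u))"
    by (subst Sum_any_reindex_inj[of "\<lambda>t. (t, k)"]) (auto simp: inj_def when_def image_iff)
  also have "\<dots> = (hright (\<lambda>i. - 1 / of_nat i) 0 Z s u when k = 0) + (Z s (heis sc2 h02 0 u) when k = 1)"
  proof -
    consider "k = 0" | "k = 1" | "k \<ge> 2" by linarith
    then show ?thesis
    proof cases
      case 1
      have "Sum_any (\<lambda>t. Z (s - t) (int_h_plus sc2 h02 t k u)) = Sum_any (\<lambda>e. Z (s - of_int e) (int_h_plus sc2 h02 (of_int e) k u))"
        by (rule Sum_any_reindex_inj)
          (auto simp: inj_def int_h_plus_def ls_add_def ls_log_def ls_int_def 1 when_def Z0 elim!: Ints_cases)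
      also have "\<dots> = Sum_any (\<lambda>e. Z (s - of_int e) (?c e u))"
        by (simp add: 1 int_h_plus_def ls_add_def ls_log_def ls_int_of_int)
      also have "\<dots> = Sum_any (\<lambda>i. Z (s - of_int (- int i)) (?c (- int i) u))"
      proof (rule Sum_any_reindex_inj)
        fix e :: int assume e: "e \<notin> range (\<lambda>i. - int i)"
        show "Z (s - of_int e) (?c e u) = 0"
        proof (cases "e < 0")
          case True
          then have "e = - int (nat (- e))" by simp
          then show ?thesis using e by blast
        qed (simp add: Z0)
      qed (auto simp: inj_def)
      also have "\<dots> = hright (\<lambda>i. - 1 / of_nat i) 0 Z s u"
        unfolding hright_def
      proof (rule Sum_any.cong)
        fix i
        show "Z (s - of_int (- int i)) (?c (- int i) u) =
            s3 (- 1 / of_nat i) (Z (s + of_int 0 + of_nat i) (heis sc2 h02 (int i) u))"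
          \<comment> \<open>At \<open>i = 0\<close> both sides vanish: the left one because
            \<open>e < 0\<close> fails, the right one because \<open>- 1 / 0 = 0\<close>.\<close>
          by (cases "i = 0") (simp_all add: Z0 int_h_term_def linear_scale[OF truncated_linear[OF assms]]
              del: W2.F.scale_minus_left W3.F.scale_minus_left)
      qed
      finally show ?thesis by (simp add: 1)
    next
      case 2
      have "Sum_any (\<lambda>t. Z (s - t) (int_h_plus sc2 h02 t k u)) = (\<Sum>t\<in>{0}. Z (s - t) (int_h_plus sc2 h02 t k u))"
        by (rule Sum_any.expand_superset)
          (auto simp: int_h_plus_def ls_add_def ls_log_def ls_int_def 2 when_def Z0)
      then show ?thesis by (simp add: 2 int_h_plus_def ls_add_def ls_log_def ls_int_def)
    next
      case 3
      then have "int_h_plus sc2 h02 t k u = 0" for t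
        by (simp add: int_h_plus_def ls_add_def ls_log_def ls_int_def)
      then show ?thesis using 3 by (simp add: Z0)
    qed
  qed
  finally show ?thesis .
qed

lemma base_eq:
  assumes "N w = w'" and R: "\<And>s k u. R s k u = (u when s = lam * lam \<and> k = 0)"
  defines "F \<equiv> \<lambda>w. E_minus sc3 h03 lam \<odot> E_plus sc3 h03 lam \<odot> ls_const (Poly_Mapping.map (T w)) \<odot> R"
  shows "base w = int_h_minus sc3 h03 \<odot> F w' \<oplus> F w' \<odot> int_h_plus sc2 h02 \<oplus> F w"
proof (intro ext)
  fix s k u
  show "base w s k u = (int_h_minus sc3 h03 \<odot> F w' \<oplus> F w' \<odot> int_h_plus sc2 h02 \<oplus> F w) s k u"
    unfolding F_def series_Phi[OF R] ls_add_def int_h_minus_mult mult_int_h_plus[OF truncated_Phi]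
    by (auto simp: base_def assms(1) integral_def hop_def heis2_0 linear_scale[OF truncated_linear[OF truncated_Phi]])
qed

lemma base_eq_Phi:
  assumes "N w = 0" and R: "\<And>s k u. R s k u = (u when s = lam * lam \<and> k = 0)"
  shows "base w = E_minus sc3 h03 lam \<odot> E_plus sc3 h03 lam \<odot> ls_const (Poly_Mapping.map (T w)) \<odot> R"
proof -
  have "Phi 0 = (\<lambda>s u. 0)" using Phi_fun_scale[of 0 0] by simp
  then show ?thesis
    unfolding series_Phi[OF R] by (intro ext) (simp add: base_def assms(1) integral_def hop_zero when_def)
qed

end

text \<open>On an eigenvector of \<open>fs\<close> with eigenvalue \<open>t\<close>,
  \<open>fn\<close> is multiplication by \<open>c - t\<close>, and nilpotency forces this to be zero
  there. The eigenvectors of \<open>fs\<close> span, so \<open>fn = 0\<close>.\<close>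

lemma semisimple_nilpotent_parts_scalar:
  assumes "vector_space S" and parts: "semisimple_nilpotent_parts S f fs fn" and f: "\<And>u. f u = S c u"
  shows "fs = S c" "fn = (\<lambda>u. 0)"
proof -
  interpret vector_space S by fact
  note p = parts[unfolded semisimple_nilpotent_parts_def]
  have lin: "Vector_Spaces.linear S S fn" using p by blast
  obtain n where n: "\<And>u. (fn ^^ n) u = 0" using p by blast
  have "fn v = 0" if "fs v = S t v" for v t
  proof -
    have v: "fn v = S (c - t) v"
      using p f[of v] that by (metis add_diff_cancel_left' scale_left_diff_distrib)
    have "(fn ^^ k) v = S ((c - t) ^ k) v" for k
      by (induction k) (simp_all add: linear_scale[OF lin] v mult.commute)
    then show ?thesis using n[of v] v by auto
  qed
  moreover have "u \<in> span {v. \<exists>t. fs v = S t v}" for u using p by simp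
  ultimately have 0: "fn u = 0" for u
  proof -
    assume *: "\<And>v t. fs v = S t v \<Longrightarrow> fn v = 0" "\<And>u. u \<in> span {v. \<exists>t. fs v = S t v}"
    show "fn u = 0" using *(2)[of u]
      by (rule span_induct)
        (use * in \<open>auto simp: subspace_def linear_0[OF lin] linear_add[OF lin] linear_scale[OF lin]\<close>)
  qed
  then show "fn = (\<lambda>u. 0)" by auto
  show "fs = S c" using p 0 f by (intro ext) (metis add.right_neutral)
qed

text \<open>The description in \<open>eigen_component\<close> has a unique solution: for
  \<open>s = c\<close> the other eigenvectors are only 0, and for \<open>s \<noteq> c\<close> every
  vector is one of them while the \<open>s\<close>-eigenspace is zero.\<close>

lemma x_power_scalar:
  assumes "vector_space S"
  shows "x_power S (S c) s k u = (u when s = c \<and> k = 0)"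
proof -
  interpret vector_space S by fact
  have "eigen_component S (S c) s u = (u when s = c)"
  proof (cases "s = c")
    case True
    have "v = 0" if "t \<noteq> c" "S c v = S t v" for t v
      using that by (simp add: scale_cancel_right)
    then have "{v. \<exists>t. t \<noteq> s \<and> S c v = S t v} = {0}"
      using True by (auto intro: exI[of _ "c + 1"])
    then have "span {v. \<exists>t. t \<noteq> s \<and> S c v = S t v} = {0}" by simp
    then show ?thesis using True by (auto simp: eigen_component_def intro!: the_equality)
  next
    case False
    then have "{v. \<exists>t. t \<noteq> s \<and> S c v = S t v} = UNIV" by (auto intro: exI[of _ c])
    then show ?thesis using False by (auto simp: eigen_component_def intro!: the_equality)
  qed
  then show ?thesis by (auto simp: x_power_def when_def)
qed

theorem corollary11p1:
  fixes p :: nat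
    and sc :: "complex \<Rightarrow> 'a::ab_group_add \<Rightarrow> 'a" and h0 :: "'a \<Rightarrow> 'a" and w1 w2 :: 'a
    and sc1 :: "complex \<Rightarrow> 'b::ab_group_add \<Rightarrow> 'b" and h01 :: "'b \<Rightarrow> 'b"
    and h0\<beta> :: "complex \<Rightarrow> complex"
    and T :: "'a \<Rightarrow> complex \<Rightarrow> 'b"
    and hs hn :: "complex fock \<Rightarrow> complex fock"
  assumes p: "p \<ge> 2"
    \<comment> \<open>\<open>\<Omega>\<close>\<close>
    and "vector_space sc" and "Vector_Spaces.linear sc sc h0"
    and "w1 \<noteq> w2" and "\<not> module.dependent sc {w1, w2}" and "module.span sc {w1, w2} = UNIV"
    and "h0 w1 = sc (lambda p) w1" and "h0 w2 = sc (lambda p) w2 + w1"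
    \<comment> \<open>\<open>\<Omega>\<^sub>1\<close>\<close>
    and "vector_space sc1" and "Vector_Spaces.linear sc1 sc1 h01"
    and "vector_space.dim sc1 (UNIV :: 'b set) = 2"
    and "((\<lambda>u. h01 u - sc1 (2 * lambda p) u) ^^ 2) = (\<lambda>u. 0)"
    and "h01 \<noteq> sc1 (2 * lambda p)"
    \<comment> \<open>\<open>\<complex>\<^sub>\<beta>\<close>\<close>
    and h0\<beta>: "h0\<beta> = (\<lambda>c. hform 1 (beta p) * c)"
    \<comment> \<open>\<open>T\<close> corresponds to an isomorphism of \<open>\<Omega> \<otimes> \<complex>\<^sub>\<beta>\<close>, spanned by the \<open>w \<otimes> 1\<close>, with \<open>\<Omega>\<^sub>1\<close>\<close>
    and "\<forall>c. Vector_Spaces.linear sc sc1 (\<lambda>w. T w c)"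
    and "\<forall>w. Vector_Spaces.linear (*) sc1 (T w)"
    and "\<forall>w c. h01 (T w c) = T (h0 w) c + T w (h0\<beta> c)"
    and "bij (\<lambda>w. T w 1)"
    \<comment> \<open>\<open>h\<^sub>s(0)\<close> and \<open>h\<^sub>n(0)\<close> on \<open>M(1, \<beta>)\<close>\<close>
    and "semisimple_nilpotent_parts (fock_scale (*)) (heis (*) h0\<beta> 0) hs hn"
  shows "\<exists>\<Y> :: 'a fock \<Rightarrow> (complex fock, 'b fock) log_series.
    log_intertwining_operator (M1_bar p) (omega p)
      (fock_module sc1 h01) (fock_module sc h0) (fock_module (*) h0\<beta>) \<Y> \<and>
    (let Em = E_minus sc1 h01 (lambda p);
         Ep = E_plus sc1 h01 (lambda p);
         T' = (\<lambda>w. ls_const (Poly_Mapping.map (T w)));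
         R = (ls_const (\<lambda>u. u) \<oplus> ls_log (\<lambda>u. fock_scale (*) (lambda p) (hn u))) \<odot>
             x_power (fock_scale (*)) (\<lambda>u. fock_scale (*) (lambda p) (hs u))
     in \<Y> (Poly_Mapping.single {#} w1) = Em \<odot> Ep \<odot> T' w1 \<odot> R \<and>
        \<Y> (Poly_Mapping.single {#} w2) =
          int_h_minus sc1 h01 \<odot> Em \<odot> Ep \<odot> T' w1 \<odot> R \<oplus>
          (Em \<odot> Ep \<odot> T' w1 \<odot> R) \<odot> int_h_plus (*) h0\<beta> \<oplus>
          Em \<odot> Ep \<odot> T' w2 \<odot> R)"
proof -
  let ?m = "(*) :: complex \<Rightarrow> complex \<Rightarrow> complex"
  note vs1 = assms(2) and lin1 = assms(3) and span = assms(6) and h0w = assms(7, 8)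
  note vs3 = assms(9) and lin3 = assms(10)
  have vs2: "vector_space ?m"
    by unfold_locales (simp_all add: algebra_simps)
  have h0b: "h0\<beta> c = lambda p * c" for c
    using h_beta_form[of p] p by (simp add: h0\<beta>)
  have lin2: "Vector_Spaces.linear ?m ?m h0\<beta>"
    by (rule linearI[OF vs2 vs2]) (simp_all add: h0b algebra_simps)
  interpret W: vector_space sc by (rule vs1)
  define f where "f w = h0 w - sc (lambda p) w" for w
  have f_linear: "Vector_Spaces.linear sc sc f"
    by (rule linearI[OF vs1 vs1])
      (simp_all add: f_def linear_add[OF lin1] linear_scale[OF lin1] W.scale_right_distrib
        W.scale_right_diff_distrib mult.commute)
  \<comment> \<open>That \<open>h(0) - lam\<close> has square zero is checked on the basis, where it
    sends \<open>w2\<close> to \<open>w1\<close> and \<open>w1\<close> to 0.\<close>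
  have nil: "h0 (f w) = sc (lambda p) (f w)" for w
  proof -
    have "w \<in> W.span {w1, w2}" using span by simp
    then show ?thesis
    proof (rule W.span_induct)
      show "W.subspace {w. h0 (f w) = sc (lambda p) (f w)}"
        by (simp add: W.subspace_def linear_0[OF lin1] linear_add[OF lin1] linear_scale[OF lin1]
            linear_0[OF f_linear] linear_add[OF f_linear] linear_scale[OF f_linear]
            W.scale_right_distrib mult.commute)
    qed (auto simp: f_def h0w linear_0[OF lin1])
  qed
  interpret D: fock_log_data sc h0 ?m h0\<beta> sc1 h01 T "lambda p"
  proof (intro fock_log_data.intro fock_modules.intro fock_space.intro fock_log_data_axioms.intro)
    fix w c
    show "Vector_Spaces.linear sc sc1 (\<lambda>w. T w c)" using assms(15) by blast
    show "Vector_Spaces.linear ?m sc1 (T w)" using assms(16) by blast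
    show "h01 (T w c) = T (h0 w) c + T w (h0\<beta> c)" using assms(17) by blast
    show "h0\<beta> c = lambda p * c" by (rule h0b)
    show "h0 (h0 w - sc (lambda p) w) = sc (lambda p) (h0 w - sc (lambda p) w)"
      using nil by (simp only: f_def)
  qed (rule vs1 lin1 vs2 lin2 vs3 lin3)+
  define R where "R = (ls_const (\<lambda>u. u) \<oplus> ls_log (\<lambda>u. fock_scale ?m (lambda p) (hn u))) \<odot>
    x_power (fock_scale ?m) (\<lambda>u. fock_scale ?m (lambda p) (hs u))"
  note vsf = vector_space_fock[OF vs2]
  \<comment> \<open>On \<open>M(1, beta)\<close> the operator \<open>h(0)\<close> is the scalar
    \<open>lam\<close>, which forces the decomposition; the logarithmic factor in \<open>R\<close>
    is then 1.\<close>
  have hsn: "hs = fock_scale ?m (lambda p)" "hn = (\<lambda>u. 0)"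
    using semisimple_nilpotent_parts_scalar[OF vsf assms(19) D.heis2_0] by auto
  have R: "R s k u = (u when s = lambda p * lambda p \<and> k = 0)" for s k u
  proof -
    have "ls_const (\<lambda>u. u) \<oplus> ls_log (\<lambda>u. fock_scale ?m (lambda p) (hn u)) = ls_const (\<lambda>u. u)"
      by (auto simp: fun_eq_iff ls_add_def ls_log_def hsn when_def)
    moreover have "(\<lambda>u. fock_scale ?m (lambda p) (hs u)) = fock_scale ?m (lambda p * lambda p)"
      by (intro ext) (simp add: hsn)
    ultimately show ?thesis
      by (simp add: R_def ls_const_mult x_power_scalar[OF vsf])
  qed
  \<comment> \<open>These two values turn the uniform formula into the two prescribed ones: for
    \<open>w1\<close> the integral terms disappear, and for \<open>w2\<close> they contain
    \<open>T(w1)\<close>.\<close>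
  have N: "D.N w1 = 0" "D.N w2 = w1" by (simp_all add: D.N_def h0w)
  have "log_intertwining_operator (M1_bar p) (omega p)
      (fock_module sc1 h01) (fock_module sc h0) (fock_module ?m h0\<beta>) D.Y"
    using p by (intro D.log_intertwining) simp
  then show ?thesis
    unfolding Let_def R_def[symmetric]
    using D.Y_vac D.base_eq_Phi[OF N(1) R] D.base_eq[OF N(2) R] by (intro exI[of _ D.Y]) simp
qed

end
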